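(* Let $\rho_{ABE}$ be a tripartite state and let $|\psi\rangle\langle\psi|_{AA'BB'E}$ be a pure state with $\rho_{ABE}=\mathrm{Tr}_{A'B'}|\psi\rangle\langle\psi|_{AA'BB'E}$. Put $\rho_{AA'BB'}=\mathrm{Tr}_E|\psi\rangle\langle\psi|_{AA'BB'E}$, regarded as a bipartite state with Alice holding $AA'$ and Bob holding $BB'$. Then the relative entropy of entanglement is an upper bound on distillable key: $$K_D(\rho_{ABE})\le E_R^\infty(\rho_{AA'BB'})\le E_R(\rho_{AA'BB'}).$$
   Context: Hilbert spaces are finite-dimensional and $\log$ is to base 2. Relative entropy of entanglement of a bipartite state: $E_R(\rho_{AB}):=\inf_{\sigma_{AB}}S(\rho_{AB}\|\sigma_{AB})$, where $S(\rho\|\sigma)=\mathrm{Tr}\,\rho[\log\rho-\log\sigma]$ and the minimisation is over all separable states $\sigma_{AB}=\sum_ip_i\,\rho_A^i\otimes\rho_B^i$. Its regularisation is $E_R^\infty(\rho):=\limsup_{n\to\infty}\frac1nE_R(\rho^{\otimes n})$. Key rate. A tripartite state $\rho_{ABE}$ is a density operator on $\mathcal H_A\otimes\mathcal H_B\otimes\mathcal H_E$, held by Alice, Bob and the adversary Eve. Distance: $\|\rho-\sigma\|:=\frac12\mathrm{Tr}|\rho-\sigma|$. LOPC operation: a concatenation of finitely many steps, each being either (i) a local quantum operation of Bob, $\rho_{ABE}\mapsto(I_{AE}\otimes\Lambda_B)(\rho_{ABE})$ with $\Lambda_B$ completely positive trace preserving (CPTP), or the analogue for Alice; or (ii) public classical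 communication from Alice to Bob: a state $\sum_i\rho^i_{ABE}\otimes|i\rangle\langle i|_{A'}$ ($A'$ a classical register of Alice) is transformed into $\sum_i\rho^i_{ABE}\otimes|iii\rangle\langle iii|_{A'B'E'}$, or the analogue from Bob to Alice. LOPC protocol: a family $\mathcal P=\{\Lambda_n\}_{n\in\mathbb N}$ of CPTP maps $\Lambda_n:(\mathcal H_A\otimes\mathcal H_B\otimes\mathcal H_E)^{\otimes n}\to\mathcal H_A^n\otimes\mathcal H_B^n\otimes\mathcal H_E^n$, each an LOPC operation. Let $\tau^\ell_{ABE}:=\frac1{2^\ell}\sum_{i=1}^{2^\ell}|ii\rangle\langle ii|_{AB}\otimes\tau_E$ for some arbitrary state $\tau_E$. $\mathcal P$ distills key at rate $R_{\mathcal P}$ from $\rho_{ABE}$ if there is a sequence $\{\ell_n\}$ with $\limsup_{n\to\infty}\ell_n/n=R_{\mathcal P}$ and $\lim_{n\to\infty}\|\Lambda_n(\rho_{ABE}^{\otimes n})-\tau^{\ell_n}_{ABE}\|=0$. The key rate (distillable key) is $K_D(\rho_{ABE}):=\sup_{\mathcal P}R_{\mathcal P}$. *)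

theory Defs
  imports
    "Jordan_Normal_Form.Schur_Decomposition"
    "HOL-Library.Extended_Real"
    "HOL-Library.Liminf_Limsup"
begin

text \<open>
  The Hilbert space of dimension \<open>d\<close> is the space of complex vectors of length \<open>d\<close>, and an
  operator on it is a complex \<open>d \<times> d\<close> matrix in the standard basis. Tensor products are
  Kronecker products: the basis vector \<open>|x\<^sub>1\<rangle> \<otimes> \<dots> \<otimes> |x\<^sub>k\<rangle>\<close> of \<open>d\<^sub>1 \<otimes> \<dots> \<otimes> d\<^sub>k\<close> has the number
  whose mixed-radix digits, most significant first, are \<open>x\<^sub>1, \<dots>, x\<^sub>k\<close>. An operator on a tensor
  product does not carry its factorisation, so the dimensions of the factors are passed
  as arguments.
\<close>

section \<open>Operators and states\<close>

definition mtrace :: "complex mat \<Rightarrow> complex" where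
  "mtrace A = (\<Sum>i<dim_row A. A $$ (i, i))"

definition mat_sum :: "nat \<Rightarrow> nat \<Rightarrow> (nat \<Rightarrow> complex mat) \<Rightarrow> nat \<Rightarrow> complex mat" where
  "mat_sum r c F m = mat r c (\<lambda>ij. \<Sum>k<m. F k $$ ij)"

definition kron :: "complex mat \<Rightarrow> complex mat \<Rightarrow> complex mat" where
  "kron A B = mat (dim_row A * dim_row B) (dim_col A * dim_col B)
     (\<lambda>(i, j). A $$ (i div dim_row B, j div dim_col B) * B $$ (i mod dim_row B, j mod dim_col B))"

definition hermitian_mat :: "complex mat \<Rightarrow> bool" where
  "hermitian_mat A \<longleftrightarrow> square_mat A \<and> mat_adjoint A = A"

definition psd :: "complex mat \<Rightarrow> bool" where
  "psd A \<longleftrightarrow> hermitian_mat A \<and> (\<forall>v \<in> carrier_vec (dim_row A). 0 \<le> Re ((A *\<^sub>v v) \<bullet>c v))"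

definition density_op :: "nat \<Rightarrow> complex mat \<Rightarrow> bool" where
  "density_op d \<rho> \<longleftrightarrow> \<rho> \<in> carrier_mat d d \<and> psd \<rho> \<and> mtrace \<rho> = 1"

definition ketbra :: "complex vec \<Rightarrow> complex mat" where
  "ketbra \<psi> = mat (dim_vec \<psi>) (dim_vec \<psi>) (\<lambda>(i, j). \<psi> $ i * cnj (\<psi> $ j))"

definition pure_state :: "nat \<Rightarrow> complex mat \<Rightarrow> bool" where
  "pure_state d P \<longleftrightarrow> (\<exists>\<psi> \<in> carrier_vec d. \<psi> \<bullet>c \<psi> = 1 \<and> P = ketbra \<psi>)"

definition unitary_mat :: "nat \<Rightarrow> complex mat \<Rightarrow> bool" where
  "unitary_mat d U \<longleftrightarrow> U \<in> carrier_mat d d \<and> mat_adjoint U * U = 1\<^sub>m d \<and> U * mat_adjoint U = 1\<^sub>m d"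

text \<open>Functional calculus for a Hermitian operator \<open>A\<close>; the result does not depend on the chosen
  diagonalisation.\<close>

definition spectral_fun :: "(real \<Rightarrow> real) \<Rightarrow> complex mat \<Rightarrow> complex mat" where
  "spectral_fun f A = (THE B. \<exists>U e. unitary_mat (dim_row A) U \<and>
     A = U * mat_diag (dim_row A) (\<lambda>i. complex_of_real (e i)) * mat_adjoint U \<and>
     B = U * mat_diag (dim_row A) (\<lambda>i. complex_of_real (f (e i))) * mat_adjoint U)"

definition trace_dist :: "complex mat \<Rightarrow> complex mat \<Rightarrow> real" where
  "trace_dist \<rho> \<sigma> = Re (mtrace (spectral_fun sqrt (mat_adjoint (\<rho> - \<sigma>) * (\<rho> - \<sigma>)))) / 2"

text \<open>The partial trace over the middle factor of \<open>d1 \<otimes> d2 \<otimes> d3\<close>.\<close>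

definition ptrace :: "nat \<Rightarrow> nat \<Rightarrow> nat \<Rightarrow> complex mat \<Rightarrow> complex mat" where
  "ptrace d1 d2 d3 X = mat (d1 * d3) (d1 * d3) (\<lambda>(i, j).
     \<Sum>k<d2. X $$ ((i div d3 * d2 + k) * d3 + i mod d3, (j div d3 * d2 + k) * d3 + j mod d3))"

text \<open>The operator \<open>X\<close> on \<open>d1 \<otimes> d2 \<otimes> d3 \<otimes> d4\<close>, regarded as an operator on \<open>d1 \<otimes> d3 \<otimes> d2 \<otimes> d4\<close>.\<close>

definition swap_mid :: "nat \<Rightarrow> nat \<Rightarrow> nat \<Rightarrow> nat \<Rightarrow> complex mat \<Rightarrow> complex mat" where
  "swap_mid d1 d2 d3 d4 X =
     (let p = (\<lambda>i. ((i div (d3 * d2 * d4) * d2 + i div d4 mod d2) * d3 + i div (d2 * d4) mod d3) * d4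
                   + i mod d4)
      in mat (d1 * d3 * d2 * d4) (d1 * d3 * d2 * d4) (\<lambda>(i, j). X $$ (p i, p j)))"

text \<open>The \<open>n\<close>-th tensor power of an operator on \<open>A \<otimes> B\<close>, with its factors regrouped so that it is
  an operator on \<open>A\<^sup>n \<otimes> B\<^sup>n\<close>; likewise for \<open>A \<otimes> B \<otimes> E\<close>.\<close>

fun tensor_pow2 :: "nat \<Rightarrow> nat \<Rightarrow> complex mat \<Rightarrow> nat \<Rightarrow> complex mat" where
  "tensor_pow2 dA dB \<rho> 0 = 1\<^sub>m 1"
| "tensor_pow2 dA dB \<rho> (Suc n) =
     swap_mid (dA ^ n) (dB ^ n) dA dB (kron (tensor_pow2 dA dB \<rho> n) \<rho>)"

fun tensor_pow3 :: "nat \<Rightarrow> nat \<Rightarrow> nat \<Rightarrow> complex mat \<Rightarrow> nat \<Rightarrow> complex mat" where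
  "tensor_pow3 dA dB dE \<rho> 0 = 1\<^sub>m 1"
| "tensor_pow3 dA dB dE \<rho> (Suc n) =
     swap_mid (dA ^ n * dA * dB ^ n) (dE ^ n) dB dE
       (swap_mid (dA ^ n) (dB ^ n * dE ^ n) dA (dB * dE)
         (kron (tensor_pow3 dA dB dE \<rho> n) \<rho>))"

section \<open>Relative entropy of entanglement\<close>

text \<open>The logarithm of a positive operator is taken on its support; \<open>S(\<rho>\<parallel>\<sigma>) = \<infinity>\<close> unless
  \<open>supp \<rho> \<subseteq> supp \<sigma>\<close>, that is, unless \<open>ker \<sigma> \<subseteq> ker \<rho>\<close>.\<close>

definition op_log2 :: "complex mat \<Rightarrow> complex mat" where
  "op_log2 = spectral_fun (\<lambda>x. if x > 0 then log 2 x else 0)"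

definition rel_entropy :: "complex mat \<Rightarrow> complex mat \<Rightarrow> ereal" where
  "rel_entropy \<rho> \<sigma> =
     (if \<forall>v \<in> carrier_vec (dim_row \<rho>). \<sigma> *\<^sub>v v = 0\<^sub>v (dim_row \<rho>) \<longrightarrow> \<rho> *\<^sub>v v = 0\<^sub>v (dim_row \<rho>)
      then ereal (Re (mtrace (\<rho> * (op_log2 \<rho> - op_log2 \<sigma>))))
      else \<infinity>)"

definition separable_state :: "nat \<Rightarrow> nat \<Rightarrow> complex mat \<Rightarrow> bool" where
  "separable_state dA dB \<sigma> \<longleftrightarrow> (\<exists>(m::nat) (p :: nat \<Rightarrow> real) \<alpha> \<beta>.
     (\<forall>i<m. 0 \<le> p i \<and> density_op dA (\<alpha> i) \<and> density_op dB (\<beta> i)) \<and> (\<Sum>i<m. p i) = 1 \<and>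
     \<sigma> = mat_sum (dA * dB) (dA * dB) (\<lambda>i. complex_of_real (p i) \<cdot>\<^sub>m kron (\<alpha> i) (\<beta> i)) m)"

definition rel_ent_entanglement :: "nat \<Rightarrow> nat \<Rightarrow> complex mat \<Rightarrow> ereal" where
  "rel_ent_entanglement dA dB \<rho> = (INF \<sigma> \<in> {\<sigma>. separable_state dA dB \<sigma>}. rel_entropy \<rho> \<sigma>)"

definition reg_rel_ent_entanglement :: "nat \<Rightarrow> nat \<Rightarrow> complex mat \<Rightarrow> ereal" where
  "reg_rel_ent_entanglement dA dB \<rho> =
     limsup (\<lambda>n. rel_ent_entanglement (dA ^ n) (dB ^ n) (tensor_pow2 dA dB \<rho> n) / ereal (real n))"

section \<open>Local operations and public communication\<close>

text \<open>The map \<open>I \<otimes> \<Lambda> \<otimes> I\<close> on operators on \<open>d1 \<otimes> d2 \<otimes> d3\<close>, where \<open>\<Lambda>\<close> sends operators on \<open>d2\<close> to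
  operators on \<open>m\<close>: it applies \<open>\<Lambda>\<close> to each block of \<open>X\<close> that is obtained by fixing the row and
  column indices of the outer factors.\<close>

definition ampliate ::
  "nat \<Rightarrow> nat \<Rightarrow> nat \<Rightarrow> nat \<Rightarrow> (complex mat \<Rightarrow> complex mat) \<Rightarrow> complex mat \<Rightarrow> complex mat" where
  "ampliate d1 d2 d3 m \<Lambda> X = mat (d1 * m * d3) (d1 * m * d3) (\<lambda>(i, j).
     \<Lambda> (mat d2 d2 (\<lambda>(k, l). X $$ ((i div (m * d3) * d2 + k) * d3 + i mod d3,
                                (j div (m * d3) * d2 + l) * d3 + j mod d3)))
       $$ (i div d3 mod m, j div d3 mod m))"

definition cptp :: "nat \<Rightarrow> nat \<Rightarrow> (complex mat \<Rightarrow> complex mat) \<Rightarrow> bool" where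
  "cptp d m \<Lambda> \<longleftrightarrow>
     (\<forall>X \<in> carrier_mat d d. \<Lambda> X \<in> carrier_mat m m \<and> mtrace (\<Lambda> X) = mtrace X) \<and>
     (\<forall>X \<in> carrier_mat d d. \<forall>Y \<in> carrier_mat d d. \<Lambda> (X + Y) = \<Lambda> X + \<Lambda> Y) \<and>
     (\<forall>c. \<forall>X \<in> carrier_mat d d. \<Lambda> (c \<cdot>\<^sub>m X) = c \<cdot>\<^sub>m \<Lambda> X) \<and>
     (\<forall>k. \<forall>X \<in> carrier_mat (k * d) (k * d). psd X \<longrightarrow> psd (ampliate k d 1 m \<Lambda> X))"

definition ket :: "nat \<Rightarrow> nat \<Rightarrow> complex mat" where
  "ket d i = mat d 1 (\<lambda>(k, _). if k = i then 1 else 0)"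

definition basis_proj :: "nat \<Rightarrow> nat \<Rightarrow> complex mat" where
  "basis_proj d i = ket d i * mat_adjoint (ket d i)"

text \<open>Public communication of a register of dimension \<open>m\<close>, as a map on all operators. From Alice
  to Bob, Alice's system is \<open>dA \<otimes> m\<close> with the register \<open>A'\<close> last, and
  \<open>X \<mapsto> \<Sum>\<^sub>i V\<^sub>i X V\<^sub>i\<^sup>\<dagger>\<close> with \<open>V\<^sub>i = I \<otimes> |i\<rangle>\<langle>i| \<otimes> (I \<otimes> |i\<rangle>) \<otimes> (I \<otimes> |i\<rangle>)\<close>. If the register is
  classical, \<open>X = \<Sum>\<^sub>i \<rho>\<^sub>i \<otimes> |i\<rangle>\<langle>i|\<close>, then this is \<open>\<Sum>\<^sub>i \<rho>\<^sub>i \<otimes> |iii\<rangle>\<langle>iii|\<close>; on other operators Alice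
  first measures the register, which is itself a local operation.\<close>

definition public_AB :: "nat \<Rightarrow> nat \<Rightarrow> nat \<Rightarrow> nat \<Rightarrow> complex mat \<Rightarrow> complex mat" where
  "public_AB dA m dB dE X =
     (let V = (\<lambda>i. kron (kron (kron (1\<^sub>m dA) (basis_proj m i)) (kron (1\<^sub>m dB) (ket m i)))
                     (kron (1\<^sub>m dE) (ket m i)));
          D = dA * m * (dB * m) * (dE * m)
      in mat_sum D D (\<lambda>i. V i * X * mat_adjoint (V i)) m)"

definition public_BA :: "nat \<Rightarrow> nat \<Rightarrow> nat \<Rightarrow> nat \<Rightarrow> complex mat \<Rightarrow> complex mat" where
  "public_BA dA dB m dE X =
     (let V = (\<lambda>i. kron (kron (kron (1\<^sub>m dA) (ket m i)) (kron (1\<^sub>m dB) (basis_proj m i)))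
                     (kron (1\<^sub>m dE) (ket m i)));
          D = dA * m * (dB * m) * (dE * m)
      in mat_sum D D (\<lambda>i. V i * X * mat_adjoint (V i)) m)"

inductive lopc ::
  "nat \<times> nat \<times> nat \<Rightarrow> nat \<times> nat \<times> nat \<Rightarrow> (complex mat \<Rightarrow> complex mat) \<Rightarrow> bool" for ds where
  none: "lopc ds ds (\<lambda>X. X)"
| local_A: "lopc ds (dA, dB, dE) F \<Longrightarrow> cptp dA m \<Lambda> \<Longrightarrow>
    lopc ds (m, dB, dE) (\<lambda>X. ampliate 1 dA (dB * dE) m \<Lambda> (F X))"
| local_B: "lopc ds (dA, dB, dE) F \<Longrightarrow> cptp dB m \<Lambda> \<Longrightarrow>
    lopc ds (dA, m, dE) (\<lambda>X. ampliate dA dB dE m \<Lambda> (F X))"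
| public_A: "lopc ds (dA * m, dB, dE) F \<Longrightarrow>
    lopc ds (dA * m, dB * m, dE * m) (\<lambda>X. public_AB dA m dB dE (F X))"
| public_B: "lopc ds (dA, dB * m, dE) F \<Longrightarrow>
    lopc ds (dA * m, dB * m, dE * m) (\<lambda>X. public_BA dA dB m dE (F X))"

section \<open>Distillable key\<close>

text \<open>\<open>\<tau>\<^sup>\<ell>\<close> as a state on \<open>a \<otimes> b \<otimes> E\<close>, where the output spaces \<open>a, b \<ge> 2\<^sup>\<ell>\<close> may be larger than the
  key, which then occupies their first \<open>2\<^sup>\<ell>\<close> basis vectors.\<close>

definition key_state :: "nat \<Rightarrow> nat \<Rightarrow> nat \<Rightarrow> complex mat \<Rightarrow> complex mat" where
  "key_state a b l \<tau> =
     kron ((1 / 2 ^ l) \<cdot>\<^sub>m mat_sum (a * b) (a * b) (\<lambda>i. kron (basis_proj a i) (basis_proj b i)) (2 ^ l)) \<tau>"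

text \<open>In the two definitions below, \<open>a n\<close>, \<open>b n\<close>, \<open>e n\<close> are the dimensions of the output spaces of
  the \<open>n\<close>-th map \<open>P n\<close> of the protocol.\<close>

definition lopc_protocol :: "nat \<Rightarrow> nat \<Rightarrow> nat \<Rightarrow> (nat \<Rightarrow> nat) \<Rightarrow> (nat \<Rightarrow> nat) \<Rightarrow> (nat \<Rightarrow> nat) \<Rightarrow>
    (nat \<Rightarrow> complex mat \<Rightarrow> complex mat) \<Rightarrow> bool" where
  "lopc_protocol dA dB dE a b e P \<longleftrightarrow>
     (\<forall>n. lopc (dA ^ n, dB ^ n, dE ^ n) (a n, b n, e n) (P n))"

definition distills_at_rate :: "nat \<Rightarrow> nat \<Rightarrow> nat \<Rightarrow> complex mat \<Rightarrow>
    (nat \<Rightarrow> nat) \<Rightarrow> (nat \<Rightarrow> nat) \<Rightarrow> (nat \<Rightarrow> nat) \<Rightarrow> (nat \<Rightarrow> complex mat \<Rightarrow> complex mat) \<Rightarrow>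
    ereal \<Rightarrow> bool" where
  "distills_at_rate dA dB dE \<rho> a b e P R \<longleftrightarrow>
     (\<exists>(l :: nat \<Rightarrow> nat) \<tau>.
        (\<forall>n. 2 ^ l n \<le> a n \<and> 2 ^ l n \<le> b n \<and> density_op (e n) (\<tau> n)) \<and>
        limsup (\<lambda>n. ereal (real (l n) / real n)) = R \<and>
        (\<lambda>n. trace_dist (P n (tensor_pow3 dA dB dE \<rho> n)) (key_state (a n) (b n) (l n) (\<tau> n)))
          \<longlonglongrightarrow> 0)"

definition key_rate :: "nat \<Rightarrow> nat \<Rightarrow> nat \<Rightarrow> complex mat \<Rightarrow> ereal" where
  "key_rate dA dB dE \<rho> =
     Sup {R. \<exists>a b e P. lopc_protocol dA dB dE a b e P \<and> distills_at_rate dA dB dE \<rho> a b e P R}"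

end

theory Submission
  imports Defs "Jordan_Normal_Form.Spectral_Radius" "HOL-Analysis.L2_Norm"
begin

text \<open>
  A distillation protocol is turned into a test that is hard for separable states. Written with Kraus
  operators, an LOPC operation is a sum over the transcripts \<open>c\<close> of the public communication, where
  Alice and Bob act by product operators and Eve only learns \<open>c\<close>. If the output is close to a key
  that is independent of Eve, then on the purification the (unnormalised) states that belong to the
  various key values have almost the same marginal on Eve's side, so for each transcript and key value
  \<open>i\<close> the polar decomposition provides a contraction \<open>Z\<close> of the systems of Alice and Bob that maps
  this state close to a fixed one (by the Powers-Stormer inequality). Summing over the \<open>2\<^sup>l\<close> key values
  with weight \<open>2\<^sup>-\<^sup>l\<^sup>/\<^sup>2\<close> gives an operator \<open>W\<close> that preserves almost all of the norm of the purification, while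
  by the Cauchy-Schwarz inequality \<open>W\<close> maps product vectors of norm \<open>1\<close> to vectors of squared norm at most
  \<open>2\<^sup>-\<^sup>l\<close>. Hence \<open>W\<^sup>\<dagger> W\<close> tests the given state against all separable states \<open>\<sigma>\<close>, and such a
  test bounds \<open>S(\<rho>\<parallel>\<sigma>)\<close> from below by about \<open>l\<close>. For the last step no data processing inequality is
  needed: \<open>S(\<rho>\<parallel>\<sigma>)\<close> is a classical relative entropy of distributions on pairs of eigenvectors,
  which inherit the distinguishability of \<open>\<rho>\<close> and \<open>\<sigma>\<close>. The second inequality is the additivity of the
  relative entropy on tensor powers.
\<close>

section \<open>Vectors as functions\<close>

text \<open>The dimensions of the outputs and the number of transcripts may grow arbitrarily fast
  with the number n of copies. A continuity estimate for entropies would bring in the logarithm of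
  such a dimension; a binary test brings in only its two error probabilities. With t the trace
  distance to the key state, the test rejects the given state with probability at most 2 sqrt(2 t).
  The entropy bound then reads (1 - 2 (error + c / 2 ^ l)) log c - 2 for every c >= 1. Taking c =
  \<delta> * 2 ^ l costs log \<delta>, a constant that disappears on division by n, so only the
  factor 1 - 4 \<delta> has to be driven to 1 afterwards. The other obstacle is that completeness
  holds only for the sum over all transcripts, while product structure and the factorisation of
  norms hold only inside one transcript. Therefore W keeps the transcript in its output: every
  estimate is made inside one transcript, and the results are added up.\<close>

definition sqnorm :: "'a set \<Rightarrow> ('a \<Rightarrow> complex) \<Rightarrow> real" where
  "sqnorm K v = (\<Sum>k\<in>K. (cmod (v k))\<^sup>2)"

lemma sqnorm_nonneg [simp]: "0 \<le> sqnorm K v"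
  unfolding sqnorm_def by (simp add: sum_nonneg)

lemma sqrt_sqnorm: "sqrt (sqnorm K v) = L2_set (\<lambda>k. cmod (v k)) K"
  unfolding sqnorm_def L2_set_def by simp

lemma of_real_sqnorm: "complex_of_real (sqnorm K v) = (\<Sum>k\<in>K. v k * cnj (v k))"
  unfolding sqnorm_def of_real_sum by (simp only: complex_norm_square)

lemma sqnorm_scale: "sqnorm K (\<lambda>k. c * v k) = (cmod c)\<^sup>2 * sqnorm K v"
  unfolding sqnorm_def by (simp add: norm_mult power_mult_distrib sum_distrib_left)

lemma sqnorm_Times:
  "sqnorm (I \<times> J) v = (\<Sum>i\<in>I. sqnorm J (\<lambda>j. v (i, j)))"
  unfolding sqnorm_def sum.cartesian_product by simp

lemma sqnorm_cnj: "sqnorm K (\<lambda>k. cnj (v k)) = sqnorm K v"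
  unfolding sqnorm_def by simp

lemma sqnorm_prod:
  "sqnorm (I \<times> J) (\<lambda>(i, j). v i * w j) = sqnorm I v * sqnorm J w"
  unfolding sqnorm_Times
  by (simp add: sqnorm_scale sum_distrib_right[symmetric]) (simp add: sqnorm_def)

lemma sum_mult_le_sqnorm:
  "cmod (\<Sum>k\<in>K. v k * w k) \<le> sqrt (sqnorm K v) * sqrt (sqnorm K w)"
proof -
  have "cmod (\<Sum>k\<in>K. v k * w k) \<le> (\<Sum>k\<in>K. \<bar>cmod (v k)\<bar> * \<bar>cmod (w k)\<bar>)"
    by (rule order_trans[OF norm_sum]) (simp add: norm_mult)
  also have "\<dots> \<le> sqrt (sqnorm K v) * sqrt (sqnorm K w)"
    unfolding sqrt_sqnorm by (rule L2_set_mult_ineq)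
  finally show ?thesis .
qed

lemma sqrt_sqnorm_add:
  "sqrt (sqnorm K (\<lambda>k. v k + w k)) \<le> sqrt (sqnorm K v) + sqrt (sqnorm K w)"
proof -
  have "L2_set (\<lambda>k. cmod (v k + w k)) K \<le> L2_set (\<lambda>k. cmod (v k) + cmod (w k)) K"
    by (rule L2_set_mono) (auto intro: norm_triangle_ineq)
  also have "\<dots> \<le> L2_set (\<lambda>k. cmod (v k)) K + L2_set (\<lambda>k. cmod (w k)) K"
    by (rule L2_set_triangle_ineq)
  finally show ?thesis unfolding sqrt_sqnorm .
qed

lemma sqrt_sqnorm_sum:
  assumes "finite I"
  shows "sqrt (sqnorm K (\<lambda>k. \<Sum>i\<in>I. v i k)) \<le> (\<Sum>i\<in>I. sqrt (sqnorm K (v i)))"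
  using assms
proof (induction I rule: finite_induct)
  case empty
  then show ?case by (simp add: sqnorm_def)
next
  case (insert x I)
  have "sqrt (sqnorm K (\<lambda>k. v x k + (\<Sum>i\<in>I. v i k))) \<le>
     sqrt (sqnorm K (v x)) + sqrt (sqnorm K (\<lambda>k. \<Sum>i\<in>I. v i k))"
    by (rule sqrt_sqnorm_add)
  with insert show ?case by simp
qed

lemma sqnorm_sum_le:
  assumes "finite I"
  shows "sqnorm K (\<lambda>k. \<Sum>i\<in>I. v i k) \<le> (\<Sum>i\<in>I. sqrt (sqnorm K (v i)))\<^sup>2"
  using sqrt_sqnorm_sum[OF assms, of K v] by (simp add: sqrt_le_D sum_nonneg)

lemma sum_power2_le: "(\<Sum>i\<in>I. (f i :: real))\<^sup>2 \<le> real (card I) * (\<Sum>i\<in>I. (f i)\<^sup>2)"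
proof -
  have "(\<Sum>i\<in>I. f i)\<^sup>2 \<le> (\<Sum>i\<in>I. \<bar>f i\<bar>)\<^sup>2"
    by (rule abs_le_square_iff[THEN iffD1]) (simp add: sum_nonneg order_trans[OF sum_abs])
  also have "\<dots> \<le> (L2_set (\<lambda>_. 1) I * L2_set f I)\<^sup>2"
    by (rule power_mono) (use L2_set_mult_ineq[of "\<lambda>_. 1" f I] in \<open>simp_all add: sum_nonneg\<close>)
  also have "\<dots> = real (card I) * (\<Sum>i\<in>I. (f i)\<^sup>2)"
    by (simp add: power_mult_distrib L2_set_def sum_nonneg)
  finally show ?thesis .
qed

text \<open>With \<open>y\<close> the image of \<open>x\<close> under the adjoint, |y|^2 = <W y, x>
  <= |W y| |x| <= |y| |x|, and one factor |y| cancels. Contraction bounds thus pass to adjoints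
  without operator norms or spectra.\<close>

lemma adjoint_contraction:
  assumes fin: "finite K" "finite Z"
    and contr: "\<And>v. sqnorm Z (\<lambda>z. \<Sum>k\<in>K. w z k * v k) \<le> sqnorm K v"
  shows "sqnorm K (\<lambda>k. \<Sum>z\<in>Z. cnj (w z k) * x z) \<le> sqnorm Z x"
proof -
  define y where "y k = (\<Sum>z\<in>Z. cnj (w z k) * x z)" for k
  have "complex_of_real (sqnorm K y) = (\<Sum>k\<in>K. \<Sum>z\<in>Z. y k * (w z k * cnj (x z)))"
    unfolding of_real_sqnorm by (simp add: y_def sum_distrib_left)
  also have "\<dots> = (\<Sum>z\<in>Z. (\<Sum>k\<in>K. w z k * y k) * cnj (x z))"
    by (subst sum.swap) (simp add: sum_distrib_right sum_distrib_left mult_ac)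
  finally have "sqnorm K y = cmod (\<Sum>z\<in>Z. (\<Sum>k\<in>K. w z k * y k) * cnj (x z))"
    by (metis abs_of_nonneg norm_of_real sqnorm_nonneg)
  also have "\<dots> \<le> sqrt (sqnorm Z (\<lambda>z. \<Sum>k\<in>K. w z k * y k)) * sqrt (sqnorm Z (\<lambda>z. cnj (x z)))"
    by (rule sum_mult_le_sqnorm)
  also have "\<dots> \<le> sqrt (sqnorm K y) * sqrt (sqnorm Z x)"
    unfolding sqnorm_cnj by (rule mult_right_mono) (auto intro: contr)
  finally have le: "sqnorm K y \<le> sqrt (sqnorm K y) * sqrt (sqnorm Z x)" .
  have "sqnorm K y \<le> sqnorm Z x"
  proof (cases "sqnorm K y = 0")
    case False
    then have pos: "0 < sqrt (sqnorm K y)" by (simp add: order_less_le)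
    have "sqrt (sqnorm K y) * sqrt (sqnorm K y) \<le> sqrt (sqnorm K y) * sqrt (sqnorm Z x)"
      using le by simp
    with pos show ?thesis by (simp only: mult_le_cancel_left_pos real_sqrt_le_iff)
  qed simp
  then show ?thesis unfolding y_def by simp
qed

section \<open>Orthonormal bases\<close>

text \<open>\<open>u k i\<close> is the \<open>i\<close>-th component of the \<open>k\<close>-th vector.\<close>

definition onb :: "nat \<Rightarrow> (nat \<Rightarrow> nat \<Rightarrow> complex) \<Rightarrow> bool" where
  "onb n u \<longleftrightarrow> (\<forall>k<n. \<forall>l<n. (\<Sum>i<n. cnj (u k i) * u l i) = (if k = l then 1 else 0))"

lemma mat_mult_entry:
  "A \<in> carrier_mat m n \<Longrightarrow> B \<in> carrier_mat n p \<Longrightarrow> i < m \<Longrightarrow> j < p \<Longrightarrow>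
    (A * B) $$ (i, j) = (\<Sum>k<n. A $$ (i, k) * B $$ (k, j))"
  by (auto simp: scalar_prod_def atLeast0LessThan intro!: sum.cong)

lemma mat_adjoint_carrier [simp, intro]: "A \<in> carrier_mat m n \<Longrightarrow> mat_adjoint A \<in> carrier_mat n m"
  unfolding mat_adjoint_def by (auto simp: mat_of_rows_def)

lemma mat_adjoint_dim [simp]: "dim_row (mat_adjoint A) = dim_col A" "dim_col (mat_adjoint A) = dim_row A"
  by (simp_all add: mat_adjoint_def mat_of_rows_def)

lemma mat_adjoint_entry [simp]:
  "i < dim_col A \<Longrightarrow> j < dim_row A \<Longrightarrow> mat_adjoint A $$ (i, j) = cnj (A $$ (j, i))"
  unfolding mat_adjoint_def by (simp add: mat_of_rows_def)

text \<open>Orthonormality of n vectors in dimension n says U^dagger U = 1 for a square U, and a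
  left inverse of a square matrix is also a right inverse.\<close>

lemma onb_complete:
  assumes "onb n u" "i < n" "j < n"
  shows "(\<Sum>k<n. u k i * cnj (u k j)) = (if i = j then 1 else 0)"
proof -
  define U where "U = mat n n (\<lambda>(i, k). u k i)"
  have U: "U \<in> carrier_mat n n" "mat_adjoint U \<in> carrier_mat n n" by (auto simp: U_def)
  have "mat_adjoint U * U = 1\<^sub>m n"
  proof (rule eq_matI)
    fix k l assume "k < dim_row (1\<^sub>m n :: complex mat)" "l < dim_col (1\<^sub>m n :: complex mat)"
    then show "(mat_adjoint U * U) $$ (k, l) = 1\<^sub>m n $$ (k, l)"
      using assms(1) by (simp add: mat_mult_entry[OF U(2,1)] del: index_mult_mat)
        (auto simp: U_def onb_def)
  qed (use U in auto)
  then have "U * mat_adjoint U = 1\<^sub>m n"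
    using mat_mult_left_right_inverse[OF U(2,1)] by simp
  then have "(U * mat_adjoint U) $$ (i, j) = 1\<^sub>m n $$ (i, j)" by simp
  then show ?thesis using assms(2,3)
    by (simp add: mat_mult_entry[OF U(1,2)] del: index_mult_mat) (auto simp: U_def)
qed

lemma onbD:
  "onb n u \<Longrightarrow> k < n \<Longrightarrow> l < n \<Longrightarrow> (\<Sum>i<n. cnj (u k i) * u l i) = (if k = l then 1 else 0)"
  by (simp add: onb_def)

lemma onb_sqnorm: "onb n u \<Longrightarrow> k < n \<Longrightarrow> sqnorm {..<n} (u k) = 1"
  using onbD[of n u k k] of_real_sqnorm[of "{..<n}" "u k"]
  by (simp add: mult.commute)

lemma onb_expand:
  assumes "onb n u" "i < n"
  shows "(\<Sum>k<n. (\<Sum>j<n. cnj (u k j) * v j) * u k i) = v i"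
proof -
  have "(\<Sum>k<n. (\<Sum>j<n. cnj (u k j) * v j) * u k i) = (\<Sum>k<n. \<Sum>j<n. v j * (u k i * cnj (u k j)))"
    by (simp add: sum_distrib_left sum_distrib_right mult_ac)
  also have "\<dots> = (\<Sum>j<n. v j * (\<Sum>k<n. u k i * cnj (u k j)))"
    by (subst sum.swap) (simp add: sum_distrib_left)
  also have "\<dots> = (\<Sum>j<n. v j * (if i = j then 1 else 0))"
    by (rule sum.cong) (use onb_complete[OF assms(1,2)] in auto)
  also have "\<dots> = (\<Sum>j<n. if i = j then v j else 0)"
    by (rule sum.cong) auto
  finally show ?thesis using assms(2) by simp
qed

lemma parseval:
  assumes "onb n u"
  shows "(\<Sum>k<n. (cmod (\<Sum>j<n. cnj (u k j) * v j))\<^sup>2) = sqnorm {..<n} v"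
proof -
  define c where "c k = (\<Sum>j<n. cnj (u k j) * v j)" for k
  have "complex_of_real (sqnorm {..<n} v) = (\<Sum>i<n. v i * cnj (\<Sum>k<n. c k * u k i))"
    unfolding of_real_sqnorm
    by (rule sum.cong) (use onb_expand[OF assms, of _ v] in \<open>auto simp: c_def\<close>)
  also have "\<dots> = (\<Sum>k<n. c k * cnj (c k))"
  proof -
    have "(\<Sum>i<n. v i * cnj (\<Sum>k<n. c k * u k i)) = (\<Sum>i<n. \<Sum>k<n. (cnj (u k i) * v i) * cnj (c k))"
      by (simp add: sum_distrib_left mult_ac)
    also have "\<dots> = (\<Sum>k<n. \<Sum>i<n. (cnj (u k i) * v i) * cnj (c k))"
      by (rule sum.swap)
    finally show ?thesis by (simp add: c_def sum_distrib_right)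
  qed
  also have "\<dots> = complex_of_real (sqnorm {..<n} c)" by (simp add: of_real_sqnorm)
  finally show ?thesis unfolding c_def of_real_eq_iff by (simp add: sqnorm_def)
qed

text \<open>\<open>K\<close> is an arbitrary index set because this also serves the isometry formed
  by all Kraus operators of a protocol, whose components are indexed by tuples.\<close>

lemma isometry_sqnorm:
  assumes fin: "finite Z"
    and on: "\<And>y z. y \<in> Z \<Longrightarrow> z \<in> Z \<Longrightarrow> (\<Sum>i\<in>K. cnj (g y i) * g z i) = (if y = z then 1 else 0)"
  shows "sqnorm K (\<lambda>i. \<Sum>z\<in>Z. g z i * x z) = sqnorm Z x"
proof -
  have "complex_of_real (sqnorm K (\<lambda>i. \<Sum>z\<in>Z. g z i * x z)) =
      (\<Sum>i\<in>K. \<Sum>z\<in>Z. \<Sum>y\<in>Z. x z * cnj (x y) * (cnj (g y i) * g z i))"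
    unfolding of_real_sqnorm by (simp add: sum_product mult_ac)
  also have "\<dots> = (\<Sum>z\<in>Z. \<Sum>y\<in>Z. x z * cnj (x y) * (\<Sum>i\<in>K. cnj (g y i) * g z i))"
    by (subst sum.swap, rule sum.cong[OF refl], subst sum.swap) (simp add: sum_distrib_left)
  also have "\<dots> = (\<Sum>z\<in>Z. \<Sum>y\<in>Z. if y = z then x z * cnj (x y) else 0)"
    by (intro sum.cong refl) (auto simp: on)
  also have "\<dots> = complex_of_real (sqnorm Z x)"
    using fin by (simp add: of_real_sqnorm)
  finally show ?thesis by (simp only: of_real_eq_iff)
qed

text \<open>The map from coefficients to linear combinations of the \<open>g z\<close> is an
  isometry, so its adjoint, which computes the coefficients of \<open>v\<close>, is a
  contraction.\<close>

lemma bessel: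
  assumes fin: "finite Z" "finite K"
    and on: "\<And>y z. y \<in> Z \<Longrightarrow> z \<in> Z \<Longrightarrow> (\<Sum>i\<in>K. cnj (g y i) * g z i) = (if y = z then 1 else 0)"
  shows "(\<Sum>z\<in>Z. (cmod (\<Sum>i\<in>K. cnj (g z i) * v i))\<^sup>2) \<le> sqnorm K v"
proof -
  have "sqnorm K (\<lambda>i. \<Sum>z\<in>Z. g z i * x z) \<le> sqnorm Z x" for x
    using isometry_sqnorm[OF fin(1) on] by simp
  from adjoint_contraction[OF fin this, of v] show ?thesis by (simp add: sqnorm_def)
qed

section \<open>The spectral theorem\<close>

text \<open>Associativity of the product of a row, a matrix and a column; it replaces matrix algebra
  for operators that are given as functions.\<close>

lemma sum_assoc:
  fixes a c :: "nat \<Rightarrow> complex"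
  shows "(\<Sum>j\<in>J. (\<Sum>k\<in>K. a k * b k j) * c j) = (\<Sum>k\<in>K. a k * (\<Sum>j\<in>J. b k j * c j))"
  by (simp add: sum_distrib_left sum_distrib_right mult.assoc) (rule sum.swap)

lemma sum_kronecker:
  "i < (n::nat) \<Longrightarrow> (\<Sum>j<n. (if i = j then 1 else 0) * f j) = (f i :: complex)"
  "i < n \<Longrightarrow> (\<Sum>j<n. (if j = i then 1 else 0) * f j) = f i"
  "i < n \<Longrightarrow> (\<Sum>j<n. f j * (if i = j then 1 else 0)) = f i"
  "i < n \<Longrightarrow> (\<Sum>j<n. f j * (if j = i then 1 else 0)) = f i"
  by (simp_all add: if_distrib[of "\<lambda>x. x * _"] if_distrib[of "\<lambda>x. _ * x"] cong: if_cong)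

lemma exists_eigenvector:
  fixes A :: "nat \<Rightarrow> nat \<Rightarrow> complex"
  assumes n: "0 < n"
  obtains lam y where "\<And>i. i < n \<Longrightarrow> (\<Sum>j<n. A i j * y j) = lam * y i" "0 < sqnorm {..<n} y"
proof -
  define M where "M = mat n n (\<lambda>(i, j). A i j)"
  have M: "M \<in> carrier_mat n n" by (simp add: M_def)
  obtain lam where "eigenvalue M lam"
    using spectrum_non_empty[OF M n] unfolding spectrum_def by auto
  then obtain v where v: "v \<in> carrier_vec n" "v \<noteq> 0\<^sub>v n" "M *\<^sub>v v = lam \<cdot>\<^sub>v v"
    unfolding eigenvalue_def eigenvector_def using M by auto
  have "(\<Sum>j<n. A i j * v $ j) = lam * v $ i" if "i < n" for i
  proof -
    have "(M *\<^sub>v v) $ i = (\<Sum>j<n. A i j * v $ j)"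
      using that v(1) by (simp add: M_def scalar_prod_def atLeast0LessThan)
    then show ?thesis using that v(1,3) by simp
  qed
  moreover have "0 < sqnorm {..<n} (\<lambda>i. v $ i)"
  proof (rule ccontr)
    assume "\<not> ?thesis"
    then have "sqnorm {..<n} (\<lambda>i. v $ i) = 0"
      using sqnorm_nonneg[of "{..<n}" "\<lambda>i. v $ i"] by linarith
    then have "\<forall>i<n. v $ i = 0" unfolding sqnorm_def by (simp add: sum_nonneg_eq_0_iff)
    then have "v = 0\<^sub>v n" using v(1) by (intro eq_vecI) auto
    with v(2) show False by simp
  qed
  ultimately show ?thesis using that by blast
qed

text \<open>The phase of \<open>x\<close> is such that no cancellation occurs in \<open>x - e\<^sub>0\<close>.\<close>

lemma householder:
  fixes x :: "nat \<Rightarrow> complex"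
  assumes n: "0 < n" and x0: "x 0 = complex_of_real r" "r \<le> 0" and x1: "sqnorm {..<n} x = 1"
  obtains R where "\<And>i j. R i j = cnj (R j i)" "\<And>i. i < n \<Longrightarrow> R i 0 = x i"
    "\<And>i k. i < n \<Longrightarrow> k < n \<Longrightarrow> (\<Sum>j<n. R i j * R j k) = (if i = k then 1 else 0)"
proof -
  define w where "w i = x i - (if i = 0 then 1 else 0)" for i
  define s where "s = complex_of_real (1 - r)"
  have s: "s \<noteq> 0" "cnj s = s" using x0(2) by (auto simp: s_def complex_eq_iff)
  \<comment> \<open>Since |w|^2 = 2 (1 - r) = 2 s, this is 1 - 2 w w^dagger / |w|^2, the reflection
    that exchanges e_0 and x. As r <= 0, s is at least 1.\<close>
  define R where "R i j = (if i = j then 1 else 0) - w i * cnj (w j) / s" for i j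
  have ww: "(\<Sum>i<n. cnj (w i) * w i) = 2 * s"
  proof -
    have "(\<Sum>i<n. cnj (w i) * w i) = (\<Sum>i<n. x i * cnj (x i) - (if 0 = i then 1 else 0) * x i
        - (if 0 = i then 1 else 0) * cnj (x i) + (if 0 = i then 1 else 0) * 1)"
      by (rule sum.cong) (auto simp: w_def algebra_simps)
    also have "\<dots> = (\<Sum>i<n. x i * cnj (x i)) - x 0 - cnj (x 0) + 1"
      unfolding sum.distrib sum_subtractf sum_kronecker[OF n] ..
    also have "\<dots> = 2 * s" by (simp add: of_real_sqnorm[symmetric] x1 x0(1) s_def)
    finally show ?thesis .
  qed
  have "R i j = cnj (R j i)" for i j by (simp add: R_def s mult.commute)
  moreover have "R i 0 = x i" if "i < n" for i
  proof -
    have "cnj (w 0) = - s" by (simp add: w_def x0 s_def)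
    then have "R i 0 = (if i = 0 then 1 else 0) + w i" using s(1) by (simp add: R_def)
    then show ?thesis by (simp add: w_def)
  qed
  moreover have "(\<Sum>j<n. R i j * R j k) = (if i = k then 1 else 0)" if i: "i < n" and k: "k < n" for i k
  proof -
    have "(\<Sum>j<n. R i j * R j k) = (\<Sum>j<n. (if i = j then 1 else 0) * (if j = k then 1 else 0)
         - (if i = j then 1 else 0) * (w j * cnj (w k) / s)
         - (w i * cnj (w j) / s) * (if j = k then 1 else 0)
         + (w i * cnj (w k) / (s * s)) * (cnj (w j) * w j))"
      by (rule sum.cong) (auto simp: R_def algebra_simps)
    also have "\<dots> = (if i = k then 1 else 0) - w i * cnj (w k) / s - w i * cnj (w k) / s
       + (w i * cnj (w k) / (s * s)) * (2 * s)"
      unfolding sum.distrib sum_subtractf sum_distrib_left[symmetric] ww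
        sum_kronecker(1)[OF i] sum_kronecker(4)[OF k] ..
    also have "\<dots> = (if i = k then 1 else 0)" using s(1) by (simp add: field_simps)
    finally show ?thesis .
  qed
  ultimately show ?thesis using that by blast
qed

text \<open>A Hermitian involution is unitary: <R z_k, R z_l> = <z_k, R R z_l> = <z_k, z_l>.\<close>

lemma onb_reflect:
  assumes z: "onb n z" and R: "\<And>i j. R i j = cnj (R j i)"
    "\<And>i k. i < n \<Longrightarrow> k < n \<Longrightarrow> (\<Sum>j<n. R i j * R j k) = (if i = k then 1 else 0)"
  shows "onb n (\<lambda>k i. \<Sum>j<n. R i j * z k j)"
  unfolding onb_def
proof (intro allI impI)
  fix k l assume kl: "k < n" "l < n"
  have "(\<Sum>i<n. cnj (\<Sum>j<n. R i j * z k j) * (\<Sum>j<n. R i j * z l j)) =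
      (\<Sum>i<n. (\<Sum>j<n. cnj (z k j) * R j i) * (\<Sum>j<n. R i j * z l j))"
    by (intro sum.cong refl arg_cong2[where f = "(*)"])
      (auto simp: mult.commute R(1)[symmetric] intro!: sum.cong)
  also have "\<dots> = (\<Sum>j<n. cnj (z k j) * (\<Sum>i<n. R j i * (\<Sum>m<n. R i m * z l m)))"
    by (rule sum_assoc)
  also have "\<dots> = (\<Sum>j<n. cnj (z k j) * z l j)"
  proof (intro sum.cong refl arg_cong2[where f = "(*)"])
    fix j assume "j \<in> {..<n}"
    then have j: "j < n" by simp
    have "(\<Sum>i<n. R j i * (\<Sum>m<n. R i m * z l m)) = (\<Sum>m<n. (\<Sum>i<n. R j i * R i m) * z l m)"
      by (rule sum_assoc[symmetric])
    also have "\<dots> = (\<Sum>m<n. (if j = m then 1 else 0) * z l m)"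
      by (rule sum.cong) (auto simp: R(2)[OF j])
    finally show "(\<Sum>i<n. R j i * (\<Sum>m<n. R i m * z l m)) = z l j"
      using j by (simp add: sum_kronecker)
  qed
  finally show "(\<Sum>i<n. cnj (\<Sum>j<n. R i j * z k j) * (\<Sum>j<n. R i j * z l j)) = (if k = l then 1 else 0)"
    using onbD[OF z kl] by simp
qed

text \<open>Deflation, by induction on the dimension. A reflection R exchanges a unit eigenvector
  with e_0. In R A R the first column vanishes below the corner, hence by Hermiticity also the first
  row beyond it, and the induction hypothesis treats the remaining block. Its eigenvectors, padded
  with a zero, are reflected back together with e_0.\<close>

lemma hermitian_eigenbasis:
  fixes A :: "nat \<Rightarrow> nat \<Rightarrow> complex"
  assumes "\<And>i j. i < n \<Longrightarrow> j < n \<Longrightarrow> A i j = cnj (A j i)"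
  shows "\<exists>u e. onb n u \<and> (\<forall>k<n. \<forall>i<n. (\<Sum>j<n. A i j * u k j) = complex_of_real (e k) * u k i)"
  using assms
proof (induction n arbitrary: A)
  case 0
  then show ?case by (simp add: onb_def)
next
  case (Suc n)
  let ?N = "Suc n"
  note herm = Suc.prems
  obtain lam y where y: "\<And>i. i < ?N \<Longrightarrow> (\<Sum>j<?N. A i j * y j) = lam * y i" "0 < sqnorm {..<?N} y"
    using exists_eigenvector[of ?N A] by blast
  \<comment> \<open>Normalises \<open>y\<close> and turns its component 0 into - |y 0| / |y|, the
    non-positive real number that \<open>householder\<close> asks for. If y 0 = 0, any phase will
    do.\<close>
  define c where "c = (if y 0 = 0 then 1 else - cnj (y 0) / cmod (y 0)) / sqrt (sqnorm {..<?N} y)"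
  define x where "x i = c * y i" for i
  have c: "(cmod c)\<^sup>2 = 1 / sqnorm {..<?N} y"
    using y(2) by (auto simp: c_def norm_divide power_divide)
  have x1: "sqnorm {..<?N} x = 1"
    unfolding x_def sqnorm_scale c using y(2) by simp
  define r where "r = - cmod (y 0) / sqrt (sqnorm {..<?N} y)"
  have x0: "x 0 = complex_of_real r" "r \<le> 0"
    using y(2) complex_norm_square[of "y 0"]
    by (auto simp: x_def c_def r_def power2_eq_square field_simps)
  have Ax: "(\<Sum>j<?N. A i j * x j) = lam * x i" if "i < ?N" for i
  proof -
    have "(\<Sum>j<?N. A i j * x j) = c * (\<Sum>j<?N. A i j * y j)"
      unfolding x_def sum_distrib_left by (simp only: mult_ac)
    also have "\<dots> = lam * x i" unfolding y(1)[OF that] x_def by (simp only: mult_ac)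
    finally show ?thesis .
  qed
  obtain R where R: "\<And>i j. R i j = cnj (R j i)" "\<And>i. i < ?N \<Longrightarrow> R i 0 = x i"
    "\<And>i k. i < ?N \<Longrightarrow> k < ?N \<Longrightarrow> (\<Sum>j<?N. R i j * R j k) = (if i = k then 1 else 0)"
    by (rule householder[of ?N x r, OF _ x0 x1]) blast+
  define A' where "A' i j = (\<Sum>a<?N. R i a * (\<Sum>b<?N. A a b * R b j))" for i j
  have herm': "A' i j = cnj (A' j i)" if "i < ?N" "j < ?N" for i j
  proof -
    have "cnj (A' j i) = (\<Sum>a<?N. \<Sum>b<?N. R i b * (A b a * R a j))"
      unfolding A'_def cnj_sum sum_distrib_left complex_cnj_mult
    proof (intro sum.cong refl)
      fix a b assume "a \<in> {..<?N}" "b \<in> {..<?N}"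
      then have "cnj (A a b) = A b a" using herm[of b a] by simp
      then show "cnj (R j a) * (cnj (A a b) * cnj (R b i)) = R i b * (A b a * R a j)"
        by (simp add: R(1)[symmetric] mult_ac)
    qed
    also have "\<dots> = A' i j" unfolding A'_def sum_distrib_left by (rule sum.swap)
    finally show ?thesis ..
  qed
  have A'0: "A' i 0 = lam * (if i = 0 then 1 else 0)" if "i < ?N" for i
  proof -
    have "A' i 0 = (\<Sum>a<?N. R i a * (\<Sum>b<?N. A a b * x b))"
      unfolding A'_def by (intro sum.cong refl arg_cong2[where f = "(*)"]) (simp add: R(2))
    also have "\<dots> = (\<Sum>a<?N. lam * (R i a * R a 0))"
      by (intro sum.cong refl) (simp add: Ax R(2) del: sum.lessThan_Suc)
    finally show ?thesis
      unfolding sum_distrib_left[symmetric] using R(3)[OF that, of 0] by simp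
  qed
  have A'1: "A' 0 j = 0" if "0 < j" "j < ?N" for j
    using herm'[of 0 j] A'0[OF that(2)] that by simp
  have lam: "lam = complex_of_real (Re lam)"
    using A'0[of 0] herm'[of 0 0] by (simp add: complex_eq_iff)
  obtain u' e' where u': "onb n u'"
    "\<And>k i. k < n \<Longrightarrow> i < n \<Longrightarrow> (\<Sum>j<n. A' (Suc i) (Suc j) * u' k j) = complex_of_real (e' k) * u' k i"
    using Suc.IH[of "\<lambda>i j. A' (Suc i) (Suc j)"] herm' by (metis Suc_less_eq)
  define z :: "nat \<Rightarrow> nat \<Rightarrow> complex" where
    "z k i = (case k of 0 \<Rightarrow> if i = 0 then 1 else 0 | Suc k' \<Rightarrow> (case i of 0 \<Rightarrow> 0 | Suc i' \<Rightarrow> u' k' i'))" for k i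
  define e where "e k = (case k of 0 \<Rightarrow> Re lam | Suc k' \<Rightarrow> e' k')" for k
  have onbz: "onb ?N z"
    unfolding onb_def sum.lessThan_Suc_shift
    using onbD[OF u'(1)] by (auto simp: z_def split: nat.splits)
  have A'z: "(\<Sum>j<?N. A' i j * z k j) = complex_of_real (e k) * z k i" if "k < ?N" "i < ?N" for k i
    unfolding sum.lessThan_Suc_shift
    using that u'(2) A'0 A'1 lam by (auto simp: z_def e_def split: nat.splits)
  define u where "u k i = (\<Sum>j<?N. R i j * z k j)" for k i
  have "onb ?N u" unfolding u_def by (rule onb_reflect[OF onbz R(1) R(3)])
  moreover have "(\<Sum>j<?N. A i j * u k j) = complex_of_real (e k) * u k i" if k: "k < ?N" and i: "i < ?N" for k i
  proof -
    \<comment> \<open>A R = R A' because R is its own inverse, so R carries eigenvectors of A' to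
      eigenvectors of A.\<close>
    have AR: "(\<Sum>b<?N. A i b * R b j) = (\<Sum>l<?N. R i l * A' l j)" for j
    proof -
      have "(\<Sum>l<?N. R i l * A' l j) = (\<Sum>a<?N. (\<Sum>l<?N. R i l * R l a) * (\<Sum>b<?N. A a b * R b j))"
        unfolding A'_def by (rule sum_assoc[symmetric])
      also have "\<dots> = (\<Sum>a<?N. (if i = a then 1 else 0) * (\<Sum>b<?N. A a b * R b j))"
        by (intro sum.cong refl arg_cong2[where f = "(*)"]) (use R(3)[OF i] in simp)
      finally show ?thesis by (simp only: sum_kronecker(1)[OF i])
    qed
    have "(\<Sum>j<?N. A i j * u k j) = (\<Sum>j<?N. (\<Sum>b<?N. A i b * R b j) * z k j)"
      unfolding u_def by (rule sum_assoc[symmetric])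
    also have "\<dots> = (\<Sum>l<?N. R i l * (\<Sum>j<?N. A' l j * z k j))"
      unfolding AR by (rule sum_assoc)
    also have "\<dots> = (\<Sum>l<?N. R i l * (complex_of_real (e k) * z k l))"
      by (intro sum.cong refl arg_cong2[where f = "(*)"]) (use A'z[OF k] in simp)
    also have "\<dots> = complex_of_real (e k) * u k i"
      unfolding u_def sum_distrib_left by (simp only: mult_ac)
    finally show ?thesis .
  qed
  ultimately show ?case by blast
qed

section \<open>Spectral decompositions and the functional calculus\<close>

definition eigen_decomp :: "nat \<Rightarrow> complex mat \<Rightarrow> (nat \<Rightarrow> nat \<Rightarrow> complex) \<Rightarrow> (nat \<Rightarrow> real) \<Rightarrow> bool" where
  "eigen_decomp n A u e \<longleftrightarrow> A \<in> carrier_mat n n \<and> onb n u \<and>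
     (\<forall>i<n. \<forall>j<n. A $$ (i, j) = (\<Sum>k<n. complex_of_real (e k) * u k i * cnj (u k j)))"

lemma eigen_decompD:
  assumes "eigen_decomp n A u e"
  shows "A \<in> carrier_mat n n" "onb n u"
    "\<And>i j. i < n \<Longrightarrow> j < n \<Longrightarrow> A $$ (i, j) = (\<Sum>k<n. complex_of_real (e k) * u k i * cnj (u k j))"
  using assms unfolding eigen_decomp_def by auto

lemma decomp_apply:
  assumes u: "onb n u" and l: "l < n"
  shows "(\<Sum>j<n. (\<Sum>k<n. c k * u k i * cnj (u k j)) * u l j) = c l * u l i"
proof -
  have "(\<Sum>j<n. (\<Sum>k<n. c k * u k i * cnj (u k j)) * u l j) =
      (\<Sum>k<n. (c k * u k i) * (\<Sum>j<n. cnj (u k j) * u l j))"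
    by (rule sum_assoc)
  also have "\<dots> = (\<Sum>k<n. (c k * u k i) * (if k = l then 1 else 0))"
    by (intro sum.cong refl arg_cong2[where f = "(*)"]) (use onbD[OF u] l in auto)
  finally show ?thesis by (simp only: sum_kronecker(4)[OF l])
qed

lemma eigen_decomp_eigen:
  assumes "eigen_decomp n A u e" "i < n" "l < n"
  shows "(\<Sum>j<n. A $$ (i, j) * u l j) = complex_of_real (e l) * u l i"
proof -
  have "(\<Sum>j<n. A $$ (i, j) * u l j) =
      (\<Sum>j<n. (\<Sum>k<n. complex_of_real (e k) * u k i * cnj (u k j)) * u l j)"
    by (intro sum.cong refl arg_cong2[where f = "(*)"]) (use eigen_decompD(3)[OF assms(1,2)] in simp)
  then show ?thesis by (simp add: decomp_apply[OF eigen_decompD(2)[OF assms(1)] assms(3)])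
qed

lemma eigen_decompI:
  assumes A: "A \<in> carrier_mat n n" and u: "onb n u"
    and ev: "\<And>k i. k < n \<Longrightarrow> i < n \<Longrightarrow> (\<Sum>j<n. A $$ (i, j) * u k j) = complex_of_real (e k) * u k i"
  shows "eigen_decomp n A u e"
proof -
  have "A $$ (i, j) = (\<Sum>k<n. complex_of_real (e k) * u k i * cnj (u k j))" if i: "i < n" and j: "j < n" for i j
  proof -
    have "(\<Sum>k<n. complex_of_real (e k) * u k i * cnj (u k j)) =
       (\<Sum>k<n. (\<Sum>l<n. A $$ (i, l) * u k l) * cnj (u k j))"
      by (intro sum.cong refl arg_cong2[where f = "(*)"]) (use ev i in auto)
    also have "\<dots> = (\<Sum>l<n. A $$ (i, l) * (\<Sum>k<n. u k l * cnj (u k j)))"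
      by (rule sum_assoc)
    also have "\<dots> = (\<Sum>l<n. A $$ (i, l) * (if l = j then 1 else 0))"
      by (intro sum.cong refl arg_cong2[where f = "(*)"]) (use onb_complete[OF u] j in auto)
    finally show ?thesis by (simp only: sum_kronecker(4)[OF j])
  qed
  with A u show ?thesis unfolding eigen_decomp_def by blast
qed

lemma eigen_decomp_hermitian:
  assumes "eigen_decomp n A u e" "i < n" "j < n"
  shows "A $$ (i, j) = cnj (A $$ (j, i))"
  using eigen_decompD(3)[OF assms(1)] assms(2,3) by (simp add: mult_ac)

lemma hermitian_eigen_decomp:
  assumes "A \<in> carrier_mat n n" "\<And>i j. i < n \<Longrightarrow> j < n \<Longrightarrow> A $$ (i, j) = cnj (A $$ (j, i))"
  obtains u e where "eigen_decomp n A u e"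
  using hermitian_eigenbasis[of n "\<lambda>i j. A $$ (i, j)", OF assms(2)] eigen_decompI[OF assms(1)]
  by blast

lemma eigen_decomp_trace:
  assumes "eigen_decomp n A u e"
  shows "mtrace A = complex_of_real (\<Sum>k<n. e k)"
proof -
  have "mtrace A = (\<Sum>i<n. \<Sum>k<n. complex_of_real (e k) * u k i * cnj (u k i))"
    using eigen_decompD(1,3)[OF assms] by (auto simp: mtrace_def)
  also have "\<dots> = (\<Sum>k<n. complex_of_real (e k) * (\<Sum>i<n. cnj (u k i) * u k i))"
    by (subst sum.swap) (simp add: sum_distrib_left mult_ac)
  also have "\<dots> = (\<Sum>k<n. complex_of_real (e k))"
    by (intro sum.cong refl) (use onbD[OF eigen_decompD(2)[OF assms]] in auto)
  finally show ?thesis by simp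
qed

text \<open>Evaluating <u k, A (v l)> on either side shows that u k and v l can overlap only if e k
  = d l. On such pairs f (e k) = f (d l) for every function f, so the operator built from
  \<open>u\<close> is also diagonal in \<open>v\<close>. This makes the definite description in
  \<open>spectral_fun\<close> well defined.\<close>

lemma eigen_decomp_fun_unique:
  assumes u: "eigen_decomp n A u e" and v: "eigen_decomp n A v d" and ij: "i < n" "j < n"
  shows "(\<Sum>k<n. complex_of_real (f (e k)) * u k i * cnj (u k j)) =
         (\<Sum>k<n. complex_of_real (f (d k)) * v k i * cnj (v k j))"
proof -
  have onb: "onb n u" "onb n v" using u v eigen_decompD by auto
  define c where "c k l = (\<Sum>i<n. cnj (u k i) * v l i)" for k l
  have ec: "complex_of_real (e k) * c k l = complex_of_real (d l) * c k l" if kl: "k < n" "l < n" for k l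
  proof -
    have "complex_of_real (d l) * c k l = (\<Sum>i<n. cnj (u k i) * (complex_of_real (d l) * v l i))"
      unfolding c_def sum_distrib_left by (simp only: mult_ac)
    also have "\<dots> = (\<Sum>i<n. cnj (u k i) * (\<Sum>j<n. A $$ (i, j) * v l j))"
      by (intro sum.cong refl) (simp add: eigen_decomp_eigen[OF v _ kl(2)])
    also have "\<dots> = (\<Sum>j<n. (\<Sum>i<n. cnj (u k i) * A $$ (i, j)) * v l j)"
      by (rule sum_assoc[symmetric])
    also have "\<dots> = (\<Sum>j<n. cnj (\<Sum>i<n. A $$ (j, i) * u k i) * v l j)"
      by (intro sum.cong refl arg_cong2[where f = "(*)"])
        (auto simp: mult.commute intro!: sum.cong eigen_decomp_hermitian[OF u])
    also have "\<dots> = (\<Sum>j<n. cnj (complex_of_real (e k) * u k j) * v l j)"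
      by (intro sum.cong refl) (simp only: eigen_decomp_eigen[OF u _ kl(1)] lessThan_iff)
    also have "\<dots> = complex_of_real (e k) * c k l"
      unfolding c_def sum_distrib_left by (simp add: mult_ac)
    finally show ?thesis ..
  qed
  have fc: "complex_of_real (f (e k)) * c k l = complex_of_real (f (d l)) * c k l" if "k < n" "l < n" for k l
    using ec[OF that] by auto
  define F where "F = mat n n (\<lambda>(i, j). \<Sum>k<n. complex_of_real (f (e k)) * u k i * cnj (u k j))"
  have "eigen_decomp n F v (\<lambda>k. f (d k))"
  proof (rule eigen_decompI)
    fix l i assume l: "l < n" and i: "i < n"
    have "(\<Sum>j<n. F $$ (i, j) * v l j) = (\<Sum>k<n. complex_of_real (f (e k)) * u k i * c k l)"
      using i unfolding F_def c_def by (simp add: sum_assoc)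
    also have "\<dots> = complex_of_real (f (d l)) * (\<Sum>k<n. c k l * u k i)"
      unfolding sum_distrib_left
    proof (intro sum.cong refl)
      fix k assume "k \<in> {..<n}"
      then have "u k i * (complex_of_real (f (e k)) * c k l) = u k i * (complex_of_real (f (d l)) * c k l)"
        using fc[of k l] l by simp
      then show "complex_of_real (f (e k)) * u k i * c k l = complex_of_real (f (d l)) * (c k l * u k i)"
        by (simp only: mult_ac)
    qed
    also have "(\<Sum>k<n. c k l * u k i) = v l i"
      unfolding c_def by (rule onb_expand[OF onb(1) i])
    finally show "(\<Sum>j<n. F $$ (i, j) * v l j) = complex_of_real (f (d l)) * v l i" .
  qed (auto simp: F_def onb)
  from eigen_decompD(3)[OF this ij] show ?thesis using ij by (simp add: F_def)
qed

lemma unitary_diag_entry: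
  assumes U: "U \<in> carrier_mat n n" and ij: "i < n" "j < n"
  shows "(U * mat_diag n d * mat_adjoint U) $$ (i, j) = (\<Sum>k<n. d k * U $$ (i, k) * cnj (U $$ (j, k)))"
proof -
  have D: "mat_diag n d \<in> carrier_mat n n" by (simp add: mat_diag_def)
  have 1: "(U * mat_diag n d) $$ (i, k) = d k * U $$ (i, k)" if "k < n" for k
  proof -
    have "(U * mat_diag n d) $$ (i, k) = (\<Sum>l<n. U $$ (i, l) * mat_diag n d $$ (l, k))"
      by (rule mat_mult_entry[OF U D ij(1) that])
    also have "\<dots> = (\<Sum>l<n. (U $$ (i, l) * d l) * (if l = k then 1 else 0))"
      by (rule sum.cong) (auto simp: mat_diag_def that)
    also have "\<dots> = U $$ (i, k) * d k" by (rule sum_kronecker(4)[OF that])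
    finally show ?thesis by (simp only: mult.commute)
  qed
  have "(U * mat_diag n d * mat_adjoint U) $$ (i, j) =
      (\<Sum>k<n. (U * mat_diag n d) $$ (i, k) * mat_adjoint U $$ (k, j))"
    by (rule mat_mult_entry[OF mult_carrier_mat[OF U D] mat_adjoint_carrier[OF U] ij])
  then show ?thesis using ij U 1 by simp
qed

lemma unitary_eigen_decomp_iff:
  assumes A: "A \<in> carrier_mat n n" and U: "U \<in> carrier_mat n n"
  shows "unitary_mat n U \<and> A = U * mat_diag n (\<lambda>i. complex_of_real (e i)) * mat_adjoint U
    \<longleftrightarrow> eigen_decomp n A (\<lambda>k i. U $$ (i, k)) e"
proof -
  have adj: "mat_adjoint U \<in> carrier_mat n n" using U by simp
  have on: "mat_adjoint U * U = 1\<^sub>m n \<longleftrightarrow> onb n (\<lambda>k i. U $$ (i, k))"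
  proof -
    have "mat_adjoint U * U = 1\<^sub>m n \<longleftrightarrow>
      (\<forall>k<n. \<forall>l<n. (mat_adjoint U * U) $$ (k, l) = 1\<^sub>m n $$ (k, l))"
      using U by (auto intro!: eq_matI simp del: index_mult_mat index_one_mat)
        (auto simp: U carrier_matD[OF U])
    also have "\<dots> \<longleftrightarrow> onb n (\<lambda>k i. U $$ (i, k))"
      unfolding onb_def using U by (simp add: mat_mult_entry[OF adj U] del: index_mult_mat)
    finally show ?thesis .
  qed
  have "unitary_mat n U \<longleftrightarrow> onb n (\<lambda>k i. U $$ (i, k))"
    unfolding unitary_mat_def using U on mat_mult_left_right_inverse[OF adj U] by blast
  moreover have "A = U * mat_diag n (\<lambda>i. complex_of_real (e i)) * mat_adjoint U \<longleftrightarrow>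
     (\<forall>i<n. \<forall>j<n. A $$ (i, j) = (\<Sum>k<n. complex_of_real (e k) * U $$ (i, k) * cnj (U $$ (j, k))))"
    (is "A = ?B \<longleftrightarrow> _")
  proof -
    have "A = ?B \<longleftrightarrow> (\<forall>i<n. \<forall>j<n. A $$ (i, j) = ?B $$ (i, j))"
    proof
      assume *: "\<forall>i<n. \<forall>j<n. A $$ (i, j) = ?B $$ (i, j)"
      have "dim_row ?B = n" "dim_col ?B = n" using U by simp_all
      with * A show "A = ?B" by (intro eq_matI) (simp_all del: index_mult_mat(1))
    qed simp
    then show ?thesis using U by (simp add: unitary_diag_entry del: index_mult_mat)
  qed
  ultimately show ?thesis unfolding eigen_decomp_def using A by blast
qed

text \<open>Existence comes from the given decomposition and uniqueness from
  \<open>eigen_decomp_fun_unique\<close>. From here on \<open>spectral_fun\<close> is evaluated in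
  whichever eigenbasis is at hand.\<close>

lemma spectral_fun_eigen_decomp:
  assumes A: "eigen_decomp n A u e"
  shows "eigen_decomp n (spectral_fun f A) u (\<lambda>k. f (e k))"
proof -
  define U where "U = mat n n (\<lambda>(i, k). u k i)"
  define B where "B = mat n n (\<lambda>(i, j). \<Sum>k<n. complex_of_real (f (e k)) * u k i * cnj (u k j))"
  have Ac: "A \<in> carrier_mat n n" "dim_row A = n" using eigen_decompD(1)[OF A] by auto
  have U: "U \<in> carrier_mat n n" by (simp add: U_def)
  have Ucong: "eigen_decomp n C (\<lambda>k i. U $$ (i, k)) d \<longleftrightarrow> eigen_decomp n C u d" for C d
    unfolding eigen_decomp_def onb_def U_def by simp
  have B: "eigen_decomp n B u (\<lambda>k. f (e k))"
    unfolding eigen_decomp_def B_def using eigen_decompD(2)[OF A] by simp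
  have Bc: "B \<in> carrier_mat n n" by (simp add: B_def)
  have "spectral_fun f A = B"
    unfolding spectral_fun_def Ac(2)
  proof (rule the_equality)
    show "\<exists>U e. unitary_mat n U \<and> A = U * mat_diag n (\<lambda>i. complex_of_real (e i)) * mat_adjoint U \<and>
       B = U * mat_diag n (\<lambda>i. complex_of_real (f (e i))) * mat_adjoint U"
      using unitary_eigen_decomp_iff[OF Ac(1) U, of e] unitary_eigen_decomp_iff[OF Bc U, of "\<lambda>i. f (e i)"]
        A B Ucong by blast
  next
    fix C
    assume "\<exists>U e. unitary_mat n U \<and> A = U * mat_diag n (\<lambda>i. complex_of_real (e i)) * mat_adjoint U \<and>
       C = U * mat_diag n (\<lambda>i. complex_of_real (f (e i))) * mat_adjoint U"
    then obtain V d where V: "unitary_mat n V"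
      "A = V * mat_diag n (\<lambda>i. complex_of_real (d i)) * mat_adjoint V"
      "C = V * mat_diag n (\<lambda>i. complex_of_real (f (d i))) * mat_adjoint V" by blast
    have Vc: "V \<in> carrier_mat n n" using V(1) by (simp add: unitary_mat_def)
    have Cc: "C \<in> carrier_mat n n" 
      unfolding V(3) by (intro mult_carrier_mat[of _ n n] Vc mat_adjoint_carrier) (simp add: mat_diag_def)
    have AV: "eigen_decomp n A (\<lambda>k i. V $$ (i, k)) d"
      using unitary_eigen_decomp_iff[OF Ac(1) Vc] V by blast
    have CV: "eigen_decomp n C (\<lambda>k i. V $$ (i, k)) (\<lambda>k. f (d k))"
      using unitary_eigen_decomp_iff[OF Cc Vc] V by blast
    show "C = B"
    proof (rule eq_matI)
      fix i j assume "i < dim_row B" "j < dim_col B"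
      then have ij: "i < n" "j < n" by (auto simp: B_def)
      show "C $$ (i, j) = B $$ (i, j)"
        using eigen_decompD(3)[OF CV ij] eigen_decomp_fun_unique[OF A AV ij, of f] ij
        by (simp add: B_def)
    qed (use Cc Bc in auto)
  qed
  with B show ?thesis by simp
qed

section \<open>Positive operators and the trace distance\<close>

lemma hermitian_mat_entry:
  assumes "hermitian_mat A" "A \<in> carrier_mat n n" "i < n" "j < n"
  shows "A $$ (i, j) = cnj (A $$ (j, i))"
  using assms mat_adjoint_entry[of i A j] by (auto simp: hermitian_mat_def)

lemma quadratic_form:
  assumes "A \<in> carrier_mat n n" "v \<in> carrier_vec n"
  shows "(A *\<^sub>v v) \<bullet>c v = (\<Sum>i<n. \<Sum>j<n. cnj (v $ i) * A $$ (i, j) * v $ j)"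
  using assms
  by (auto simp: scalar_prod_def atLeast0LessThan sum_distrib_left sum_distrib_right mult_ac
      intro!: sum.cong)

lemma psd_eigen_decomp:
  assumes psd: "psd A" and A: "A \<in> carrier_mat n n"
  obtains u e where "eigen_decomp n A u e" "\<And>k. k < n \<Longrightarrow> 0 \<le> e k"
proof -
  have herm: "A $$ (i, j) = cnj (A $$ (j, i))" if "i < n" "j < n" for i j
    using psd A that unfolding psd_def by (intro hermitian_mat_entry) auto
  obtain u e where ue: "eigen_decomp n A u e" using hermitian_eigen_decomp[OF A herm] by blast
  have "0 \<le> e k" if k: "k < n" for k
  proof -
    have v: "vec n (u k) \<in> carrier_vec n" by simp
    have "(A *\<^sub>v vec n (u k)) \<bullet>c vec n (u k) = (\<Sum>i<n. cnj (u k i) * (\<Sum>j<n. A $$ (i, j) * u k j))"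
      unfolding quadratic_form[OF A v] by (simp add: sum_distrib_left mult_ac)
    also have "\<dots> = complex_of_real (e k) * (\<Sum>i<n. cnj (u k i) * u k i)"
      unfolding sum_distrib_left[of "complex_of_real (e k)"]
      by (intro sum.cong refl) (simp only: eigen_decomp_eigen[OF ue _ k] lessThan_iff mult.left_commute)
    also have "\<dots> = complex_of_real (e k)" using onbD[OF eigen_decompD(2)[OF ue] k k] by simp
    finally have "Re ((A *\<^sub>v vec n (u k)) \<bullet>c vec n (u k)) = e k" by simp
    moreover have "0 \<le> Re ((A *\<^sub>v vec n (u k)) \<bullet>c vec n (u k))"
      using psd v A unfolding psd_def by auto
    ultimately show ?thesis by simp
  qed
  with ue that show ?thesis by blast
qed

lemma eigen_decomp_gram:
  assumes A: "eigen_decomp n A u e" and e: "\<And>k. k < n \<Longrightarrow> 0 \<le> e k" and ij: "i < n" "j < n"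
  shows "A $$ (i, j) =
    (\<Sum>k<n. complex_of_real (sqrt (e k)) * u k i * cnj (complex_of_real (sqrt (e k)) * u k j))"
  unfolding eigen_decompD(3)[OF A ij]
proof (intro sum.cong refl)
  fix k assume "k \<in> {..<n}"
  then have "complex_of_real (e k) = complex_of_real (sqrt (e k)) * complex_of_real (sqrt (e k))"
    using e[of k] by (simp flip: of_real_mult)
  then show "complex_of_real (e k) * u k i * cnj (u k j) =
    complex_of_real (sqrt (e k)) * u k i * cnj (complex_of_real (sqrt (e k)) * u k j)"
    by (simp add: mult_ac)
qed

lemma psd_gram:
  assumes "psd A" "A \<in> carrier_mat n n"
  obtains g where "\<And>i j. i < n \<Longrightarrow> j < n \<Longrightarrow> A $$ (i, j) = (\<Sum>k<n. g k i * cnj (g k j))"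
proof -
  obtain u e where ue: "eigen_decomp n A u e" "\<And>k. k < n \<Longrightarrow> 0 \<le> e k"
    using psd_eigen_decomp[OF assms] by blast
  show ?thesis by (rule that[OF eigen_decomp_gram[OF ue]])
qed

lemma sum_rotate:
  "(\<Sum>i\<in>I. \<Sum>j\<in>J. \<Sum>k\<in>K. f i j k) = (\<Sum>k\<in>K. \<Sum>i\<in>I. \<Sum>j\<in>J. f i j k)"
proof -
  have "(\<Sum>i\<in>I. \<Sum>j\<in>J. \<Sum>k\<in>K. f i j k) = (\<Sum>i\<in>I. \<Sum>k\<in>K. \<Sum>j\<in>J. f i j k)"
    by (intro sum.cong refl) (rule sum.swap)
  then show ?thesis by (simp only: sum.swap[of _ K I])
qed

text \<open>Covers spectral decompositions, where \<open>c\<close> holds the eigenvalues, as well as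
  Gram representations, where it is constantly 1.\<close>

lemma weighted_gram_form:
  fixes v :: "'a \<Rightarrow> complex"
  shows "(\<Sum>i\<in>I. \<Sum>j\<in>I. cnj (v i) * (\<Sum>k\<in>K. c k * g k i * cnj (g k j)) * v j) =
    (\<Sum>k\<in>K. c k * complex_of_real ((cmod (\<Sum>j\<in>I. cnj (g k j) * v j))\<^sup>2))"
proof -
  have "(\<Sum>i\<in>I. \<Sum>j\<in>I. cnj (v i) * (\<Sum>k\<in>K. c k * g k i * cnj (g k j)) * v j) =
     (\<Sum>i\<in>I. \<Sum>j\<in>I. \<Sum>k\<in>K. c k * ((cnj (g k j) * v j) * (g k i * cnj (v i))))"
    by (simp add: sum_distrib_left sum_distrib_right mult_ac)
  also have "\<dots> = (\<Sum>k\<in>K. \<Sum>i\<in>I. \<Sum>j\<in>I. c k * ((cnj (g k j) * v j) * (g k i * cnj (v i))))"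
    by (rule sum_rotate)
  also have "\<dots> = (\<Sum>k\<in>K. c k * ((\<Sum>j\<in>I. cnj (g k j) * v j) * cnj (\<Sum>i\<in>I. cnj (g k i) * v i)))"
    by (intro sum.cong refl, subst sum.swap) (simp only: cnj_sum complex_cnj_mult complex_cnj_cnj sum_product, simp only: sum_distrib_left)
  finally show ?thesis by (simp only: complex_norm_square)
qed

lemma gram_quadratic_form:
  fixes v :: "'a \<Rightarrow> complex"
  shows "(\<Sum>i\<in>I. \<Sum>j\<in>I. cnj (v i) * (\<Sum>k\<in>K. g k i * cnj (g k j)) * v j) =
    complex_of_real (\<Sum>k\<in>K. (cmod (\<Sum>j\<in>I. cnj (g k j) * v j))\<^sup>2)"
  using weighted_gram_form[where c = "\<lambda>_. 1"] by simp

lemma psd_of_gram: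
  assumes A: "A \<in> carrier_mat n n"
    and gram: "\<And>i j. i < n \<Longrightarrow> j < n \<Longrightarrow> A $$ (i, j) = (\<Sum>k\<in>K. g k i * cnj (g k j))"
  shows "psd A"
proof -
  have "mat_adjoint A = A"
    by (rule eq_matI) (use A gram in \<open>auto simp: mult_ac\<close>)
  moreover have "0 \<le> Re ((A *\<^sub>v v) \<bullet>c v)" if v: "v \<in> carrier_vec n" for v
  proof -
    have "(A *\<^sub>v v) \<bullet>c v =
        (\<Sum>i<n. \<Sum>j<n. cnj (v $ i) * (\<Sum>k\<in>K. g k i * cnj (g k j)) * v $ j)"
      unfolding quadratic_form[OF A v] by (intro sum.cong refl) (simp add: gram)
    also have "\<dots> = complex_of_real (\<Sum>k\<in>K. (cmod (\<Sum>j<n. cnj (g k j) * v $ j))\<^sup>2)"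
      by (rule gram_quadratic_form)
    finally show ?thesis by (simp add: sum_nonneg)
  qed
  ultimately show ?thesis using A unfolding psd_def hermitian_mat_def by auto
qed

lemma psd_of_eigen_decomp:
  assumes "eigen_decomp n A u e" "\<And>k. k < n \<Longrightarrow> 0 \<le> e k"
  shows "psd A"
  by (rule psd_of_gram[OF eigen_decompD(1)[OF assms(1)] eigen_decomp_gram[OF assms]])

lemma density_eigen_decomp:
  assumes "density_op n \<rho>"
  obtains u a where "eigen_decomp n \<rho> u a" "\<And>k. k < n \<Longrightarrow> 0 \<le> a k" "(\<Sum>k<n. a k) = 1"
proof -
  obtain u a where A: "eigen_decomp n \<rho> u a" and a: "\<And>k. k < n \<Longrightarrow> 0 \<le> a k"
    using psd_eigen_decomp[of \<rho> n] assms by (auto simp: density_op_def)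
  moreover have "(\<Sum>k<n. a k) = 1"
    using eigen_decomp_trace[OF A] assms by (simp add: density_op_def flip: of_real_sum)
  ultimately show ?thesis using that by blast
qed

text \<open>For a Hermitian difference D, the operator under the square root is D^2. It has the
  eigenvectors of D, and sqrt (d^2) = |d|.\<close>

lemma trace_dist_eigen_decomp:
  assumes D: "eigen_decomp n (\<rho> - \<sigma>) u d"
  shows "2 * trace_dist \<rho> \<sigma> = (\<Sum>k<n. \<bar>d k\<bar>)"
proof -
  let ?D = "\<rho> - \<sigma>"
  have Dc: "?D \<in> carrier_mat n n" by (rule eigen_decompD(1)[OF D])
  have adj: "mat_adjoint ?D = ?D"
  proof (rule eq_matI)
    fix i j assume "i < dim_row ?D" "j < dim_col ?D"
    with Dc have "i < n" "j < n" by (simp_all only: carrier_matD)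
    then show "mat_adjoint ?D $$ (i, j) = ?D $$ (i, j)"
      using Dc eigen_decomp_hermitian[OF D, of i j]
      by (simp only: mat_adjoint_entry carrier_matD)
  qed (simp_all only: mat_adjoint_dim carrier_matD[OF Dc])
  have "eigen_decomp n (?D * ?D) u (\<lambda>k. (d k)\<^sup>2)"
  proof (rule eigen_decompI)
    fix k i assume k: "k < n" and i: "i < n"
    have "(\<Sum>j<n. (?D * ?D) $$ (i, j) * u k j) = (\<Sum>l<n. ?D $$ (i, l) * (\<Sum>j<n. ?D $$ (l, j) * u k j))"
      using i by (simp add: mat_mult_entry[OF Dc Dc] sum_assoc del: index_mult_mat index_minus_mat)
    also have "\<dots> = complex_of_real (d k) * (\<Sum>l<n. ?D $$ (i, l) * u k l)"
      unfolding sum_distrib_left[of "complex_of_real (d k)"]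
      by (intro sum.cong refl) (simp only: eigen_decomp_eigen[OF D _ k] lessThan_iff, simp only: mult.left_commute)
    also have "\<dots> = complex_of_real ((d k)\<^sup>2) * u k i"
      unfolding eigen_decomp_eigen[OF D i k] by (simp add: power2_eq_square)
    finally show "(\<Sum>j<n. (?D * ?D) $$ (i, j) * u k j) = complex_of_real ((d k)\<^sup>2) * u k i" .
  qed (use Dc eigen_decompD(2)[OF D] in auto)
  from eigen_decomp_trace[OF spectral_fun_eigen_decomp[OF this, of sqrt]]
  show ?thesis unfolding trace_dist_def adj by simp
qed

text \<open>In the eigenbasis of the difference, the diagonal element at \<open>g z\<close> is at
  most the sum of |d k| |<g z, u k>|^2, and by Bessel these weights sum over z to at most 1 for each
  k. A family of vectors in mutually orthogonal blocks thereby collects the errors of all blocks in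
  one trace distance.\<close>

lemma trace_dist_ge:
  assumes D: "\<rho> - \<sigma> \<in> carrier_mat n n"
    "\<And>i j. i < n \<Longrightarrow> j < n \<Longrightarrow> (\<rho> - \<sigma>) $$ (i, j) = cnj ((\<rho> - \<sigma>) $$ (j, i))"
    and fin: "finite Z"
    and on: "\<And>y z. y \<in> Z \<Longrightarrow> z \<in> Z \<Longrightarrow> (\<Sum>i<n. cnj (g y i) * g z i) = (if y = z then 1 else 0)"
  shows "(\<Sum>z\<in>Z. cmod (\<Sum>i<n. \<Sum>j<n. cnj (g z i) * (\<rho> - \<sigma>) $$ (i, j) * g z j)) \<le> 2 * trace_dist \<rho> \<sigma>"
proof -
  obtain u d where D: "eigen_decomp n (\<rho> - \<sigma>) u d" using hermitian_eigen_decomp[OF D] by blast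
  have form: "(\<Sum>i<n. \<Sum>j<n. cnj (v i) * (\<rho> - \<sigma>) $$ (i, j) * v j) =
      (\<Sum>k<n. complex_of_real (d k * (cmod (\<Sum>j<n. cnj (u k j) * v j))\<^sup>2))" for v
  proof -
    have "(\<Sum>i<n. \<Sum>j<n. cnj (v i) * (\<rho> - \<sigma>) $$ (i, j) * v j) =
       (\<Sum>i<n. \<Sum>j<n. cnj (v i) * (\<Sum>k<n. complex_of_real (d k) * u k i * cnj (u k j)) * v j)"
      by (intro sum.cong refl) (simp only: eigen_decompD(3)[OF D] lessThan_iff)
    also have "\<dots> = (\<Sum>k<n. complex_of_real (d k) * complex_of_real ((cmod (\<Sum>j<n. cnj (u k j) * v j))\<^sup>2))"
      by (rule weighted_gram_form)
    finally show ?thesis by (simp only: of_real_mult)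
  qed
  have flip: "cmod (\<Sum>j<n. cnj (u k j) * g z j) = cmod (\<Sum>j<n. cnj (g z j) * u k j)" for k z
    by (rule trans[OF complex_mod_cnj[symmetric]]) (simp add: mult.commute)
  have "(\<Sum>z\<in>Z. cmod (\<Sum>i<n. \<Sum>j<n. cnj (g z i) * (\<rho> - \<sigma>) $$ (i, j) * g z j)) \<le>
     (\<Sum>z\<in>Z. \<Sum>k<n. \<bar>d k\<bar> * (cmod (\<Sum>j<n. cnj (g z j) * u k j))\<^sup>2)"
    unfolding form flip
    by (intro sum_mono order_trans[OF norm_sum] sum_mono)
      (simp add: norm_mult abs_mult flip: of_real_mult of_real_power)
  also have "\<dots> = (\<Sum>k<n. \<bar>d k\<bar> * (\<Sum>z\<in>Z. (cmod (\<Sum>j<n. cnj (g z j) * u k j))\<^sup>2))"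
    by (subst sum.swap) (simp add: sum_distrib_left)
  also have "\<dots> \<le> (\<Sum>k<n. \<bar>d k\<bar> * 1)"
  proof (intro sum_mono mult_left_mono)
    fix k assume "k \<in> {..<n}"
    then have "sqnorm {..<n} (u k) = 1" using onb_sqnorm[OF eigen_decompD(2)[OF D]] by simp
    then show "(\<Sum>z\<in>Z. (cmod (\<Sum>j<n. cnj (g z j) * u k j))\<^sup>2) \<le> 1"
      using bessel[OF fin finite_lessThan on, of "u k"] by simp
  qed simp
  finally show ?thesis using trace_dist_eigen_decomp[OF D] by simp
qed

section \<open>Relative entropy as a double sum over eigenbases\<close>

text \<open>The transition probabilities between two orthonormal bases, which form a doubly
  stochastic matrix.\<close>

definition overlap :: "nat \<Rightarrow> (nat \<Rightarrow> nat \<Rightarrow> complex) \<Rightarrow> (nat \<Rightarrow> nat \<Rightarrow> complex) \<Rightarrow> nat \<Rightarrow> nat \<Rightarrow> real" where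
  "overlap n u v k l = (cmod (\<Sum>i<n. cnj (u k i) * v l i))\<^sup>2"

text \<open>The function behind \<open>op_log2\<close>. For positive operators of finite relative
  entropy, the default value 0 occurs only where the weight \<open>a k * overlap n u v k l\<close>
  vanishes.\<close>

definition log2_pos :: "real \<Rightarrow> real" where
  "log2_pos x = (if x > 0 then log 2 x else 0)"

lemma overlap_nonneg [simp]: "0 \<le> overlap n u v k l"
  by (simp add: overlap_def)

lemma overlap_commute: "overlap n u v k l = overlap n v u l k"
  unfolding overlap_def
  by (subst complex_mod_cnj[symmetric]) (simp add: mult.commute)

lemma sum_overlap:
  assumes "onb n v" "onb n u" "k < n"
  shows "(\<Sum>l<n. overlap n u v k l) = 1"
  using parseval[OF assms(1), of "u k"] onb_sqnorm[OF assms(2,3)]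
  by (subst overlap_commute) (simp add: overlap_def)

lemma trace_prod_overlap:
  assumes A: "eigen_decomp n A u a" and B: "eigen_decomp n B v b"
  shows "mtrace (A * B) = complex_of_real (\<Sum>k<n. \<Sum>l<n. a k * b l * overlap n u v k l)"
proof -
  note Ac = eigen_decompD(1)[OF A] and Bc = eigen_decompD(1)[OF B]
  have "mtrace (A * B) = (\<Sum>i<n. \<Sum>j<n. A $$ (i, j) * B $$ (j, i))"
    using Ac Bc by (auto simp: mtrace_def mat_mult_entry[OF Ac Bc] simp del: index_mult_mat(1) intro!: sum.cong)
  also have "\<dots> = (\<Sum>i<n. \<Sum>j<n. \<Sum>l<n. complex_of_real (b l) * (cnj (v l i) * A $$ (i, j) * v l j))"
    by (intro sum.cong refl) (simp add: eigen_decompD(3)[OF B] sum_distrib_left mult_ac)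
  also have "\<dots> = (\<Sum>l<n. complex_of_real (b l) * (\<Sum>i<n. \<Sum>j<n. cnj (v l i) * A $$ (i, j) * v l j))"
    by (subst sum_rotate) (simp only: sum_distrib_left)
  also have "\<dots> = (\<Sum>l<n. complex_of_real (b l) *
      (\<Sum>i<n. \<Sum>j<n. cnj (v l i) * (\<Sum>k<n. complex_of_real (a k) * u k i * cnj (u k j)) * v l j))"
    by (intro sum.cong refl arg_cong2[where f = "(*)"]) (simp only: eigen_decompD(3)[OF A] lessThan_iff)
  also have "\<dots> = (\<Sum>l<n. \<Sum>k<n. complex_of_real (a k * b l * overlap n u v k l))"
    unfolding weighted_gram_form overlap_def by (simp add: sum_distrib_left mult_ac)
  also have "\<dots> = complex_of_real (\<Sum>k<n. \<Sum>l<n. a k * b l * overlap n u v k l)"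
    by (subst sum.swap) simp
  finally show ?thesis .
qed

lemma mult_mat_vec_entry:
  "A \<in> carrier_mat n n \<Longrightarrow> x \<in> carrier_vec n \<Longrightarrow> i < n \<Longrightarrow> (A *\<^sub>v x) $ i = (\<Sum>j<n. A $$ (i, j) * x $ j)"
  by (auto simp: scalar_prod_def atLeast0LessThan intro!: sum.cong)

lemma kernel_iff_eigen:
  assumes A: "eigen_decomp n A u a" and x: "x \<in> carrier_vec n"
  shows "A *\<^sub>v x = 0\<^sub>v n \<longleftrightarrow> (\<forall>k<n. a k = 0 \<or> (\<Sum>j<n. cnj (u k j) * x $ j) = 0)"
proof -
  define c where "c k = (\<Sum>j<n. cnj (u k j) * x $ j)" for k
  have Ac: "A \<in> carrier_mat n n" and u: "onb n u" using eigen_decompD[OF A] by auto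
  have Ax: "(A *\<^sub>v x) $ i = (\<Sum>k<n. (complex_of_real (a k) * c k) * u k i)" if "i < n" for i
  proof -
    have "(A *\<^sub>v x) $ i = (\<Sum>j<n. (\<Sum>k<n. (complex_of_real (a k) * u k i) * cnj (u k j)) * x $ j)"
      by (simp add: mult_mat_vec_entry[OF Ac x that] eigen_decompD(3)[OF A that] del: index_mult_mat_vec)
    also have "\<dots> = (\<Sum>k<n. (complex_of_real (a k) * u k i) * c k)"
      unfolding c_def by (rule sum_assoc)
    finally show ?thesis by (simp only: mult_ac)
  qed
  show ?thesis
  proof
    assume 0: "A *\<^sub>v x = 0\<^sub>v n"
    have "complex_of_real (a k) * c k = 0" if k: "k < n" for k
    proof -
      have "(\<Sum>i<n. cnj (u k i) * (A *\<^sub>v x) $ i) = (\<Sum>i<n. cnj (u k i) * (\<Sum>l<n. u l i * (complex_of_real (a l) * c l)))"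
        by (intro sum.cong refl arg_cong2[where f = "(*)"]) (simp add: Ax mult.commute del: index_mult_mat_vec)
      also have "\<dots> = (\<Sum>l<n. (\<Sum>i<n. cnj (u k i) * u l i) * (complex_of_real (a l) * c l))"
        by (rule sum_assoc[symmetric])
      also have "\<dots> = (\<Sum>l<n. (if k = l then 1 else 0) * (complex_of_real (a l) * c l))"
        by (intro sum.cong refl arg_cong2[where f = "(*)"]) (use onbD[OF u k] in auto)
      finally show ?thesis unfolding 0 sum_kronecker(1)[OF k] by simp
    qed
    then show "\<forall>k<n. a k = 0 \<or> (\<Sum>j<n. cnj (u k j) * x $ j) = 0" by (auto simp: c_def)
  next
    assume "\<forall>k<n. a k = 0 \<or> (\<Sum>j<n. cnj (u k j) * x $ j) = 0"
    then have 0: "\<And>k. k < n \<Longrightarrow> complex_of_real (a k) * c k = 0" by (auto simp: c_def)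
    show "A *\<^sub>v x = 0\<^sub>v n"
      by (rule eq_vecI) (use Ac 0 in \<open>auto simp: Ax simp del: index_mult_mat_vec(1) intro!: sum.neutral\<close>)
  qed
qed

text \<open>The kernel of \<open>\<sigma>\<close> is spanned by the \<open>v l\<close> with b l = 0.
  For positive operators the condition thus becomes absolute continuity of the weights a k |<u k, v
  l>|^2 with respect to b l |<u k, v l>|^2.\<close>

lemma support_iff_overlap:
  assumes A: "eigen_decomp n \<rho> u a" and B: "eigen_decomp n \<sigma> v b"
  shows "(\<forall>x \<in> carrier_vec n. \<sigma> *\<^sub>v x = 0\<^sub>v n \<longrightarrow> \<rho> *\<^sub>v x = 0\<^sub>v n) \<longleftrightarrow>
    (\<forall>k<n. \<forall>l<n. b l = 0 \<longrightarrow> a k * overlap n u v k l = 0)"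
proof
  assume supp: "\<forall>x \<in> carrier_vec n. \<sigma> *\<^sub>v x = 0\<^sub>v n \<longrightarrow> \<rho> *\<^sub>v x = 0\<^sub>v n"
  show "\<forall>k<n. \<forall>l<n. b l = 0 \<longrightarrow> a k * overlap n u v k l = 0"
  proof (intro allI impI)
    fix k l assume k: "k < n" and l: "l < n" and b: "b l = 0"
    have x: "vec n (v l) \<in> carrier_vec n" by simp
    have "\<sigma> *\<^sub>v vec n (v l) = 0\<^sub>v n"
      unfolding kernel_iff_eigen[OF B x] using onbD[OF eigen_decompD(2)[OF B] _ l] b by auto
    then have "\<rho> *\<^sub>v vec n (v l) = 0\<^sub>v n" using supp x by blast
    then show "a k * overlap n u v k l = 0"
      unfolding kernel_iff_eigen[OF A x] using k by (auto simp: overlap_def)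
  qed
next
  assume 0: "\<forall>k<n. \<forall>l<n. b l = 0 \<longrightarrow> a k * overlap n u v k l = 0"
  show "\<forall>x \<in> carrier_vec n. \<sigma> *\<^sub>v x = 0\<^sub>v n \<longrightarrow> \<rho> *\<^sub>v x = 0\<^sub>v n"
  proof (intro ballI impI)
    fix x assume x: "x \<in> carrier_vec n" and "\<sigma> *\<^sub>v x = 0\<^sub>v n"
    then have c: "\<And>l. l < n \<Longrightarrow> b l = 0 \<or> (\<Sum>j<n. cnj (v l j) * x $ j) = 0"
      unfolding kernel_iff_eigen[OF B x] by blast
    show "\<rho> *\<^sub>v x = 0\<^sub>v n"
      unfolding kernel_iff_eigen[OF A x]
    proof (intro allI impI)
      fix k assume k: "k < n"
      have "(\<Sum>i<n. cnj (u k i) * x $ i) =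
         (\<Sum>i<n. cnj (u k i) * (\<Sum>l<n. v l i * (\<Sum>j<n. cnj (v l j) * x $ j)))"
        by (intro sum.cong refl arg_cong2[where f = "(*)"])
          (use onb_expand[OF eigen_decompD(2)[OF B]] in \<open>simp add: mult.commute\<close>)
      also have "\<dots> = (\<Sum>l<n. (\<Sum>i<n. cnj (u k i) * v l i) * (\<Sum>j<n. cnj (v l j) * x $ j))"
        by (rule sum_assoc[symmetric])
      finally have "complex_of_real (a k) * (\<Sum>i<n. cnj (u k i) * x $ i) =
         (\<Sum>l<n. complex_of_real (a k) * (\<Sum>i<n. cnj (u k i) * v l i) * (\<Sum>j<n. cnj (v l j) * x $ j))"
        by (simp add: sum_distrib_left mult_ac)
      also have "\<dots> = 0"
      proof (rule sum.neutral, rule ballI)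
        fix l assume "l \<in> {..<n}"
        with c[of l] 0 k show "complex_of_real (a k) * (\<Sum>i<n. cnj (u k i) * v l i) * (\<Sum>j<n. cnj (v l j) * x $ j) = 0"
          by (auto simp: overlap_def)
      qed
      finally show "a k = 0 \<or> (\<Sum>j<n. cnj (u k j) * x $ j) = 0" by simp
    qed
  qed
qed

text \<open>The overlaps in each row sum to 1, so the trace of \<rho> log \<rho>, a single sum over
  k, can be spread over all pairs (k, l) and merged with the trace of \<rho> log \<sigma>.\<close>

lemma rel_entropy_overlap:
  assumes A: "eigen_decomp n \<rho> u a" and B: "eigen_decomp n \<sigma> v b"
  shows "rel_entropy \<rho> \<sigma> =
    (if \<forall>k<n. \<forall>l<n. b l = 0 \<longrightarrow> a k * overlap n u v k l = 0
     then ereal (\<Sum>k<n. \<Sum>l<n. a k * overlap n u v k l * (log2_pos (a k) - log2_pos (b l))) else \<infinity>)"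
proof -
  have Ac: "\<rho> \<in> carrier_mat n n" "dim_row \<rho> = n" and u: "onb n u" and v: "onb n v"
    using eigen_decompD[OF A] eigen_decompD[OF B] by auto
  have LA: "eigen_decomp n (op_log2 \<rho>) u (\<lambda>k. log2_pos (a k))"
    and LB: "eigen_decomp n (op_log2 \<sigma>) v (\<lambda>k. log2_pos (b k))"
    unfolding op_log2_def log2_pos_def by (rule spectral_fun_eigen_decomp[OF A] spectral_fun_eigen_decomp[OF B])+
  have uu: "overlap n u u k l = (if k = l then 1 else 0)" if "k < n" "l < n" for k l
    using onbD[OF u that] by (simp add: overlap_def)
  have "mtrace (\<rho> * (op_log2 \<rho> - op_log2 \<sigma>)) = mtrace (\<rho> * op_log2 \<rho>) - mtrace (\<rho> * op_log2 \<sigma>)"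
  proof -
    have "\<rho> * (op_log2 \<rho> - op_log2 \<sigma>) = \<rho> * op_log2 \<rho> - \<rho> * op_log2 \<sigma>"
      by (rule mult_minus_distrib_mat[OF Ac(1) eigen_decompD(1)[OF LA] eigen_decompD(1)[OF LB]])
    then show ?thesis
      using Ac eigen_decompD(1)[OF LA] eigen_decompD(1)[OF LB]
      by (simp add: mtrace_def sum_subtractf del: index_mult_mat(1))
  qed
  also have "\<dots> = complex_of_real ((\<Sum>k<n. \<Sum>l<n. a k * log2_pos (a l) * overlap n u u k l)
      - (\<Sum>k<n. \<Sum>l<n. a k * log2_pos (b l) * overlap n u v k l))"
    unfolding trace_prod_overlap[OF A LA] trace_prod_overlap[OF A LB] by simp
  also have "(\<Sum>k<n. \<Sum>l<n. a k * log2_pos (a l) * overlap n u u k l) =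
      (\<Sum>k<n. \<Sum>l<n. a k * log2_pos (a k) * overlap n u v k l)"
  proof (rule sum.cong[OF refl])
    fix k assume "k \<in> {..<n}"
    then have k: "k < n" by simp
    have "(\<Sum>l<n. a k * log2_pos (a l) * overlap n u u k l) = (\<Sum>l<n. if k = l then a k * log2_pos (a k) else 0)"
      by (rule sum.cong) (auto simp: uu k)
    also have "\<dots> = a k * log2_pos (a k) * (\<Sum>l<n. overlap n u v k l)"
      using sum_overlap[OF v u k] k by simp
    finally show "(\<Sum>l<n. a k * log2_pos (a l) * overlap n u u k l) =
      (\<Sum>l<n. a k * log2_pos (a k) * overlap n u v k l)"
      by (simp add: sum_distrib_left)
  qed
  finally have "Re (mtrace (\<rho> * (op_log2 \<rho> - op_log2 \<sigma>))) =
     (\<Sum>k<n. \<Sum>l<n. a k * log2_pos (a k) * overlap n u v k l)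
      - (\<Sum>k<n. \<Sum>l<n. a k * log2_pos (b l) * overlap n u v k l)"
    by (simp only: Re_complex_of_real)
  also have "\<dots> = (\<Sum>k<n. \<Sum>l<n. a k * overlap n u v k l * (log2_pos (a k) - log2_pos (b l)))"
    by (simp add: sum_subtractf algebra_simps)
  finally have "Re (mtrace (\<rho> * (op_log2 \<rho> - op_log2 \<sigma>))) =
     (\<Sum>k<n. \<Sum>l<n. a k * overlap n u v k l * (log2_pos (a k) - log2_pos (b l)))" .
  then show ?thesis
    unfolding rel_entropy_def Ac(2) support_iff_overlap[OF A B] by simp
qed

section \<open>Hypothesis testing\<close>

lemma sqnorm_diff:
  "sqnorm K (\<lambda>i. x i - y i) = sqnorm K x - 2 * Re (\<Sum>i\<in>K. cnj (x i) * y i) + sqnorm K y"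
proof -
  have "(cmod (a - b))\<^sup>2 = (cmod a)\<^sup>2 - 2 * Re (cnj a * b) + (cmod b)\<^sup>2" for a b
    by (simp add: cmod_power2 power2_diff algebra_simps)
  then show ?thesis
    unfolding sqnorm_def by (simp add: sum.distrib sum_subtractf sum_distrib_left)
qed

text \<open>From ln (y / x) <= y / x - 1 one gets x (ln x - ln y) >= - y, and 1 / ln 2 <= 2. Summed
  against a probability distribution in \<open>y\<close>, this is the additive loss of 2 in the
  entropy bound.\<close>

lemma log2_ratio_ge:
  assumes "0 < x" "0 < y"
  shows "- 2 * y \<le> x * (log 2 x - log 2 y)"
proof -
  have "x * ln (y / x) \<le> x * (y / x - 1)"
    using assms by (intro mult_left_mono ln_le_minus_one) auto
  then have "- y \<le> x * (ln x - ln y)"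
    using assms by (simp add: ln_div algebra_simps)
  then have "- y / ln 2 \<le> x * (ln x - ln y) / ln 2" by (rule divide_right_mono) simp
  moreover have "- 2 * y \<le> - y / ln 2"
  proof -
    have "1 \<le> 2 * ln (2 :: real)" using ln_le_minus_one[of "1 / 2 :: real"] by (simp add: ln_div)
    then show ?thesis using assms mult_right_mono[of 1 "2 * ln 2" y] by (simp add: field_simps)
  qed
  ultimately show ?thesis by (simp add: log_def flip: diff_divide_distrib)
qed

text \<open>
  With \<open>P k l = a k |\<langle>u k, v l\<rangle>|\<^sup>2\<close> and \<open>Q k l = b l |\<langle>u k, v l\<rangle>|\<^sup>2\<close> the relative entropy is the classical
  one of \<open>P\<close> and \<open>Q\<close>. Writing \<open>\<langle>u, v\<rangle> = \<langle>u - T u, v\<rangle> + \<langle>u, T v\<rangle>\<close> with \<open>T = W\<^sup>\<dagger> W\<close> bounds the sum of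
  \<open>min P (c Q)\<close> by the error probabilities of the test \<open>T\<close> (Nussbaum and Szkola).
\<close>

lemma rel_entropy_ge_test:
  fixes w :: "'z \<Rightarrow> nat \<Rightarrow> complex"
  assumes \<rho>: "density_op n \<rho>" and \<sigma>: "density_op n \<sigma>" and Z: "finite Z"
    and contr: "\<And>x. sqnorm Z (\<lambda>z. \<Sum>i<n. w z i * x i) \<le> sqnorm {..<n} x"
    and succ: "1 - \<epsilon> \<le> Re (\<Sum>z\<in>Z. \<Sum>i<n. \<Sum>j<n. w z i * \<rho> $$ (i, j) * cnj (w z j))"
    and fail: "Re (\<Sum>z\<in>Z. \<Sum>i<n. \<Sum>j<n. w z i * \<sigma> $$ (i, j) * cnj (w z j)) \<le> q"
    and c: "1 \<le> c"
  shows "ereal ((1 - 2 * (\<epsilon> + c * q)) * log 2 c - 2) \<le> rel_entropy \<rho> \<sigma>"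
proof -
  obtain u a where A: "eigen_decomp n \<rho> u a" and a: "\<And>k. k < n \<Longrightarrow> 0 \<le> a k" and suma: "(\<Sum>k<n. a k) = 1"
    using density_eigen_decomp[OF \<rho>] by blast
  obtain v b where B: "eigen_decomp n \<sigma> v b" and b: "\<And>k. k < n \<Longrightarrow> 0 \<le> b k" and sumb: "(\<Sum>k<n. b k) = 1"
    using density_eigen_decomp[OF \<sigma>] by blast
  have u: "onb n u" and v: "onb n v" using eigen_decompD A B by auto
  define W where "W x z = (\<Sum>i<n. w z i * x i)" for x z
  define T where "T x i = (\<Sum>z\<in>Z. cnj (w z i) * W x z)" for x i
  have sqT: "sqnorm {..<n} (T x) \<le> sqnorm Z (W x)" for x
    unfolding T_def by (rule adjoint_contraction[OF finite_lessThan Z contr])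
  have TT: "(\<Sum>i<n. cnj (x i) * T y i) = (\<Sum>z\<in>Z. cnj (W x z) * W y z)" for x y
  proof -
    have "(\<Sum>i<n. cnj (x i) * T y i) = (\<Sum>i<n. \<Sum>z\<in>Z. cnj (w z i * x i) * W y z)"
      unfolding T_def by (simp add: sum_distrib_left mult_ac)
    also have "\<dots> = (\<Sum>z\<in>Z. (\<Sum>i<n. cnj (w z i * x i)) * W y z)"
      by (subst sum.swap) (simp add: sum_distrib_right)
    finally show ?thesis by (simp add: W_def)
  qed
  have T_self: "(\<Sum>i<n. cnj (T x i) * y i) = (\<Sum>i<n. cnj (x i) * T y i)" for x y
  proof -
    have "(\<Sum>i<n. cnj (T x i) * y i) = cnj (\<Sum>i<n. cnj (y i) * T x i)" by (simp add: mult.commute)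
    then show ?thesis unfolding TT by (simp add: mult.commute)
  qed
  \<comment> \<open>As an operator inequality this is (1 - T)^2 <= 1 - T, while \<open>sqT\<close>
    is T^2 <= T. They turn squared lengths into plain probabilities of rejecting and
    accepting.\<close>
  have sq1T: "sqnorm {..<n} (\<lambda>i. x i - T x i) \<le> sqnorm {..<n} x - sqnorm Z (W x)" for x
  proof -
    have "Re (\<Sum>i<n. cnj (x i) * T x i) = sqnorm Z (W x)"
      unfolding TT sqnorm_def Re_sum by (intro sum.cong refl) (simp add: cmod_power2 flip: power2_eq_square)
    then show ?thesis using sqT[of x] unfolding sqnorm_diff by simp
  qed
  have tr: "Re (\<Sum>z\<in>Z. \<Sum>i<n. \<Sum>j<n. w z i * M $$ (i, j) * cnj (w z j)) = (\<Sum>k<n. m k * sqnorm Z (W (y k)))"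
    if M: "eigen_decomp n M y m" for M y m
  proof -
    have "(\<Sum>i<n. \<Sum>j<n. w z i * M $$ (i, j) * cnj (w z j)) =
       complex_of_real (\<Sum>k<n. m k * (cmod (W (y k) z))\<^sup>2)" for z
    proof -
      have "(\<Sum>i<n. \<Sum>j<n. w z i * M $$ (i, j) * cnj (w z j)) =
          (\<Sum>i<n. \<Sum>j<n. cnj (cnj (w z i)) * (\<Sum>k<n. complex_of_real (m k) * y k i * cnj (y k j)) * cnj (w z j))"
        by (intro sum.cong refl) (simp add: eigen_decompD(3)[OF M])
      also have "\<dots> = (\<Sum>k<n. complex_of_real (m k) * complex_of_real ((cmod (\<Sum>j<n. cnj (y k j) * cnj (w z j)))\<^sup>2))"
        by (rule weighted_gram_form)
      also have "(\<lambda>k. cmod (\<Sum>j<n. cnj (y k j) * cnj (w z j))) = (\<lambda>k. cmod (W (y k) z))"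
        by (rule ext, subst complex_mod_cnj[symmetric]) (simp add: W_def mult.commute)
      finally show ?thesis by simp
    qed
    then have "Re (\<Sum>z\<in>Z. \<Sum>i<n. \<Sum>j<n. w z i * M $$ (i, j) * cnj (w z j)) =
       (\<Sum>z\<in>Z. \<Sum>k<n. m k * (cmod (W (y k) z))\<^sup>2)" by simp
    then show ?thesis by (subst (asm) sum.swap) (simp add: sqnorm_def sum_distrib_left)
  qed
  define y1 where "y1 k l = (\<Sum>i<n. cnj (u k i - T (u k) i) * v l i)" for k l
  define y2 where "y2 k l = (\<Sum>i<n. cnj (u k i) * T (v l) i)" for k l
  \<comment> \<open>The two summands are bounded without their cross term, by |x + y|^2 <= 2 |x|^2 +
    2 |y|^2; this is where the factor 2 in front of the error probabilities comes from.\<close>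
  have G: "overlap n u v k l \<le> 2 * (cmod (y1 k l))\<^sup>2 + 2 * (cmod (y2 k l))\<^sup>2" for k l
  proof -
    have "(\<Sum>i<n. cnj (u k i) * v l i) = y1 k l + y2 k l"
      unfolding y1_def y2_def by (simp add: left_diff_distrib sum_subtractf T_self)
    then have "overlap n u v k l \<le> (cmod (y1 k l) + cmod (y2 k l))\<^sup>2"
      unfolding overlap_def by (simp add: norm_triangle_ineq power_mono)
    also have "\<dots> \<le> 2 * (cmod (y1 k l))\<^sup>2 + 2 * (cmod (y2 k l))\<^sup>2"
      using zero_le_power2[of "cmod (y1 k l) - cmod (y2 k l)"] by (simp add: power2_eq_square algebra_simps)
    finally show ?thesis .
  qed
  \<comment> \<open>Parseval in the basis \<open>v\<close> turns the sum over l into |u k - T (u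
    k)|^2, hence into the probability of rejecting \<open>\<rho>\<close>. Dually, \<open>X2\<close>
    uses the basis \<open>u\<close> and the probability of accepting
    \<open>\<sigma>\<close>.\<close>
  have X1: "(\<Sum>k<n. \<Sum>l<n. a k * (cmod (y1 k l))\<^sup>2) \<le> \<epsilon>"
  proof -
    have "(\<Sum>l<n. (cmod (y1 k l))\<^sup>2) \<le> 1 - sqnorm Z (W (u k))" if k: "k < n" for k
    proof -
      have "(\<Sum>l<n. (cmod (y1 k l))\<^sup>2) = (\<Sum>l<n. (cmod (\<Sum>i<n. cnj (v l i) * (u k i - T (u k) i)))\<^sup>2)"
        unfolding y1_def
        by (intro sum.cong refl, subst complex_mod_cnj[symmetric]) (simp add: mult.commute)
      also have "\<dots> = sqnorm {..<n} (\<lambda>i. u k i - T (u k) i)" by (rule parseval[OF v])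
      also have "\<dots> \<le> 1 - sqnorm Z (W (u k))" using sq1T[of "u k"] onb_sqnorm[OF u k] by simp
      finally show ?thesis .
    qed
    then have "(\<Sum>k<n. a k * (\<Sum>l<n. (cmod (y1 k l))\<^sup>2)) \<le> (\<Sum>k<n. a k * (1 - sqnorm Z (W (u k))))"
      by (intro sum_mono mult_left_mono) (auto intro: a)
    also have "\<dots> \<le> \<epsilon>"
      using succ unfolding tr[OF A] by (simp add: right_diff_distrib sum_subtractf suma)
    finally show ?thesis by (simp add: sum_distrib_left)
  qed
  have X2: "(\<Sum>k<n. \<Sum>l<n. b l * (cmod (y2 k l))\<^sup>2) \<le> q"
  proof -
    have "(\<Sum>l<n. b l * (\<Sum>k<n. (cmod (y2 k l))\<^sup>2)) \<le> (\<Sum>l<n. b l * sqnorm Z (W (v l)))"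
      unfolding y2_def parseval[OF u] by (intro sum_mono mult_left_mono) (auto intro: b sqT)
    also have "\<dots> \<le> q" using fail unfolding tr[OF B] .
    finally show ?thesis by (subst sum.swap) (simp add: sum_distrib_left)
  qed
  show ?thesis
  proof (cases "\<forall>k<n. \<forall>l<n. b l = 0 \<longrightarrow> a k * overlap n u v k l = 0")
    case supp: True
    let ?X = "\<lambda>k l. a k * (cmod (y1 k l))\<^sup>2 + c * (b l * (cmod (y2 k l))\<^sup>2)"
    let ?G = "overlap n u v"
    have logc: "0 \<le> log 2 c" using c by simp
    \<comment> \<open>Pointwise for P = a k G and Q = b l G. If P <= c Q, then P <= 2 X, so the term
      with log c is non-positive and \<open>log2_ratio_ge\<close> does the rest. Otherwise the
      logarithm of the ratio is itself at least log c.\<close>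
    have bound: "log 2 c * (a k * ?G k l - 2 * ?X k l) - 2 * (b l * ?G k l) \<le>
        a k * ?G k l * (log2_pos (a k) - log2_pos (b l))" if k: "k < n" and l: "l < n" for k l
    proof (cases "a k * ?G k l = 0")
      case True
      have "0 \<le> ?X k l" "0 \<le> b l * ?G k l" using a[OF k] b[OF l] c by simp_all
      moreover have "log 2 c * (a k * ?G k l - 2 * ?X k l) = - (2 * (log 2 c * ?X k l))"
        unfolding True by (simp add: algebra_simps)
      ultimately show ?thesis unfolding True using mult_nonneg_nonneg[OF logc, of "?X k l"] by linarith
    next
      case False
      then have pos: "0 < a k" "0 < ?G k l" "0 < b l"
        using a[OF k] b[OF l] supp k l overlap_nonneg[of n u v k l] by (auto simp: order_le_less)
      then have lg: "log2_pos (a k) - log2_pos (b l) = log 2 (a k) - log 2 (b l)" by (simp add: log2_pos_def)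
      have X0: "0 \<le> ?X k l" using a[OF k] b[OF l] c by simp
      show ?thesis
      proof (cases "a k \<le> c * b l")
        case True
        have "a k * ?G k l \<le> a k * (2 * (cmod (y1 k l))\<^sup>2 + 2 * (cmod (y2 k l))\<^sup>2)"
          using G[of k l] pos by (intro mult_left_mono) auto
        also have "\<dots> \<le> 2 * ?X k l"
          using mult_right_mono[OF True, of "(cmod (y2 k l))\<^sup>2"] by (simp add: algebra_simps)
        finally have "log 2 c * (a k * ?G k l - 2 * ?X k l) \<le> 0"
          using logc by (simp add: mult_nonneg_nonpos)
        moreover have "- 2 * b l * ?G k l \<le> a k * (log 2 (a k) - log 2 (b l)) * ?G k l"
          using log2_ratio_ge[OF pos(1,3)] pos(2) by (intro mult_right_mono) auto
        ultimately show ?thesis unfolding lg by (simp add: algebra_simps)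
      next
        case False
        then have "c * b l \<le> a k" by simp
        then have "log 2 (c * b l) \<le> log 2 (a k)" using c pos by simp
        then have "log 2 c \<le> log 2 (a k) - log 2 (b l)" using c pos by (simp add: log_mult)
        then have "log 2 c * (a k * ?G k l) \<le> (log 2 (a k) - log 2 (b l)) * (a k * ?G k l)"
          using pos by (intro mult_right_mono) auto
        moreover have "0 \<le> log 2 c * ?X k l" "0 \<le> b l * ?G k l" using logc X0 pos by simp_all
        ultimately show ?thesis unfolding lg by (simp add: algebra_simps)
      qed
    qed
    have P1: "(\<Sum>k<n. \<Sum>l<n. a k * ?G k l) = 1"
      using sum_overlap[OF v u] suma by (simp flip: sum_distrib_left)
    have Q1: "(\<Sum>k<n. \<Sum>l<n. b l * ?G k l) = 1"
      by (subst sum.swap, subst overlap_commute) (use sum_overlap[OF u v] sumb in \<open>simp flip: sum_distrib_left\<close>)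
    have "(\<Sum>k<n. \<Sum>l<n. ?X k l) \<le> \<epsilon> + c * q"
    proof -
      have "(\<Sum>k<n. \<Sum>l<n. ?X k l) = (\<Sum>k<n. \<Sum>l<n. a k * (cmod (y1 k l))\<^sup>2) +
         c * (\<Sum>k<n. \<Sum>l<n. b l * (cmod (y2 k l))\<^sup>2)"
        unfolding sum.distrib sum_distrib_left[of c] ..
      then show ?thesis using X1 mult_left_mono[OF X2, of c] c by linarith
    qed
    then have "(1 - 2 * (\<epsilon> + c * q)) * log 2 c - 2 \<le> log 2 c * (1 - 2 * (\<Sum>k<n. \<Sum>l<n. ?X k l)) - 2 * 1"
      using logc by (simp add: mult.commute mult_left_mono)
    also have "\<dots> = (\<Sum>k<n. \<Sum>l<n. log 2 c * (a k * ?G k l - 2 * ?X k l) - 2 * (b l * ?G k l))"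
    proof -
      have "(\<Sum>k<n. \<Sum>l<n. log 2 c * (a k * ?G k l - 2 * ?X k l) - 2 * (b l * ?G k l)) =
         log 2 c * ((\<Sum>k<n. \<Sum>l<n. a k * ?G k l) - 2 * (\<Sum>k<n. \<Sum>l<n. ?X k l))
         - 2 * (\<Sum>k<n. \<Sum>l<n. b l * ?G k l)"
        unfolding sum_distrib_left[of "log 2 c"] sum_distrib_left[of 2] sum_subtractf[symmetric] ..
      then show ?thesis unfolding P1 Q1 by simp
    qed
    also have "\<dots> \<le> (\<Sum>k<n. \<Sum>l<n. a k * ?G k l * (log2_pos (a k) - log2_pos (b l)))"
      by (intro sum_mono) (use bound in auto)
    finally show ?thesis unfolding rel_entropy_overlap[OF A B] using supp by simp
  next
    case False
    then show ?thesis unfolding rel_entropy_overlap[OF A B] by auto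
  qed
qed

section \<open>Tensor products\<close>

lemma enc_less: "x < a \<Longrightarrow> y < b \<Longrightarrow> x * b + y < a * (b :: nat)"
  by (metis add.commute add_less_cancel_left less_le_trans mult_Suc mult_le_mono1 Suc_leI)

lemma enc_dec:
  assumes "i < a * (b :: nat)"
  obtains x y where "i = x * b + y" "x < a" "y < b"
proof
  show "i = (i div b) * b + i mod b" by simp
  show "i div b < a" using assms by (simp add: less_mult_imp_div_less)
  show "i mod b < b" using assms by (metis mod_less_divisor mult_0_right not_gr_zero not_less_zero)
qed

lemma enc_div_mod [simp]:
  "y < b \<Longrightarrow> (x * b + y) div b = x" "y < b \<Longrightarrow> (x * b + y) mod b = (y :: nat)"
  by simp_all

lemma enc_bounds: "i < a * b \<Longrightarrow> i div b < a" "i < a * b \<Longrightarrow> i mod b < (b :: nat)"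
  by (auto elim!: enc_dec)

lemma sum_enc: "(\<Sum>i<a * b. f i) = (\<Sum>x<a. \<Sum>y<b. f (x * b + y :: nat))"
proof -
  have "(\<Sum>i<a * b. f i) = (\<Sum>(x, y)\<in>{..<a} \<times> {..<b}. f (x * b + y))"
    by (rule sum.reindex_bij_witness[of _ "\<lambda>(x, y). x * b + y" "\<lambda>i. (i div b, i mod b)"])
      (auto simp: enc_less elim!: enc_dec)
  then show ?thesis by (simp add: sum.cartesian_product)
qed

lemma enc_eq_iff: "y < b \<Longrightarrow> y' < b \<Longrightarrow> x * b + y = x' * b + y' \<longleftrightarrow> x = x' \<and> y = (y' :: nat)"
  by (metis enc_div_mod)

lemma sum_mult_sum4:
  fixes f :: "'a \<Rightarrow> 'b \<Rightarrow> 'e :: comm_semiring_0" and g :: "'c \<Rightarrow> 'd \<Rightarrow> 'e"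
  shows "(\<Sum>i\<in>I. \<Sum>j\<in>J. \<Sum>k\<in>K. \<Sum>l\<in>L. f i k * g j l) = (\<Sum>i\<in>I. \<Sum>k\<in>K. f i k) * (\<Sum>j\<in>J. \<Sum>l\<in>L. g j l)"
proof -
  have "(\<Sum>i\<in>I. \<Sum>j\<in>J. \<Sum>k\<in>K. \<Sum>l\<in>L. f i k * g j l) =
      (\<Sum>i\<in>I. \<Sum>j\<in>J. (\<Sum>k\<in>K. f i k) * (\<Sum>l\<in>L. g j l))"
    by (simp only: sum_product)
  then show ?thesis by (simp only: sum_product)
qed

lemma kron_carrier [intro]:
  "A \<in> carrier_mat m m \<Longrightarrow> B \<in> carrier_mat n n \<Longrightarrow> kron A B \<in> carrier_mat (m * n) (m * n)"
  unfolding kron_def by auto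

lemma kron_entry:
  assumes "A \<in> carrier_mat m m" "B \<in> carrier_mat n n" "i < m" "k < m" "j < n" "l < n"
  shows "kron A B $$ (i * n + j, k * n + l) = A $$ (i, k) * B $$ (j, l)"
  using assms enc_less[OF assms(3,5)] enc_less[OF assms(4,6)] unfolding kron_def by auto

lemma swap_mid_carrier: "swap_mid d1 d2 d3 d4 X \<in> carrier_mat (d1 * d3 * (d2 * d4)) (d1 * d3 * (d2 * d4))"
  unfolding swap_mid_def Let_def by (simp add: mult.assoc)

lemma swap_mid_entry:
  assumes "a < d1" "a' < d1" "b < d2" "b' < d2" "c < d3" "c' < d3" "e < d4" "e' < d4"
  shows "swap_mid d1 d2 d3 d4 X $$ ((a * d3 + c) * (d2 * d4) + (b * d4 + e), (a' * d3 + c') * (d2 * d4) + (b' * d4 + e')) =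
    X $$ ((a * d2 + b) * (d3 * d4) + (c * d4 + e), (a' * d2 + b') * (d3 * d4) + (c' * d4 + e'))"
proof -
  define p where "p i = ((i div (d3 * d2 * d4) * d2 + i div d4 mod d2) * d3 + i div (d2 * d4) mod d3) * d4 + i mod d4" for i
  have p: "p ((a * d3 + c) * (d2 * d4) + (b * d4 + e)) = (a * d2 + b) * (d3 * d4) + (c * d4 + e)"
    if "a < d1" "b < d2" "c < d3" "e < d4" for a b c e
  proof -
    let ?i = "((a * d3 + c) * d2 + b) * d4 + e"
    have "?i div d4 = (a * d3 + c) * d2 + b" "?i mod d4 = e" using that by simp_all
    moreover have "?i div (d2 * d4) = ?i div d4 div d2" "?i div (d3 * d2 * d4) = ?i div d4 div d2 div d3"
      by (metis div_mult2_eq mult.commute, metis div_mult2_eq mult.commute mult.left_commute)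
    ultimately have "p ?i = ((a * d2 + b) * d3 + c) * d4 + e" using that by (simp add: p_def)
    moreover have "(a * d3 + c) * (d2 * d4) + (b * d4 + e) = ?i" by (simp add: algebra_simps)
    ultimately show ?thesis by (simp add: algebra_simps)
  qed
  have l: "(a * d3 + c) * (d2 * d4) + (b * d4 + e) < d1 * d3 * d2 * d4"
    if "a < d1" "b < d2" "c < d3" "e < d4" for a b c e
    using enc_less[OF enc_less[OF that(1,3)] enc_less[OF that(2,4)]] by (simp add: mult.assoc)
  show ?thesis
    unfolding swap_mid_def Let_def p_def[symmetric]
    using assms by (simp add: l p)
qed

text \<open>For an index with digits (a, c, b, e) in the order d1, d3, d2, d4, this is the index (a,
  b) of the first tensor factor; \<open>regroup_snd\<close> is the index (c, e) of the
  second.\<close>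

definition regroup_fst :: "nat \<Rightarrow> nat \<Rightarrow> nat \<Rightarrow> nat \<Rightarrow> nat" where
  "regroup_fst d2 d3 d4 i = i div (d2 * d4) div d3 * d2 + i mod (d2 * d4) div d4"

definition regroup_snd :: "nat \<Rightarrow> nat \<Rightarrow> nat \<Rightarrow> nat \<Rightarrow> nat" where
  "regroup_snd d2 d3 d4 i = i div (d2 * d4) mod d3 * d4 + i mod (d2 * d4) mod d4"

lemma regroup_enc:
  assumes "b < d2" "c < d3" "e < d4"
  shows "regroup_fst d2 d3 d4 ((a * d3 + c) * (d2 * d4) + (b * d4 + e)) = a * d2 + b"
    "regroup_snd d2 d3 d4 ((a * d3 + c) * (d2 * d4) + (b * d4 + e)) = c * d4 + e"
  using assms enc_less[OF assms(1,3)] by (simp_all add: regroup_fst_def regroup_snd_def)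

lemma regroup_dec:
  assumes "i < d1 * d3 * (d2 * d4 :: nat)"
  obtains a b c e where "i = (a * d3 + c) * (d2 * d4) + (b * d4 + e)" "a < d1" "b < d2" "c < d3" "e < d4"
proof -
  obtain x y where "i = x * (d2 * d4) + y" "x < d1 * d3" "y < d2 * d4"
    using enc_dec[OF assms] by blast
  moreover obtain a c where "x = a * d3 + c" "a < d1" "c < d3"
    using enc_dec[OF \<open>x < d1 * d3\<close>] by blast
  moreover obtain b e where "y = b * d4 + e" "b < d2" "e < d4"
    using enc_dec[OF \<open>y < d2 * d4\<close>] by blast
  ultimately show ?thesis using that by blast
qed

lemma swap_kron_entry:
  assumes X: "X \<in> carrier_mat (d1 * d2) (d1 * d2)" and Y: "Y \<in> carrier_mat (d3 * d4) (d3 * d4)"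
    and i: "i < d1 * d3 * (d2 * d4)" and j: "j < d1 * d3 * (d2 * d4)"
  shows "swap_mid d1 d2 d3 d4 (kron X Y) $$ (i, j) =
    X $$ (regroup_fst d2 d3 d4 i, regroup_fst d2 d3 d4 j) * Y $$ (regroup_snd d2 d3 d4 i, regroup_snd d2 d3 d4 j)"
proof -
  obtain a b c e where 1: "i = (a * d3 + c) * (d2 * d4) + (b * d4 + e)" "a < d1" "b < d2" "c < d3" "e < d4"
    by (rule regroup_dec[OF i]) (rule that)
  obtain a' b' c' e' where 2: "j = (a' * d3 + c') * (d2 * d4) + (b' * d4 + e')" "a' < d1" "b' < d2" "c' < d3" "e' < d4"
    by (rule regroup_dec[OF j]) (rule that)
  show ?thesis
    unfolding 1(1) 2(1)
    unfolding swap_mid_entry[OF 1(2) 2(2) 1(3) 2(3) 1(4) 2(4) 1(5) 2(5)]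
      regroup_enc[OF 1(3,4,5)] regroup_enc[OF 2(3,4,5)]
    by (rule kron_entry[OF X Y enc_less[OF 1(2,3)] enc_less[OF 2(2,3)] enc_less[OF 1(4,5)] enc_less[OF 2(4,5)]])
qed

lemma sum_regroup:
  "(\<Sum>i<d1 * d3 * (d2 * d4). f (regroup_fst d2 d3 d4 i) (regroup_snd d2 d3 d4 i)) =
    (\<Sum>x<d1 * d2. \<Sum>y<d3 * d4. f x y)"
proof -
  have "(\<Sum>i<d1 * d3 * (d2 * d4). f (regroup_fst d2 d3 d4 i) (regroup_snd d2 d3 d4 i)) =
     (\<Sum>a<d1. \<Sum>c<d3. \<Sum>b<d2. \<Sum>e<d4. f (a * d2 + b) (c * d4 + e))"
    by (simp add: sum_enc regroup_enc)
  also have "\<dots> = (\<Sum>a<d1. \<Sum>b<d2. \<Sum>c<d3. \<Sum>e<d4. f (a * d2 + b) (c * d4 + e))"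
    by (rule sum.cong[OF refl]) (rule sum.swap)
  finally show ?thesis by (simp add: sum_enc)
qed

lemma sum_regroup_prod:
  fixes f g :: "nat \<Rightarrow> complex"
  shows "(\<Sum>i<d1 * d3 * (d2 * d4). f (regroup_fst d2 d3 d4 i) * g (regroup_snd d2 d3 d4 i)) =
    (\<Sum>x<d1 * d2. f x) * (\<Sum>y<d3 * d4. g y)"
  by (simp add: sum_regroup[of "\<lambda>x y. f x * g y"] sum_product)

text \<open>The vector u k1 \<otimes> v k2. Its number k = (k1, k2) keeps the original order of the
  factors, whereas its component i is read in the regrouped order.\<close>

definition basis_prod :: "nat \<Rightarrow> nat \<Rightarrow> nat \<Rightarrow> (nat \<Rightarrow> nat \<Rightarrow> complex) \<Rightarrow> (nat \<Rightarrow> nat \<Rightarrow> complex) \<Rightarrow> nat \<Rightarrow> nat \<Rightarrow> complex" where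
  "basis_prod d2 d3 d4 u v k i =
     u (k div (d3 * d4)) (regroup_fst d2 d3 d4 i) * v (k mod (d3 * d4)) (regroup_snd d2 d3 d4 i)"

lemma inner_basis_prod:
  "(\<Sum>i<d1 * d3 * (d2 * d4). cnj (basis_prod d2 d3 d4 u v k i) * basis_prod d2 d3 d4 u' v' l i) =
    (\<Sum>x<d1 * d2. cnj (u (k div (d3 * d4)) x) * u' (l div (d3 * d4)) x) *
    (\<Sum>y<d3 * d4. cnj (v (k mod (d3 * d4)) y) * v' (l mod (d3 * d4)) y)"
  unfolding basis_prod_def by (simp add: mult_ac flip: sum_regroup_prod)

lemma regroup_dim: "d1 * d3 * (d2 * d4) = d1 * d2 * (d3 * d4 :: nat)"
  by simp

text \<open>Tensor products of eigenvectors are eigenvectors for the products of the eigenvalues,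
  and regrouping only permutes components.\<close>

lemma eigen_decomp_swap_kron:
  assumes X: "eigen_decomp (d1 * d2) X u a" and Y: "eigen_decomp (d3 * d4) Y v b"
  shows "eigen_decomp (d1 * d3 * (d2 * d4)) (swap_mid d1 d2 d3 d4 (kron X Y)) (basis_prod d2 d3 d4 u v)
    (\<lambda>k. a (k div (d3 * d4)) * b (k mod (d3 * d4)))"
  unfolding eigen_decomp_def
proof (intro conjI allI impI)
  let ?N = "d1 * d3 * (d2 * d4)"
  show "onb ?N (basis_prod d2 d3 d4 u v)"
    unfolding onb_def
  proof (intro allI impI)
    fix k l assume k: "k < ?N" and l: "l < ?N"
    obtain k1 k2 where k12: "k = k1 * (d3 * d4) + k2" "k1 < d1 * d2" "k2 < d3 * d4"
      using k unfolding regroup_dim by (rule enc_dec)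
    obtain l1 l2 where l12: "l = l1 * (d3 * d4) + l2" "l1 < d1 * d2" "l2 < d3 * d4"
      using l unfolding regroup_dim by (rule enc_dec)
    show "(\<Sum>i<?N. cnj (basis_prod d2 d3 d4 u v k i) * basis_prod d2 d3 d4 u v l i) = (if k = l then 1 else 0)"
      unfolding inner_basis_prod k12(1) l12(1)
      using onbD[OF eigen_decompD(2)[OF X] k12(2) l12(2)] onbD[OF eigen_decompD(2)[OF Y] k12(3) l12(3)] k12 l12
      by (simp add: enc_eq_iff)
  qed
  fix i j assume i: "i < ?N" and j: "j < ?N"
  have lt: "regroup_fst d2 d3 d4 i < d1 * d2" "regroup_snd d2 d3 d4 i < d3 * d4" if "i < ?N" for i
    using that by (auto elim!: regroup_dec simp: regroup_enc enc_less)
  show "swap_mid d1 d2 d3 d4 (kron X Y) $$ (i, j) =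
     (\<Sum>k<?N. complex_of_real (a (k div (d3 * d4)) * b (k mod (d3 * d4))) *
         basis_prod d2 d3 d4 u v k i * cnj (basis_prod d2 d3 d4 u v k j))"
    unfolding swap_kron_entry[OF eigen_decompD(1)[OF X] eigen_decompD(1)[OF Y] i j] regroup_dim
      eigen_decompD(3)[OF X lt(1)[OF i] lt(1)[OF j]] eigen_decompD(3)[OF Y lt(2)[OF i] lt(2)[OF j]]
      sum_product sum_enc[where b = "d3 * d4"]
    by (intro sum.cong refl) (simp add: basis_prod_def mult_ac)
qed (rule swap_mid_carrier)

lemma density_swap_kron:
  assumes X: "density_op (d1 * d2) X" and Y: "density_op (d3 * d4) Y"
  shows "density_op (d1 * d3 * (d2 * d4)) (swap_mid d1 d2 d3 d4 (kron X Y))"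
proof -
  obtain u a where A: "eigen_decomp (d1 * d2) X u a" "\<And>k. k < d1 * d2 \<Longrightarrow> 0 \<le> a k" "(\<Sum>k<d1 * d2. a k) = 1"
    using density_eigen_decomp[OF X] by blast
  obtain v b where B: "eigen_decomp (d3 * d4) Y v b" "\<And>k. k < d3 * d4 \<Longrightarrow> 0 \<le> b k" "(\<Sum>k<d3 * d4. b k) = 1"
    using density_eigen_decomp[OF Y] by blast
  note AB = eigen_decomp_swap_kron[OF A(1) B(1)]
  have "psd (swap_mid d1 d2 d3 d4 (kron X Y))"
  proof (rule psd_of_eigen_decomp[OF AB])
    fix k assume "k < d1 * d3 * (d2 * d4)"
    then show "0 \<le> a (k div (d3 * d4)) * b (k mod (d3 * d4))"
      unfolding regroup_dim by (rule enc_dec) (simp add: A(2) B(2))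
  qed
  moreover have "mtrace (swap_mid d1 d2 d3 d4 (kron X Y)) = 1"
    unfolding eigen_decomp_trace[OF AB] regroup_dim sum_enc[where b = "d3 * d4"]
    using A(3) B(3) by (simp flip: sum_product)
  ultimately show ?thesis unfolding density_op_def using swap_mid_carrier by blast
qed

lemma overlap_basis_prod:
  "overlap (d1 * d3 * (d2 * d4)) (basis_prod d2 d3 d4 u v) (basis_prod d2 d3 d4 u' v') k l =
    overlap (d1 * d2) u u' (k div (d3 * d4)) (l div (d3 * d4)) *
    overlap (d3 * d4) v v' (k mod (d3 * d4)) (l mod (d3 * d4))"
  unfolding overlap_def inner_basis_prod by (simp add: norm_mult power_mult_distrib)

text \<open>Eigenvalues and overlaps both multiply, so the classical distributions behind the two
  relative entropies are product distributions, for which relative entropy is additive.\<close>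

lemma rel_entropy_swap_kron:
  assumes X: "density_op (d1 * d2) X" "density_op (d1 * d2) X'" "rel_entropy X X' = ereal r"
    and Y: "density_op (d3 * d4) Y" "density_op (d3 * d4) Y'" "rel_entropy Y Y' = ereal s"
  shows "rel_entropy (swap_mid d1 d2 d3 d4 (kron X Y)) (swap_mid d1 d2 d3 d4 (kron X' Y')) = ereal (r + s)"
proof -
  let ?m = "d1 * d2" and ?n = "d3 * d4"
  obtain u a where A: "eigen_decomp ?m X u a" "\<And>k. k < ?m \<Longrightarrow> 0 \<le> a k" "(\<Sum>k<?m. a k) = 1"
    using density_eigen_decomp[OF X(1)] by blast
  obtain u' a' where A': "eigen_decomp ?m X' u' a'" "\<And>k. k < ?m \<Longrightarrow> 0 \<le> a' k"
    using density_eigen_decomp[OF X(2)] by blast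
  obtain v b where B: "eigen_decomp ?n Y v b" "\<And>k. k < ?n \<Longrightarrow> 0 \<le> b k" "(\<Sum>k<?n. b k) = 1"
    using density_eigen_decomp[OF Y(1)] by blast
  obtain v' b' where B': "eigen_decomp ?n Y' v' b'" "\<And>k. k < ?n \<Longrightarrow> 0 \<le> b' k"
    using density_eigen_decomp[OF Y(2)] by blast
  let ?G = "overlap ?m u u'" and ?H = "overlap ?n v v'"
  have suppX: "\<forall>k<?m. \<forall>l<?m. a' l = 0 \<longrightarrow> a k * ?G k l = 0"
    and r: "r = (\<Sum>k<?m. \<Sum>l<?m. a k * ?G k l * (log2_pos (a k) - log2_pos (a' l)))"
    using X(3) unfolding rel_entropy_overlap[OF A(1) A'(1)] by (simp_all split: if_splits)
  have suppY: "\<forall>k<?n. \<forall>l<?n. b' l = 0 \<longrightarrow> b k * ?H k l = 0"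
    and s: "s = (\<Sum>k<?n. \<Sum>l<?n. b k * ?H k l * (log2_pos (b k) - log2_pos (b' l)))"
    using Y(3) unfolding rel_entropy_overlap[OF B(1) B'(1)] by (simp_all split: if_splits)
  have PX: "(\<Sum>k<?m. \<Sum>l<?m. a k * ?G k l) = 1" and PY: "(\<Sum>k<?n. \<Sum>l<?n. b k * ?H k l) = 1"
    using sum_overlap[OF eigen_decompD(2)[OF A'(1)] eigen_decompD(2)[OF A(1)]]
      sum_overlap[OF eigen_decompD(2)[OF B'(1)] eigen_decompD(2)[OF B(1)]] A(3) B(3)
    by (simp_all flip: sum_distrib_left)
  have lp: "log2_pos (x * y) = log2_pos x + log2_pos y" if "0 < x" "0 < y" for x y
    using that by (simp add: log2_pos_def log_mult)
  \<comment> \<open>\<open>log2_pos\<close> is additive only on positive arguments. A nonzero weight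
    forces all four eigenvalues to be positive by the support conditions, and with a zero weight
    both sides vanish.\<close>
  have split: "(a k1 * b k2) * (?G k1 l1 * ?H k2 l2) * (log2_pos (a k1 * b k2) - log2_pos (a' l1 * b' l2)) =
      a k1 * ?G k1 l1 * (log2_pos (a k1) - log2_pos (a' l1)) * (b k2 * ?H k2 l2)
      + a k1 * ?G k1 l1 * (b k2 * ?H k2 l2 * (log2_pos (b k2) - log2_pos (b' l2)))"
    if "k1 < ?m" "l1 < ?m" "k2 < ?n" "l2 < ?n" for k1 l1 k2 l2
  proof (cases "a k1 * ?G k1 l1 = 0 \<or> b k2 * ?H k2 l2 = 0")
    case False
    then have "0 < a k1" "0 < a' l1" "0 < b k2" "0 < b' l2"
      using suppX suppY A(2)[OF that(1)] A'(2)[OF that(2)] B(2)[OF that(3)] B'(2)[OF that(4)] that by (auto simp: order_le_less)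
    then show ?thesis by (simp add: lp algebra_simps)
  qed auto
  have "(\<Sum>k<?m * ?n. \<Sum>l<?m * ?n.
       a (k div ?n) * b (k mod ?n) * (?G (k div ?n) (l div ?n) * ?H (k mod ?n) (l mod ?n)) *
       (log2_pos (a (k div ?n) * b (k mod ?n)) - log2_pos (a' (l div ?n) * b' (l mod ?n)))) =
     (\<Sum>k1<?m. \<Sum>k2<?n. \<Sum>l1<?m. \<Sum>l2<?n.
       a k1 * ?G k1 l1 * (log2_pos (a k1) - log2_pos (a' l1)) * (b k2 * ?H k2 l2)
      + a k1 * ?G k1 l1 * (b k2 * ?H k2 l2 * (log2_pos (b k2) - log2_pos (b' l2))))"
    unfolding sum_enc[where b = "?n"] by (intro sum.cong refl) (simp add: split)
  also have "\<dots> = r * 1 + 1 * s"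
    unfolding sum.distrib sum_mult_sum4 PX PY r[symmetric] s[symmetric] ..
  finally have val: "(\<Sum>k<?m * ?n. \<Sum>l<?m * ?n.
       a (k div ?n) * b (k mod ?n) * (?G (k div ?n) (l div ?n) * ?H (k mod ?n) (l mod ?n)) *
       (log2_pos (a (k div ?n) * b (k mod ?n)) - log2_pos (a' (l div ?n) * b' (l mod ?n)))) = r + s"
    by simp
  have supp: "\<forall>k<?m * ?n. \<forall>l<?m * ?n. a' (l div ?n) * b' (l mod ?n) = 0 \<longrightarrow>
     a (k div ?n) * b (k mod ?n) * (?G (k div ?n) (l div ?n) * ?H (k mod ?n) (l mod ?n)) = 0"
  proof (intro allI impI)
    fix k l assume k: "k < ?m * ?n" and l: "l < ?m * ?n" and "a' (l div ?n) * b' (l mod ?n) = 0"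
    then show "a (k div ?n) * b (k mod ?n) * (?G (k div ?n) (l div ?n) * ?H (k mod ?n) (l mod ?n)) = 0"
      using suppX suppY enc_bounds[OF k] enc_bounds[OF l] by auto
  qed
  show ?thesis
    unfolding rel_entropy_overlap[OF eigen_decomp_swap_kron[OF A(1) B(1)] eigen_decomp_swap_kron[OF A'(1) B'(1)]]
      overlap_basis_prod
    unfolding regroup_dim
    using supp val by simp
qed

section \<open>Separable states\<close>

text \<open>With trivial second factors the regrouping does nothing, which makes this a case of
  \<open>density_swap_kron\<close>.\<close>

lemma density_kron:
  assumes "density_op m A" "density_op n B"
  shows "density_op (m * n) (kron A B)"
proof -
  have Ac: "A \<in> carrier_mat m m" and Bc: "B \<in> carrier_mat n n" using assms by (auto simp: density_op_def)
  have "swap_mid m 1 n 1 (kron A B) = kron A B"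
  proof (rule eq_matI)
    fix i j assume "i < dim_row (kron A B)" "j < dim_col (kron A B)"
    then have ij: "i < m * n * (1 * 1)" "j < m * n * (1 * 1)" using kron_carrier[OF Ac Bc] by auto
    show "swap_mid m 1 n 1 (kron A B) $$ (i, j) = kron A B $$ (i, j)"
      using swap_kron_entry[of A m 1 B n 1 i j] ij Ac Bc
      by (auto elim!: enc_dec simp: kron_entry[OF Ac Bc] regroup_fst_def regroup_snd_def)
  qed (use kron_carrier[OF Ac Bc] swap_mid_carrier[of m 1 n 1 "kron A B"] in auto)
  then show ?thesis using density_swap_kron[of m 1 A n 1 B] assms by simp
qed

lemma separable_entry:
  assumes "\<And>i. i < m \<Longrightarrow> density_op dA (\<alpha> i) \<and> density_op dB (\<beta> i)"
    and "\<sigma> = mat_sum (dA * dB) (dA * dB) (\<lambda>i. complex_of_real (p i) \<cdot>\<^sub>m kron (\<alpha> i) (\<beta> i)) m"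
    and "a < dA" "a' < dA" "b < dB" "b' < dB"
  shows "\<sigma> $$ (a * dB + b, a' * dB + b') = (\<Sum>i<m. complex_of_real (p i) * (\<alpha> i $$ (a, a') * \<beta> i $$ (b, b')))"
proof -
  have "(complex_of_real (p i) \<cdot>\<^sub>m kron (\<alpha> i) (\<beta> i)) $$ (a * dB + b, a' * dB + b') =
      complex_of_real (p i) * (\<alpha> i $$ (a, a') * \<beta> i $$ (b, b'))" if "i < m" for i
  proof -
    have c: "\<alpha> i \<in> carrier_mat dA dA" "\<beta> i \<in> carrier_mat dB dB" using assms(1)[OF that] by (auto simp: density_op_def)
    show ?thesis using kron_carrier[OF c] kron_entry[OF c assms(3-6)] enc_less assms(3-6) by simp
  qed
  then show ?thesis using enc_less assms(3-6) unfolding assms(2) mat_sum_def by simp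
qed

text \<open>The regrouping takes (\<alpha> \<otimes> \<beta>) \<otimes> (\<gamma> \<otimes>
  \<delta>) to (\<alpha> \<otimes> \<gamma>) \<otimes> (\<beta> \<otimes> \<delta>), again a product
  across the cut. The weights multiply, with pairs of indices encoded in one number.\<close>

lemma separable_swap_kron:
  assumes "separable_state d1 d2 X" "separable_state d3 d4 Y"
  shows "separable_state (d1 * d3) (d2 * d4) (swap_mid d1 d2 d3 d4 (kron X Y))"
proof -
  obtain m p \<alpha> \<beta> where X: "\<And>i. i < m \<Longrightarrow> 0 \<le> p i" "\<And>i. i < m \<Longrightarrow> density_op d1 (\<alpha> i) \<and> density_op d2 (\<beta> i)"
    "(\<Sum>i<m. p i) = 1" "X = mat_sum (d1 * d2) (d1 * d2) (\<lambda>i. complex_of_real (p i) \<cdot>\<^sub>m kron (\<alpha> i) (\<beta> i)) m"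
    using assms(1) unfolding separable_state_def by blast
  obtain n q \<gamma> \<delta> where Y: "\<And>i. i < n \<Longrightarrow> 0 \<le> q i" "\<And>i. i < n \<Longrightarrow> density_op d3 (\<gamma> i) \<and> density_op d4 (\<delta> i)"
    "(\<Sum>i<n. q i) = 1" "Y = mat_sum (d3 * d4) (d3 * d4) (\<lambda>i. complex_of_real (q i) \<cdot>\<^sub>m kron (\<gamma> i) (\<delta> i)) n"
    using assms(2) unfolding separable_state_def by blast
  let ?p = "\<lambda>k. p (k div n) * q (k mod n)"
  let ?a = "\<lambda>k. kron (\<alpha> (k div n)) (\<gamma> (k mod n))" and ?b = "\<lambda>k. kron (\<beta> (k div n)) (\<delta> (k mod n))"
  let ?M = "mat_sum (d1 * d3 * (d2 * d4)) (d1 * d3 * (d2 * d4)) (\<lambda>k. complex_of_real (?p k) \<cdot>\<^sub>m kron (?a k) (?b k)) (m * n)"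
  have dens: "density_op (d1 * d3) (?a k) \<and> density_op (d2 * d4) (?b k)" and pos: "0 \<le> ?p k" if "k < m * n" for k
    using that X(1,2) Y(1,2) by (auto elim!: enc_dec intro!: density_kron)
  have Xc: "X \<in> carrier_mat (d1 * d2) (d1 * d2)" and Yc: "Y \<in> carrier_mat (d3 * d4) (d3 * d4)"
    unfolding X(4) Y(4) mat_sum_def by auto
  have eqM: "swap_mid d1 d2 d3 d4 (kron X Y) = ?M"
  proof (rule eq_matI)
    fix i j assume "i < dim_row ?M" "j < dim_col ?M"
    then have i: "i < d1 * d3 * (d2 * d4)" and j: "j < d1 * d3 * (d2 * d4)" by (auto simp: mat_sum_def)
    obtain a b c e where 1: "i = (a * d3 + c) * (d2 * d4) + (b * d4 + e)" "a < d1" "b < d2" "c < d3" "e < d4"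
      by (rule regroup_dec[OF i]) (rule that)
    obtain a' b' c' e' where 2: "j = (a' * d3 + c') * (d2 * d4) + (b' * d4 + e')" "a' < d1" "b' < d2" "c' < d3" "e' < d4"
      by (rule regroup_dec[OF j]) (rule that)
    have "?M $$ (i, j) = (\<Sum>k<m * n. complex_of_real (?p k) *
        (?a k $$ (a * d3 + c, a' * d3 + c') * ?b k $$ (b * d4 + e, b' * d4 + e')))"
      unfolding 1(1) 2(1)
      by (rule separable_entry[OF dens refl]) (use 1 2 enc_less in auto)
    also have "\<dots> = (\<Sum>x<m. \<Sum>y<n. (complex_of_real (p x) * (\<alpha> x $$ (a, a') * \<beta> x $$ (b, b'))) *
        (complex_of_real (q y) * (\<gamma> y $$ (c, c') * \<delta> y $$ (e, e'))))"
      unfolding sum_enc[where b = n]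
    proof (intro sum.cong refl)
      fix x y assume "x \<in> {..<m}" "y \<in> {..<n}"
      then have xy: "x < m" "y < n" by auto
      then have c: "\<alpha> x \<in> carrier_mat d1 d1" "\<beta> x \<in> carrier_mat d2 d2" "\<gamma> y \<in> carrier_mat d3 d3" "\<delta> y \<in> carrier_mat d4 d4"
        using X(2) Y(2) by (auto simp: density_op_def)
      show "complex_of_real (?p (x * n + y)) *
        (?a (x * n + y) $$ (a * d3 + c, a' * d3 + c') * ?b (x * n + y) $$ (b * d4 + e, b' * d4 + e')) =
        (complex_of_real (p x) * (\<alpha> x $$ (a, a') * \<beta> x $$ (b, b'))) *
        (complex_of_real (q y) * (\<gamma> y $$ (c, c') * \<delta> y $$ (e, e')))"
        using 1 2 xy by (simp add: kron_entry[OF c(1,3)] kron_entry[OF c(2,4)])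
    qed
    also have "\<dots> = X $$ (a * d2 + b, a' * d2 + b') * Y $$ (c * d4 + e, c' * d4 + e')"
      using 1 2 by (simp add: separable_entry[OF X(2,4)] separable_entry[OF Y(2,4)] sum_product)
    also have "\<dots> = swap_mid d1 d2 d3 d4 (kron X Y) $$ (i, j)"
      unfolding swap_kron_entry[OF Xc Yc i j] unfolding 1(1) 2(1) using 1 2 by (simp add: regroup_enc)
    finally show "swap_mid d1 d2 d3 d4 (kron X Y) $$ (i, j) = ?M $$ (i, j)" ..
  qed (use swap_mid_carrier[of d1 d2 d3 d4 "kron X Y"] in \<open>auto simp: mat_sum_def\<close>)
  have sum1: "(\<Sum>k<m * n. ?p k) = 1"
    unfolding sum_enc[where b = n] using X(3) Y(3) by (simp flip: sum_product)
  show ?thesis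
    unfolding separable_state_def
    by (intro exI[of _ "m * n"] exI[of _ ?p] exI[of _ ?a] exI[of _ ?b] conjI allI impI
        pos dens[THEN conjunct1] dens[THEN conjunct2] eqM sum1)
qed

text \<open>Splits a separable state into unnormalised product vectors, to which a bound for product
  vectors can be applied one at a time. The square root of the weight is absorbed into Alice's
  vector.\<close>

lemma separable_gram:
  assumes "separable_state dA dB \<sigma>"
  obtains R :: "(nat \<times> nat \<times> nat) set" and g h where "finite R"
    "\<And>a a' b b'. a < dA \<Longrightarrow> a' < dA \<Longrightarrow> b < dB \<Longrightarrow> b' < dB \<Longrightarrow>
      \<sigma> $$ (a * dB + b, a' * dB + b') = (\<Sum>r\<in>R. (g r a * h r b) * cnj (g r a' * h r b'))"
proof -
  obtain m p \<alpha> \<beta> where X: "\<And>i. i < m \<Longrightarrow> 0 \<le> p i" "\<And>i. i < m \<Longrightarrow> density_op dA (\<alpha> i) \<and> density_op dB (\<beta> i)"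
    "\<sigma> = mat_sum (dA * dB) (dA * dB) (\<lambda>i. complex_of_real (p i) \<cdot>\<^sub>m kron (\<alpha> i) (\<beta> i)) m"
    using assms unfolding separable_state_def by blast
  have "\<exists>g. \<forall>a<dA. \<forall>a'<dA. \<alpha> i $$ (a, a') = (\<Sum>k<dA. g k a * cnj (g k a'))" if "i < m" for i
    using X(2)[OF that] psd_gram[of "\<alpha> i" dA] by (metis density_op_def)
  then obtain ga where ga: "\<And>i a a'. i < m \<Longrightarrow> a < dA \<Longrightarrow> a' < dA \<Longrightarrow>
      \<alpha> i $$ (a, a') = (\<Sum>k<dA. ga i k a * cnj (ga i k a'))" by metis
  have "\<exists>g. \<forall>a<dB. \<forall>a'<dB. \<beta> i $$ (a, a') = (\<Sum>k<dB. g k a * cnj (g k a'))" if "i < m" for i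
    using X(2)[OF that] psd_gram[of "\<beta> i" dB] by (metis density_op_def)
  then obtain gb where gb: "\<And>i a a'. i < m \<Longrightarrow> a < dB \<Longrightarrow> a' < dB \<Longrightarrow>
      \<beta> i $$ (a, a') = (\<Sum>k<dB. gb i k a * cnj (gb i k a'))" by metis
  let ?R = "{..<m} \<times> {..<dA} \<times> {..<dB}"
  define g where "g = (\<lambda>(i :: nat, k :: nat, l :: nat) (a :: nat). complex_of_real (sqrt (p i)) * ga i k a)"
  define h where "h = (\<lambda>(i :: nat, k :: nat, l :: nat) (b :: nat). gb i l b)"
  have "\<sigma> $$ (a * dB + b, a' * dB + b') = (\<Sum>r\<in>?R. (g r a * h r b) * cnj (g r a' * h r b'))"
    if ab: "a < dA" "a' < dA" "b < dB" "b' < dB" for a a' b b'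
  proof -
    have "\<sigma> $$ (a * dB + b, a' * dB + b') = (\<Sum>i<m. complex_of_real (p i) * (\<alpha> i $$ (a, a') * \<beta> i $$ (b, b')))"
      by (rule separable_entry[OF X(2,3) ab])
    also have "\<dots> = (\<Sum>i<m. \<Sum>k<dA. \<Sum>l<dB. (g (i, k, l) a * h (i, k, l) b) * cnj (g (i, k, l) a' * h (i, k, l) b'))"
    proof (rule sum.cong[OF refl])
      fix i assume "i \<in> {..<m}"
      then have i: "i < m" by simp
      have p: "complex_of_real (p i) = complex_of_real (sqrt (p i)) * complex_of_real (sqrt (p i))"
        using X(1)[OF i] by (simp flip: of_real_mult)
      show "complex_of_real (p i) * (\<alpha> i $$ (a, a') * \<beta> i $$ (b, b')) =
        (\<Sum>k<dA. \<Sum>l<dB. (g (i, k, l) a * h (i, k, l) b) * cnj (g (i, k, l) a' * h (i, k, l) b'))"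
        unfolding ga[OF i ab(1,2)] gb[OF i ab(3,4)] sum_product p
        unfolding sum_distrib_left
        by (intro sum.cong refl) (simp add: g_def h_def mult_ac)
    qed
    finally show ?thesis by (simp add: sum.cartesian_product case_prod_unfold)
  qed
  then show ?thesis using that[of ?R g h] by blast
qed

lemma separable_density:
  assumes "separable_state dA dB \<sigma>"
  shows "density_op (dA * dB) \<sigma>"
proof -
  obtain R :: "(nat \<times> nat \<times> nat) set" and g h where R: "finite R"
    "\<And>a a' b b'. a < dA \<Longrightarrow> a' < dA \<Longrightarrow> b < dB \<Longrightarrow> b' < dB \<Longrightarrow>
      \<sigma> $$ (a * dB + b, a' * dB + b') = (\<Sum>r\<in>R. (g r a * h r b) * cnj (g r a' * h r b'))"
    using separable_gram[OF assms] by blast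
  obtain m p \<alpha> \<beta> where X: "\<And>i. i < m \<Longrightarrow> density_op dA (\<alpha> i) \<and> density_op dB (\<beta> i)" "(\<Sum>i<m. p i) = (1 :: real)"
    "\<sigma> = mat_sum (dA * dB) (dA * dB) (\<lambda>i. complex_of_real (p i) \<cdot>\<^sub>m kron (\<alpha> i) (\<beta> i)) m"
    using assms unfolding separable_state_def by blast
  have c: "\<sigma> \<in> carrier_mat (dA * dB) (dA * dB)" unfolding X(3) mat_sum_def by simp
  have "psd \<sigma>"
    by (rule psd_of_gram[OF c, where K = R and g = "\<lambda>r i. g r (i div dB) * h r (i mod dB)"]) (auto elim!: enc_dec simp: R(2))
  moreover have "mtrace \<sigma> = 1"
  proof -
    have "mtrace \<sigma> = (\<Sum>a<dA. \<Sum>b<dB. \<Sum>i<m. complex_of_real (p i) * (\<alpha> i $$ (a, a) * \<beta> i $$ (b, b)))"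
      using c by (simp add: mtrace_def sum_enc separable_entry[OF X(1,3)])
    also have "\<dots> = (\<Sum>i<m. complex_of_real (p i) * (mtrace (\<alpha> i) * mtrace (\<beta> i)))"
    proof (subst sum_rotate, intro sum.cong refl)
      fix i assume "i \<in> {..<m}"
      then have "\<alpha> i \<in> carrier_mat dA dA" "\<beta> i \<in> carrier_mat dB dB" using X(1) by (auto simp: density_op_def)
      then show "(\<Sum>a<dA. \<Sum>b<dB. complex_of_real (p i) * (\<alpha> i $$ (a, a) * \<beta> i $$ (b, b))) =
        complex_of_real (p i) * (mtrace (\<alpha> i) * mtrace (\<beta> i))"
        by (simp add: mtrace_def sum_product) (simp add: sum_distrib_left)
    qed
    also have "\<dots> = (\<Sum>i<m. complex_of_real (p i))"
      by (intro sum.cong refl) (use X(1) in \<open>auto simp: density_op_def\<close>)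
    also have "\<dots> = 1" using X(2) by (simp flip: of_real_sum)
    finally show ?thesis .
  qed
  ultimately show ?thesis using c unfolding density_op_def by blast
qed

section \<open>Subadditivity of the relative entropy of entanglement\<close>

lemma eigen_decomp_one: "eigen_decomp 1 (1\<^sub>m 1) (\<lambda>_ _. 1) (\<lambda>_. 1)"
  unfolding eigen_decomp_def onb_def by simp

lemma density_one: "density_op 1 (1\<^sub>m 1)"
  using psd_of_eigen_decomp[OF eigen_decomp_one] by (simp add: density_op_def mtrace_def)

lemma separable_one: "separable_state 1 1 (1\<^sub>m 1)"
  unfolding separable_state_def
proof (intro exI[of _ 1] exI[of _ "\<lambda>_. 1"] exI[of _ "\<lambda>_. 1\<^sub>m 1"] conjI allI impI)
  show "1\<^sub>m 1 = mat_sum (1 * 1) (1 * 1) (\<lambda>i. complex_of_real 1 \<cdot>\<^sub>m kron (1\<^sub>m 1) (1\<^sub>m 1)) 1"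
    by (rule eq_matI) (auto simp: mat_sum_def kron_def)
qed (use density_one in auto)

lemma separable_tensor_pow2:
  "separable_state dA dB \<sigma> \<Longrightarrow> separable_state (dA ^ n) (dB ^ n) (tensor_pow2 dA dB \<sigma> n)"
proof (induction n)
  case 0
  then show ?case using separable_one by simp
next
  case (Suc n)
  then show ?case using separable_swap_kron[of "dA ^ n" "dB ^ n" _ dA dB \<sigma>] by (simp add: mult.commute)
qed

lemma density_tensor_pow2:
  "density_op (dA * dB) \<rho> \<Longrightarrow> density_op (dA ^ n * dB ^ n) (tensor_pow2 dA dB \<rho> n)"
proof (induction n)
  case 0
  then show ?case using density_one by simp
next
  case (Suc n)
  then have "density_op (dA ^ n * dA * (dB ^ n * dB)) (tensor_pow2 dA dB \<rho> (Suc n))"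
    using density_swap_kron[of "dA ^ n" "dB ^ n" _ dA dB \<rho>] by simp
  moreover have "dA ^ n * dA * (dB ^ n * dB) = dA ^ Suc n * dB ^ Suc n" by simp
  ultimately show ?case by (simp only:)
qed

lemma rel_entropy_tensor_pow2:
  assumes "density_op (dA * dB) \<rho>" "density_op (dA * dB) \<sigma>" "rel_entropy \<rho> \<sigma> = ereal r"
  shows "rel_entropy (tensor_pow2 dA dB \<rho> n) (tensor_pow2 dA dB \<sigma> n) = ereal (real n * r)"
proof (induction n)
  case 0
  show ?case
    using rel_entropy_overlap[OF eigen_decomp_one eigen_decomp_one] by (simp add: log2_pos_def zero_ereal_def)
next
  case (Suc n)
  then show ?case
    using rel_entropy_swap_kron[OF density_tensor_pow2[OF assms(1)] density_tensor_pow2[OF assms(2)] Suc assms]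
    by (simp add: algebra_simps)
qed

lemma rel_entropy_not_MInf: "rel_entropy \<rho> \<sigma> \<noteq> - \<infinity>"
  by (simp add: rel_entropy_def)

text \<open>The tensor powers of a separable \<open>\<sigma>\<close> compete in the infimum for the
  powers of \<open>\<rho>\<close>, with n times the relative entropy of one copy. If that is
  infinite, there is nothing to show.\<close>

lemma reg_rel_ent_entanglement_le:
  assumes "density_op (dA * dB) \<rho>"
  shows "reg_rel_ent_entanglement dA dB \<rho> \<le> rel_ent_entanglement dA dB \<rho>"
  unfolding rel_ent_entanglement_def[of dA dB]
proof (rule INF_greatest)
  fix \<sigma> assume "\<sigma> \<in> {\<sigma>. separable_state dA dB \<sigma>}"
  then have \<sigma>: "separable_state dA dB \<sigma>" by simp
  show "reg_rel_ent_entanglement dA dB \<rho> \<le> rel_entropy \<rho> \<sigma>"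
  proof (cases "rel_entropy \<rho> \<sigma>")
    case (real r)
    have "rel_ent_entanglement (dA ^ n) (dB ^ n) (tensor_pow2 dA dB \<rho> n) / ereal (real n) \<le> ereal r" if "0 < n" for n
    proof -
      have "rel_ent_entanglement (dA ^ n) (dB ^ n) (tensor_pow2 dA dB \<rho> n) \<le>
          rel_entropy (tensor_pow2 dA dB \<rho> n) (tensor_pow2 dA dB \<sigma> n)"
        unfolding rel_ent_entanglement_def by (rule INF_lower) (use separable_tensor_pow2[OF \<sigma>] in simp)
      also have "\<dots> = ereal (real n * r)"
        by (rule rel_entropy_tensor_pow2[OF assms separable_density[OF \<sigma>] real])
      finally have "rel_ent_entanglement (dA ^ n) (dB ^ n) (tensor_pow2 dA dB \<rho> n) / ereal (real n) \<le>
          ereal (real n * r) / ereal (real n)"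
        using that by (intro ereal_divide_right_mono) auto
      then show ?thesis using that by simp
    qed
    then show ?thesis
      unfolding reg_rel_ent_entanglement_def real
      by (intro Limsup_bounded) (auto simp: eventually_sequentially intro!: exI[of _ 1])
  qed (use rel_entropy_not_MInf in auto)
qed

section \<open>The structure of LOPC operations\<close>

lemma ampliate_carrier [simp]: "ampliate d1 d2 d3 m \<Lambda> X \<in> carrier_mat (d1 * m * d3) (d1 * m * d3)"
  unfolding ampliate_def by simp

lemma ampliate_entry:
  assumes "x < d1" "x' < d1" "i < m" "i' < m" "y < d3" "y' < d3"
  shows "ampliate d1 d2 d3 m \<Lambda> X $$ ((x * m + i) * d3 + y, (x' * m + i') * d3 + y') =
    \<Lambda> (mat d2 d2 (\<lambda>(k, l). X $$ ((x * d2 + k) * d3 + y, (x' * d2 + l) * d3 + y'))) $$ (i, i')"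
proof -
  have d: "((x * m + i) * d3 + y) div (m * d3) = x" if "i < m" "y < d3" for x i y
    using that by (metis div_mult2_eq enc_div_mod(1) mult.commute)
  show ?thesis
    unfolding ampliate_def using assms by (simp add: d enc_less)
qed

lemma cptpD:
  assumes "cptp d m \<Lambda>"
  shows "X \<in> carrier_mat d d \<Longrightarrow> \<Lambda> X \<in> carrier_mat m m"
    "X \<in> carrier_mat d d \<Longrightarrow> mtrace (\<Lambda> X) = mtrace X"
    "X \<in> carrier_mat d d \<Longrightarrow> Y \<in> carrier_mat d d \<Longrightarrow> \<Lambda> (X + Y) = \<Lambda> X + \<Lambda> Y"
    "X \<in> carrier_mat d d \<Longrightarrow> \<Lambda> (c \<cdot>\<^sub>m X) = c \<cdot>\<^sub>m \<Lambda> X"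
    "X \<in> carrier_mat (k * d) (k * d) \<Longrightarrow> psd X \<Longrightarrow> psd (ampliate k d 1 m \<Lambda> X)"
  using assms unfolding cptp_def by blast+

text \<open>Linearity for finite combinations. The empty one needs that \<open>\<Lambda>\<close>
  maps 0 to 0, which is homogeneity with the scalar 0.\<close>

lemma cptp_sum:
  assumes \<Lambda>: "cptp d m \<Lambda>" and S: "finite S" and ij: "i < m" "j < m"
  shows "\<Lambda> (mat d d (\<lambda>(p, q). \<Sum>z\<in>S. f z * K z p q)) $$ (i, j) =
    (\<Sum>z\<in>S. f z * \<Lambda> (mat d d (\<lambda>(p, q). K z p q)) $$ (i, j))"
  using S
proof (induction S rule: finite_induct)
  case empty
  have 0: "0 \<cdot>\<^sub>m (0\<^sub>m d d :: complex mat) = mat d d (\<lambda>_. 0)" by (rule eq_matI) auto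
  have "\<Lambda> (mat d d (\<lambda>_. 0)) = 0 \<cdot>\<^sub>m \<Lambda> (0\<^sub>m d d)"
    unfolding 0[symmetric] by (rule cptpD(4)[OF \<Lambda>]) simp
  then show ?case using cptpD(1)[OF \<Lambda>, of "0\<^sub>m d d"] ij by auto
next
  case (insert z S)
  let ?A = "mat d d (\<lambda>(p, q). K z p q)" and ?B = "mat d d (\<lambda>(p, q). \<Sum>z\<in>S. f z * K z p q)"
  have "mat d d (\<lambda>(p, q). \<Sum>z\<in>insert z S. f z * K z p q) = f z \<cdot>\<^sub>m ?A + ?B"
    using insert(1,2) by (intro eq_matI) auto
  then have "\<Lambda> (mat d d (\<lambda>(p, q). \<Sum>z\<in>insert z S. f z * K z p q)) = f z \<cdot>\<^sub>m \<Lambda> ?A + \<Lambda> ?B"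
    by (simp add: cptpD(3)[OF \<Lambda>] cptpD(4)[OF \<Lambda>])
  moreover have "\<Lambda> ?A \<in> carrier_mat m m" "\<Lambda> ?B \<in> carrier_mat m m"
    by (auto intro: cptpD(1)[OF \<Lambda>])
  ultimately show ?case using insert ij by auto
qed

text \<open>\<open>K i i' k k'\<close> is the entry \<open>\<langle>i| \<Phi>(|k\<rangle>\<langle>k'|) |i'\<rangle>\<close> of a completely positive map \<open>\<Phi>\<close> from dimension
  \<open>d\<close> to dimension \<open>m\<close>, and the vectors \<open>g\<close> are its Kraus operators.\<close>

definition cp_kernel :: "nat \<Rightarrow> nat \<Rightarrow> (nat \<Rightarrow> nat \<Rightarrow> nat \<Rightarrow> nat \<Rightarrow> complex) \<Rightarrow> bool" where
  "cp_kernel m d K \<longleftrightarrow> (\<exists>(r :: nat) g. \<forall>i<m. \<forall>i'<m. \<forall>k<d. \<forall>k'<d.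
     K i i' k k' = (\<Sum>x<r. g x i k * cnj (g x i' k')))"

lemma cp_kernelI:
  "(\<And>i i' k k'. i < m \<Longrightarrow> i' < m \<Longrightarrow> k < d \<Longrightarrow> k' < d \<Longrightarrow>
     K i i' k k' = (\<Sum>x<(r :: nat). g x i k * cnj (g x i' k'))) \<Longrightarrow> cp_kernel m d K"
  unfolding cp_kernel_def by blast

text \<open>The Kraus operators are set to zero on the outputs that violate \<open>Q\<close> and
  relabelled by \<open>h\<close>. For a public message, \<open>Q\<close> selects its value and
  \<open>h\<close> strips the received copy.\<close>

lemma cp_kernel_restrict:
  assumes "cp_kernel m d K" "\<And>i. i < m' \<Longrightarrow> h i < m"
  shows "cp_kernel m' d (\<lambda>i i' k k'. if Q i \<and> Q i' then K (h i) (h i') k k' else 0)"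
proof -
  obtain r :: nat and g where g: "\<And>i i' k k'. i < m \<Longrightarrow> i' < m \<Longrightarrow> k < d \<Longrightarrow> k' < d \<Longrightarrow>
     K i i' k k' = (\<Sum>x<r. g x i k * cnj (g x i' k'))" using assms(1) unfolding cp_kernel_def by blast
  show ?thesis
    by (rule cp_kernelI[where r = r and g = "\<lambda>x i k. if Q i then g x (h i) k else 0"]) (auto simp: g assms(2))
qed

text \<open>Choi's argument: \<open>M\<close> is the Choi matrix of the first map, with a reference
  system of dimension \<open>a\<close>. Complete positivity keeps it positive when
  \<open>\<Lambda>\<close> acts on the other half, and the Gram vectors of the result are the Kraus
  operators of the composition.\<close>

lemma cp_kernel_cptp:
  assumes K: "cp_kernel d a K" and \<Lambda>: "cptp d m \<Lambda>"
  shows "cp_kernel m a (\<lambda>i i' k k'. \<Lambda> (mat d d (\<lambda>(p, q). K p q k k')) $$ (i, i'))"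
proof -
  obtain r :: nat and g where g: "\<And>i i' k k'. i < d \<Longrightarrow> i' < d \<Longrightarrow> k < a \<Longrightarrow> k' < a \<Longrightarrow>
     K i i' k k' = (\<Sum>x<r. g x i k * cnj (g x i' k'))" using K unfolding cp_kernel_def by blast
  define M where "M = mat (a * d) (a * d) (\<lambda>(i, j). K (i mod d) (j mod d) (i div d) (j div d))"
  have M: "M \<in> carrier_mat (a * d) (a * d)" by (simp add: M_def)
  have "psd M"
    by (rule psd_of_gram[OF M, where K = "{..<r}" and g = "\<lambda>x i. g x (i mod d) (i div d)"])
      (simp add: M_def g enc_bounds)
  then have "psd (ampliate a d 1 m \<Lambda> M)" by (rule cptpD(5)[OF \<Lambda> M])
  then obtain h where h: "\<And>i j. i < a * m * 1 \<Longrightarrow> j < a * m * 1 \<Longrightarrow>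
      ampliate a d 1 m \<Lambda> M $$ (i, j) = (\<Sum>x<a * m * 1. h x i * cnj (h x j))"
    by (rule psd_gram[OF _ ampliate_carrier]) (rule that)
  show ?thesis
  proof (rule cp_kernelI[where r = "a * m * 1" and g = "\<lambda>x i k. h x ((k * m + i) * 1 + 0)"])
    fix i i' k k' assume b: "i < m" "i' < m" "k < a" "k' < a"
    have "\<Lambda> (mat d d (\<lambda>(p, q). K p q k k')) $$ (i, i') =
        \<Lambda> (mat d d (\<lambda>(p, q). M $$ ((k * d + p) * 1 + 0, (k' * d + q) * 1 + 0))) $$ (i, i')"
    proof -
      have "mat d d (\<lambda>(p, q). K p q k k') = mat d d (\<lambda>(p, q). M $$ ((k * d + p) * 1 + 0, (k' * d + q) * 1 + 0))"
        by (rule eq_matI) (use b in \<open>auto simp: M_def enc_less\<close>)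
      then show ?thesis by simp
    qed
    also have "\<dots> = ampliate a d 1 m \<Lambda> M $$ ((k * m + i) * 1 + 0, (k' * m + i') * 1 + 0)"
      by (rule ampliate_entry[symmetric]) (use b in auto)
    also have "\<dots> = (\<Sum>x<a * m * 1. h x ((k * m + i) * 1 + 0) * cnj (h x ((k' * m + i') * 1 + 0)))"
      by (rule h) (use b in \<open>simp_all add: enc_less\<close>)
    finally show "\<Lambda> (mat d d (\<lambda>(p, q). K p q k k')) $$ (i, i') =
        (\<Sum>x<a * m * 1. h x ((k * m + i) * 1 + 0) * cnj (h x ((k' * m + i') * 1 + 0)))" .
  qed
qed

lemma cptp_trace_entries:
  assumes \<Lambda>: "cptp d m \<Lambda>"
  shows "(\<Sum>i<m. \<Lambda> (mat d d (\<lambda>(p, q). K p q)) $$ (i, i)) = (\<Sum>p<d. K p p)"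
  using cptpD(1,2)[OF \<Lambda>, of "mat d d (\<lambda>(p, q). K p q)"] by (simp add: mtrace_def)

abbreviation quad :: "nat \<Rightarrow> nat \<Rightarrow> (nat \<times> nat \<times> nat \<times> nat) set" where
  "quad a b \<equiv> {..<a} \<times> {..<a} \<times> {..<b} \<times> {..<b}"

text \<open>
  An LOPC operation is a sum over the \<open>N\<close> transcripts \<open>c\<close> of the public communication. Given the
  transcript, Alice and Bob have applied completely positive maps with kernels \<open>KA c\<close> and \<open>KB c\<close>,
  while Eve has only recorded \<open>c\<close>, so that the operation is block diagonal in her register.
\<close>

definition lopc_repr :: "nat \<Rightarrow> nat \<Rightarrow> nat \<Rightarrow> nat \<Rightarrow> nat \<Rightarrow> nat \<Rightarrow> (complex mat \<Rightarrow> complex mat) \<Rightarrow> nat \<Rightarrow>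
    (nat \<Rightarrow> nat \<Rightarrow> nat \<Rightarrow> nat \<Rightarrow> nat \<Rightarrow> complex) \<Rightarrow> (nat \<Rightarrow> nat \<Rightarrow> nat \<Rightarrow> nat \<Rightarrow> nat \<Rightarrow> complex) \<Rightarrow> bool" where
  "lopc_repr a0 b0 e0 a1 b1 e1 F N KA KB \<longleftrightarrow>
     e1 = e0 * N \<and>
     (\<forall>c<N. cp_kernel a1 a0 (KA c) \<and> cp_kernel b1 b0 (KB c)) \<and>
     (\<forall>a<a0. \<forall>a'<a0. \<forall>b<b0. \<forall>b'<b0.
        (\<Sum>c<N. (\<Sum>p<a1. KA c p p a a') * (\<Sum>q<b1. KB c q q b b')) = (if a = a' \<and> b = b' then 1 else 0)) \<and>
     (\<forall>X \<in> carrier_mat (a0 * b0 * e0) (a0 * b0 * e0). F X \<in> carrier_mat (a1 * b1 * e1) (a1 * b1 * e1) \<and>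
       (\<forall>p<a1. \<forall>p'<a1. \<forall>q<b1. \<forall>q'<b1. \<forall>e<e0. \<forall>e'<e0. \<forall>c<N. \<forall>c'<N.
          F X $$ ((p * b1 + q) * e1 + (e * N + c), (p' * b1 + q') * e1 + (e' * N + c')) =
          (if c = c' then \<Sum>(a, a', b, b')\<in>quad a0 b0.
             KA c p p' a a' * KB c q q' b b' * X $$ ((a * b0 + b) * e0 + e, (a' * b0 + b') * e0 + e') else 0)))"

lemma lopc_reprD:
  assumes "lopc_repr a0 b0 e0 a1 b1 e1 F N KA KB"
  shows "e1 = e0 * N"
    "c < N \<Longrightarrow> cp_kernel a1 a0 (KA c)" "c < N \<Longrightarrow> cp_kernel b1 b0 (KB c)"
    "a < a0 \<Longrightarrow> a' < a0 \<Longrightarrow> b < b0 \<Longrightarrow> b' < b0 \<Longrightarrow>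
      (\<Sum>c<N. (\<Sum>p<a1. KA c p p a a') * (\<Sum>q<b1. KB c q q b b')) = (if a = a' \<and> b = b' then 1 else 0)"
    "X \<in> carrier_mat (a0 * b0 * e0) (a0 * b0 * e0) \<Longrightarrow> F X \<in> carrier_mat (a1 * b1 * e1) (a1 * b1 * e1)"
    "X \<in> carrier_mat (a0 * b0 * e0) (a0 * b0 * e0) \<Longrightarrow>
       p < a1 \<Longrightarrow> p' < a1 \<Longrightarrow> q < b1 \<Longrightarrow> q' < b1 \<Longrightarrow> e < e0 \<Longrightarrow> e' < e0 \<Longrightarrow> c < N \<Longrightarrow> c' < N \<Longrightarrow>
          F X $$ ((p * b1 + q) * e1 + (e * N + c), (p' * b1 + q') * e1 + (e' * N + c')) =
          (if c = c' then \<Sum>(a, a', b, b')\<in>quad a0 b0.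
             KA c p p' a a' * KB c q q' b b' * X $$ ((a * b0 + b) * e0 + e, (a' * b0 + b') * e0 + e') else 0)"
proof -
  note R = assms[unfolded lopc_repr_def]
  show "e1 = e0 * N" by (rule R[THEN conjunct1])
  show "c < N \<Longrightarrow> cp_kernel a1 a0 (KA c)" "c < N \<Longrightarrow> cp_kernel b1 b0 (KB c)"
    using R[THEN conjunct2, THEN conjunct1] by simp_all
  show "a < a0 \<Longrightarrow> a' < a0 \<Longrightarrow> b < b0 \<Longrightarrow> b' < b0 \<Longrightarrow>
      (\<Sum>c<N. (\<Sum>p<a1. KA c p p a a') * (\<Sum>q<b1. KB c q q b b')) = (if a = a' \<and> b = b' then 1 else 0)"
    by (rule R[THEN conjunct2, THEN conjunct2, THEN conjunct1, rule_format])
  note X = R[THEN conjunct2, THEN conjunct2, THEN conjunct2, rule_format]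
  show "X \<in> carrier_mat (a0 * b0 * e0) (a0 * b0 * e0) \<Longrightarrow> F X \<in> carrier_mat (a1 * b1 * e1) (a1 * b1 * e1)"
    by (rule X[THEN conjunct1])
  show "X \<in> carrier_mat (a0 * b0 * e0) (a0 * b0 * e0) \<Longrightarrow>
       p < a1 \<Longrightarrow> p' < a1 \<Longrightarrow> q < b1 \<Longrightarrow> q' < b1 \<Longrightarrow> e < e0 \<Longrightarrow> e' < e0 \<Longrightarrow> c < N \<Longrightarrow> c' < N \<Longrightarrow>
          F X $$ ((p * b1 + q) * e1 + (e * N + c), (p' * b1 + q') * e1 + (e' * N + c')) =
          (if c = c' then \<Sum>(a, a', b, b')\<in>quad a0 b0.
             KA c p p' a a' * KB c q q' b b' * X $$ ((a * b0 + b) * e0 + e, (a' * b0 + b') * e0 + e') else 0)"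
    by (rule X[THEN conjunct2, rule_format])
qed

lemma lopc_repr_none:
  "lopc_repr a b e a b e (\<lambda>X. X) 1
    (\<lambda>c p p' k k'. (if p = k then 1 else 0) * (if p' = k' then 1 else 0))
    (\<lambda>c p p' k k'. (if p = k then 1 else 0) * (if p' = k' then 1 else 0))"
proof -
  let ?K = "\<lambda>p p' k k' :: nat. ((if p = k then 1 else 0) * (if p' = k' then 1 else 0) :: complex)"
  have cp: "cp_kernel m m ?K" for m
    by (rule cp_kernelI[where r = 1 and g = "\<lambda>x p k. if p = k then 1 else 0"]) simp
  have tr: "(\<Sum>p<m. ?K p p k k') = (if k = k' then 1 else 0)" if "k < m" for m k k'
    using that by (simp add: sum_kronecker(2))
  have entry: "(\<Sum>(k, k', l, l')\<in>quad a b. ?K p p' k k' * ?K q q' l l' * f k k' l l') = f p p' q q'"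
    if "p < a" "p' < a" "q < b" "q' < b" for p p' q q' f
  proof -
    have "(\<Sum>(k, k', l, l')\<in>quad a b. ?K p p' k k' * ?K q q' l l' * f k k' l l') =
       (\<Sum>z\<in>quad a b. if z = (p, p', q, q') then f p p' q q' else 0)"
      by (intro sum.cong refl) (auto split: if_splits)
    then show ?thesis using that by simp
  qed
  show ?thesis
    unfolding lopc_repr_def
    using cp tr entry[of _ _ _ _ "\<lambda>k k' l l'. _ $$ (((k * b + l) * e + _), ((k' * b + l') * e + _))"]
    by simp
qed

text \<open>The local map acts on the output indices of each kernel \<open>KA c\<close>. As it
  preserves the trace, the completeness relation over the transcripts is inherited.\<close>

lemma lopc_repr_local_A:
  assumes R: "lopc_repr a0 b0 e0 dA dB dE F N KA KB" and \<Lambda>: "cptp dA m \<Lambda>"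
  shows "lopc_repr a0 b0 e0 m dB dE (\<lambda>X. ampliate 1 dA (dB * dE) m \<Lambda> (F X)) N
    (\<lambda>c p p' k k'. \<Lambda> (mat dA dA (\<lambda>(x, y). KA c x y k k')) $$ (p, p')) KB"
  unfolding lopc_repr_def
proof (intro conjI allI impI ballI)
  show "dE = e0 * N" by (rule lopc_reprD(1)[OF R])
next
  fix c assume "c < N"
  then show "cp_kernel m a0 (\<lambda>p p' k k'. \<Lambda> (mat dA dA (\<lambda>(x, y). KA c x y k k')) $$ (p, p'))" "cp_kernel dB b0 (KB c)"
    using cp_kernel_cptp[OF lopc_reprD(2)[OF R] \<Lambda>] lopc_reprD(3)[OF R] by auto
next
  fix a a' b b' assume "a < a0" "a' < a0" "b < b0" "b' < b0"
  then show "(\<Sum>c<N. (\<Sum>p<m. \<Lambda> (mat dA dA (\<lambda>(x, y). KA c x y a a')) $$ (p, p)) * (\<Sum>q<dB. KB c q q b b'))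
      = (if a = a' \<and> b = b' then 1 else 0)"
    unfolding cptp_trace_entries[OF \<Lambda>] by (rule lopc_reprD(4)[OF R])
next
  fix X :: "complex mat" assume X: "X \<in> carrier_mat (a0 * b0 * e0) (a0 * b0 * e0)"
  show "ampliate 1 dA (dB * dE) m \<Lambda> (F X) \<in> carrier_mat (m * dB * dE) (m * dB * dE)"
    using ampliate_carrier[of 1 dA "dB * dE" m \<Lambda> "F X"] by (simp add: mult.assoc del: ampliate_carrier)
  fix p p' q q' e e' c c'
  assume b: "p < m" "p' < m" "q < dB" "q' < dB" "e < e0" "e' < e0" "c < N" "c' < N"
  have E: "e * N + c < dE" "e' * N + c' < dE" using b lopc_reprD(1)[OF R] by (simp_all add: enc_less)
  \<comment> \<open>An empty index set encodes the vanishing entries for different transcripts, so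
    that both cases are one finite sum and \<open>cptp_sum\<close> applies to it.\<close>
  let ?S = "if c = c' then quad a0 b0 else {}"
  let ?f = "\<lambda>(a, a', b, b'). KB c q q' b b' * X $$ ((a * b0 + b) * e0 + e, (a' * b0 + b') * e0 + e')"
  have "ampliate 1 dA (dB * dE) m \<Lambda> (F X) $$
      ((0 * m + p) * (dB * dE) + (q * dE + (e * N + c)), (0 * m + p') * (dB * dE) + (q' * dE + (e' * N + c'))) =
     \<Lambda> (mat dA dA (\<lambda>(k, l). F X $$ ((0 * dA + k) * (dB * dE) + (q * dE + (e * N + c)),
        (0 * dA + l) * (dB * dE) + (q' * dE + (e' * N + c'))))) $$ (p, p')"
    by (rule ampliate_entry) (use b E in \<open>simp_all add: enc_less\<close>)
  also have "mat dA dA (\<lambda>(k, l). F X $$ ((0 * dA + k) * (dB * dE) + (q * dE + (e * N + c)),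
        (0 * dA + l) * (dB * dE) + (q' * dE + (e' * N + c')))) =
      mat dA dA (\<lambda>(k, l). \<Sum>z\<in>?S. ?f z * (case z of (a, a', b, b') \<Rightarrow> KA c k l a a'))"
  proof (rule eq_matI)
    fix k l assume "k < dim_row (mat dA dA (\<lambda>(k, l). \<Sum>z\<in>?S. ?f z * (case z of (a, a', b, b') \<Rightarrow> KA c k l a a')))"
      "l < dim_col (mat dA dA (\<lambda>(k, l). \<Sum>z\<in>?S. ?f z * (case z of (a, a', b, b') \<Rightarrow> KA c k l a a')))"
    then have kl: "k < dA" "l < dA" by simp_all
    have i: "(0 * dA + k) * (dB * dE) + (q * dE + r) = (k * dB + q) * dE + r" for k q r
      by (simp add: algebra_simps)
    show "mat dA dA (\<lambda>(k, l). F X $$ ((0 * dA + k) * (dB * dE) + (q * dE + (e * N + c)),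
        (0 * dA + l) * (dB * dE) + (q' * dE + (e' * N + c')))) $$ (k, l) =
      mat dA dA (\<lambda>(k, l). \<Sum>z\<in>?S. ?f z * (case z of (a, a', b, b') \<Rightarrow> KA c k l a a')) $$ (k, l)"
      unfolding i using kl lopc_reprD(6)[OF R X kl b(3-8)]
      by (simp add: case_prod_unfold mult_ac)
  qed simp_all
  also have "\<Lambda> \<dots> $$ (p, p') =
     (\<Sum>z\<in>?S. ?f z * \<Lambda> (mat dA dA (\<lambda>(k, l). case z of (a, a', b, b') \<Rightarrow> KA c k l a a')) $$ (p, p'))"
    by (rule cptp_sum[OF \<Lambda> _ b(1,2)]) simp
  finally show "ampliate 1 dA (dB * dE) m \<Lambda> (F X) $$
      ((p * dB + q) * dE + (e * N + c), (p' * dB + q') * dE + (e' * N + c')) =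
     (if c = c' then \<Sum>(a, a', b, b')\<in>quad a0 b0. \<Lambda> (mat dA dA (\<lambda>(x, y). KA c x y a a')) $$ (p, p') * KB c q q' b b' *
         X $$ ((a * b0 + b) * e0 + e, (a' * b0 + b') * e0 + e') else 0)"
    by (simp add: algebra_simps case_prod_unfold)
qed

lemma lopc_repr_local_B:
  assumes R: "lopc_repr a0 b0 e0 dA dB dE F N KA KB" and \<Lambda>: "cptp dB m \<Lambda>"
  shows "lopc_repr a0 b0 e0 dA m dE (\<lambda>X. ampliate dA dB dE m \<Lambda> (F X)) N KA
    (\<lambda>c p p' k k'. \<Lambda> (mat dB dB (\<lambda>(x, y). KB c x y k k')) $$ (p, p'))"
  unfolding lopc_repr_def
proof (intro conjI allI impI ballI)
  show "dE = e0 * N" by (rule lopc_reprD(1)[OF R])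
next
  fix c assume "c < N"
  then show "cp_kernel m b0 (\<lambda>p p' k k'. \<Lambda> (mat dB dB (\<lambda>(x, y). KB c x y k k')) $$ (p, p'))" "cp_kernel dA a0 (KA c)"
    using cp_kernel_cptp[OF lopc_reprD(3)[OF R] \<Lambda>] lopc_reprD(2)[OF R] by auto
next
  fix a a' b b' assume "a < a0" "a' < a0" "b < b0" "b' < b0"
  then show "(\<Sum>c<N. (\<Sum>p<dA. KA c p p a a') * (\<Sum>q<m. \<Lambda> (mat dB dB (\<lambda>(x, y). KB c x y b b')) $$ (q, q)))
      = (if a = a' \<and> b = b' then 1 else 0)"
    unfolding cptp_trace_entries[OF \<Lambda>] by (rule lopc_reprD(4)[OF R])
next
  fix X :: "complex mat" assume X: "X \<in> carrier_mat (a0 * b0 * e0) (a0 * b0 * e0)"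
  show "ampliate dA dB dE m \<Lambda> (F X) \<in> carrier_mat (dA * m * dE) (dA * m * dE)" by simp
  fix p p' q q' e e' c c'
  assume b: "p < dA" "p' < dA" "q < m" "q' < m" "e < e0" "e' < e0" "c < N" "c' < N"
  have E: "e * N + c < dE" "e' * N + c' < dE" using b lopc_reprD(1)[OF R] by (simp_all add: enc_less)
  let ?S = "if c = c' then quad a0 b0 else {}"
  let ?f = "\<lambda>(a, a', b, b'). KA c p p' a a' * X $$ ((a * b0 + b) * e0 + e, (a' * b0 + b') * e0 + e')"
  have "ampliate dA dB dE m \<Lambda> (F X) $$ ((p * m + q) * dE + (e * N + c), (p' * m + q') * dE + (e' * N + c')) =
     \<Lambda> (mat dB dB (\<lambda>(k, l). F X $$ ((p * dB + k) * dE + (e * N + c), (p' * dB + l) * dE + (e' * N + c')))) $$ (q, q')"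
    by (rule ampliate_entry) (use b E in simp_all)
  also have "mat dB dB (\<lambda>(k, l). F X $$ ((p * dB + k) * dE + (e * N + c), (p' * dB + l) * dE + (e' * N + c'))) =
      mat dB dB (\<lambda>(k, l). \<Sum>z\<in>?S. ?f z * (case z of (a, a', b, b') \<Rightarrow> KB c k l b b'))"
  proof (rule eq_matI)
    fix k l assume "k < dim_row (mat dB dB (\<lambda>(k, l). \<Sum>z\<in>?S. ?f z * (case z of (a, a', b, b') \<Rightarrow> KB c k l b b')))"
      "l < dim_col (mat dB dB (\<lambda>(k, l). \<Sum>z\<in>?S. ?f z * (case z of (a, a', b, b') \<Rightarrow> KB c k l b b')))"
    then have kl: "k < dB" "l < dB" by simp_all
    show "mat dB dB (\<lambda>(k, l). F X $$ ((p * dB + k) * dE + (e * N + c), (p' * dB + l) * dE + (e' * N + c'))) $$ (k, l) =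
      mat dB dB (\<lambda>(k, l). \<Sum>z\<in>?S. ?f z * (case z of (a, a', b, b') \<Rightarrow> KB c k l b b')) $$ (k, l)"
      using kl lopc_reprD(6)[OF R X b(1,2) kl b(5-8)]
      by (simp add: case_prod_unfold mult_ac)
  qed simp_all
  also have "\<Lambda> \<dots> $$ (q, q') =
     (\<Sum>z\<in>?S. ?f z * \<Lambda> (mat dB dB (\<lambda>(k, l). case z of (a, a', b, b') \<Rightarrow> KB c k l b b')) $$ (q, q'))"
    by (rule cptp_sum[OF \<Lambda> _ b(3,4)]) simp
  finally show "ampliate dA dB dE m \<Lambda> (F X) $$
      ((p * m + q) * dE + (e * N + c), (p' * m + q') * dE + (e' * N + c')) =
     (if c = c' then \<Sum>(a, a', b, b')\<in>quad a0 b0. KA c p p' a a' * \<Lambda> (mat dB dB (\<lambda>(x, y). KB c x y b b')) $$ (q, q') *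
         X $$ ((a * b0 + b) * e0 + e, (a' * b0 + b') * e0 + e') else 0)"
    by (simp add: case_prod_unfold mult_ac)
qed

section \<open>Matrix entries of the public communication maps\<close>

lemma kron_entry_rect:
  assumes "A \<in> carrier_mat m n" "B \<in> carrier_mat m' n'" "i < m" "k < n" "j < m'" "l < n'"
  shows "kron A B $$ (i * m' + j, k * n' + l) = A $$ (i, k) * B $$ (j, l)"
  using assms enc_less[OF assms(3,5)] enc_less[OF assms(4,6)] unfolding kron_def by auto

lemma kron_carrier_rect:
  "A \<in> carrier_mat m n \<Longrightarrow> B \<in> carrier_mat m' n' \<Longrightarrow> kron A B \<in> carrier_mat (m * m') (n * n')"
  unfolding kron_def by auto

lemma ket_carrier: "ket m i \<in> carrier_mat m 1"
  unfolding ket_def by simp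

lemma basis_proj_carrier: "basis_proj m i \<in> carrier_mat m m"
  unfolding basis_proj_def by (rule mult_carrier_mat[OF ket_carrier mat_adjoint_carrier[OF ket_carrier]])

lemma basis_proj_entry:
  assumes "k < m" "l < m"
  shows "basis_proj m i $$ (k, l) = (if k = i \<and> l = i then 1 else 0)"
proof -
  have "basis_proj m i $$ (k, l) = (\<Sum>x<1. ket m i $$ (k, x) * mat_adjoint (ket m i) $$ (x, l))"
    unfolding basis_proj_def
    by (rule mat_mult_entry[OF ket_carrier mat_adjoint_carrier[OF ket_carrier] assms])
  then show ?thesis using assms ket_carrier[of m i] by (simp add: ket_def)
qed

lemma kron_one_ket_entry:
  assumes "x < d" "j < m" "y < d"
  shows "kron (1\<^sub>m d) (ket m i) $$ (x * m + j, y) = (if x = y \<and> j = i then 1 else 0)"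
  using kron_entry_rect[OF one_carrier_mat ket_carrier assms(1,3,2), of 0 i] assms by (simp add: ket_def)

lemma kron_one_proj_entry:
  assumes "x < d" "j < m" "y < d" "k < m"
  shows "kron (1\<^sub>m d) (basis_proj m i) $$ (x * m + j, y * m + k) = (if x = y \<and> j = i \<and> k = i then 1 else 0)"
  using kron_entry_rect[OF one_carrier_mat basis_proj_carrier assms(1,3,2,4), of i] assms
  by (simp add: basis_proj_entry)

lemma kron_one_proj_entry':
  assumes "p < d * m" "p' < d * m"
  shows "kron (1\<^sub>m d) (basis_proj m i) $$ (p, p') = (if p = p' \<and> p mod m = i then 1 else 0)"
proof -
  obtain x j where 1: "p = x * m + j" "x < d" "j < m" using assms(1) by (rule enc_dec)
  obtain y k where 2: "p' = y * m + k" "y < d" "k < m" using assms(2) by (rule enc_dec)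
  show ?thesis unfolding 1(1) 2(1) kron_one_proj_entry[OF 1(2,3) 2(2,3)] using 1 2 by (auto simp: enc_eq_iff)
qed

text \<open>The rows of V in question have at most one nonzero entry, a 1 whose presence is decided
  by \<phi> and \<phi>', so the sandwich merely selects one entry of Y.\<close>

lemma selection_sandwich:
  fixes V Y :: "complex mat"
  assumes V: "V \<in> carrier_mat D d" and Y: "Y \<in> carrier_mat d d" and IJ: "I < D" "J < D" "\<kappa> < d" "\<kappa>' < d"
    and I: "\<And>K. K < d \<Longrightarrow> V $$ (I, K) = (if K = \<kappa> \<and> \<phi> then 1 else 0)"
    and J: "\<And>K. K < d \<Longrightarrow> V $$ (J, K) = (if K = \<kappa>' \<and> \<phi>' then 1 else 0)"
  shows "(V * Y * mat_adjoint V) $$ (I, J) = (if \<phi> \<and> \<phi>' then Y $$ (\<kappa>, \<kappa>') else 0)"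
proof -
  have VY: "(V * Y) $$ (I, L) = (if \<phi> then Y $$ (\<kappa>, L) else 0)" if "L < d" for L
  proof -
    have "(V * Y) $$ (I, L) = (\<Sum>K<d. if K = \<kappa> then if \<phi> then Y $$ (K, L) else 0 else 0)"
      unfolding mat_mult_entry[OF V Y IJ(1) that] by (intro sum.cong refl) (simp add: I)
    then show ?thesis using IJ(3) by simp
  qed
  have "(V * Y * mat_adjoint V) $$ (I, J) = (\<Sum>L<d. (V * Y) $$ (I, L) * mat_adjoint V $$ (L, J))"
    by (rule mat_mult_entry[OF mult_carrier_mat[OF V Y] mat_adjoint_carrier[OF V] IJ(1,2)])
  also have "\<dots> = (\<Sum>L<d. if L = \<kappa>' then if \<phi> \<and> \<phi>' then Y $$ (\<kappa>, L) else 0 else 0)"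
  proof (intro sum.cong refl)
    fix L assume "L \<in> {..<d}"
    then have L: "L < d" by simp
    have "mat_adjoint V $$ (L, J) = cnj (V $$ (J, L))"
      by (rule mat_adjoint_entry) (use V L IJ in auto)
    then show "(V * Y) $$ (I, L) * mat_adjoint V $$ (L, J) =
        (if L = \<kappa>' then if \<phi> \<and> \<phi>' then Y $$ (\<kappa>, L) else 0 else 0)"
      using L by (simp add: VY J del: index_mult_mat(1))
  qed
  finally show ?thesis using IJ(4) by simp
qed

lemma mat_sum_entry: "i < r \<Longrightarrow> j < c \<Longrightarrow> mat_sum r c F m $$ (i, j) = (\<Sum>k<m. F k $$ (i, j))"
  by (simp add: mat_sum_def)

lemma enc3_less: "p < a \<Longrightarrow> q < b \<Longrightarrow> e < c \<Longrightarrow> (p * b + q) * c + e < a * b * (c :: nat)"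
  by (simp add: enc_less)

lemma public_AB_entry:
  assumes Y: "Y \<in> carrier_mat (dA * m * dB * dE) (dA * m * dB * dE)"
    and b: "p < dA * m" "p' < dA * m" "q < dB" "q' < dB" "j < m" "j' < m" "e < dE" "e' < dE" "k < m" "k' < m"
  shows "public_AB dA m dB dE Y $$ ((p * (dB * m) + (q * m + j)) * (dE * m) + (e * m + k),
      (p' * (dB * m) + (q' * m + j')) * (dE * m) + (e' * m + k')) =
    (if p mod m = k \<and> j = k \<and> p' mod m = k \<and> j' = k \<and> k' = k
     then Y $$ ((p * dB + q) * dE + e, (p' * dB + q') * dE + e') else 0)"
proof -
  let ?D = "dA * m * (dB * m) * (dE * m)"
  define V where "V i = kron (kron (kron (1\<^sub>m dA) (basis_proj m i)) (kron (1\<^sub>m dB) (ket m i)))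
                     (kron (1\<^sub>m dE) (ket m i))" for i
  have c1: "kron (1\<^sub>m dA) (basis_proj m i) \<in> carrier_mat (dA * m) (dA * m)" for i
    by (rule kron_carrier_rect[OF one_carrier_mat basis_proj_carrier])
  have c2: "kron (1\<^sub>m d) (ket m i) \<in> carrier_mat (d * m) d" for d i
    using kron_carrier_rect[OF one_carrier_mat ket_carrier, of d m i] by simp
  note c12 = kron_carrier_rect[OF c1 c2]
  have V: "V i \<in> carrier_mat ?D (dA * m * dB * dE)" for i
    unfolding V_def by (rule kron_carrier_rect[OF c12 c2])
  have row: "V i $$ ((p * (dB * m) + (q * m + j)) * (dE * m) + (e * m + k), K) =
      (if K = (p * dB + q) * dE + e \<and> (p mod m = i \<and> j = i \<and> k = i) then 1 else 0)"
    if bd: "p < dA * m" "q < dB" "j < m" "e < dE" "k < m" "K < dA * m * dB * dE" for i p q j e k K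
  proof -
    obtain K1 e2 where K1: "K = K1 * dE + e2" "K1 < dA * m * dB" "e2 < dE" using bd(6) by (rule enc_dec)
    obtain p2 q2 where K2: "K1 = p2 * dB + q2" "p2 < dA * m" "q2 < dB" using K1(2) by (rule enc_dec)
    have "V i $$ ((p * (dB * m) + (q * m + j)) * (dE * m) + (e * m + k), (p2 * dB + q2) * dE + e2) =
        kron (1\<^sub>m dA) (basis_proj m i) $$ (p, p2) * kron (1\<^sub>m dB) (ket m i) $$ (q * m + j, q2) *
        kron (1\<^sub>m dE) (ket m i) $$ (e * m + k, e2)"
      unfolding V_def
      by (subst kron_entry_rect[OF c12 c2], (use bd K1 K2 in \<open>simp_all add: enc_less\<close>)[4],
          subst kron_entry_rect[OF c1 c2]) (use bd K1 K2 in \<open>simp_all add: enc_less\<close>)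
    then show ?thesis
      unfolding K1(1) K2(1) using bd K1 K2
      by (auto simp: kron_one_proj_entry' kron_one_ket_entry enc_eq_iff)
  qed
  have less: "(p * (dB * m) + (q * m + j)) * (dE * m) + (e * m + k) < ?D"
    if "p < dA * m" "q < dB" "j < m" "e < dE" "k < m" for p q j e k
    using that by (simp only: enc_less)
  have less': "(p * dB + q) * dE + e < dA * m * dB * dE" if "p < dA * m" "q < dB" "e < dE" for p q e
    using that by (simp only: enc_less)
  have "public_AB dA m dB dE Y $$ ((p * (dB * m) + (q * m + j)) * (dE * m) + (e * m + k),
      (p' * (dB * m) + (q' * m + j')) * (dE * m) + (e' * m + k')) =
    (\<Sum>i<m. if (p mod m = i \<and> j = i \<and> k = i) \<and> (p' mod m = i \<and> j' = i \<and> k' = i)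
       then Y $$ ((p * dB + q) * dE + e, (p' * dB + q') * dE + e') else 0)"
    unfolding public_AB_def Let_def V_def[symmetric]
      mat_sum_entry[OF less(1)[OF b(1,3,5,7,9)] less(1)[OF b(2,4,6,8,10)]]
    by (intro sum.cong refl selection_sandwich[OF V Y] less less' row b)
  also have "\<dots> = (\<Sum>i<m. if k = i then if p mod m = k \<and> j = k \<and> p' mod m = k \<and> j' = k \<and> k' = k
       then Y $$ ((p * dB + q) * dE + e, (p' * dB + q') * dE + e') else 0 else 0)"
    by (intro sum.cong refl) auto
  finally show ?thesis using b by simp
qed

lemma public_BA_entry:
  assumes Y: "Y \<in> carrier_mat (dA * (dB * m) * dE) (dA * (dB * m) * dE)"
    and b: "p < dA" "p' < dA" "q < dB * m" "q' < dB * m" "j < m" "j' < m" "e < dE" "e' < dE" "k < m" "k' < m"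
  shows "public_BA dA dB m dE Y $$ (((p * m + j) * (dB * m) + q) * (dE * m) + (e * m + k),
      ((p' * m + j') * (dB * m) + q') * (dE * m) + (e' * m + k')) =
    (if q mod m = k \<and> j = k \<and> q' mod m = k \<and> j' = k \<and> k' = k
     then Y $$ ((p * (dB * m) + q) * dE + e, (p' * (dB * m) + q') * dE + e') else 0)"
proof -
  let ?D = "dA * m * (dB * m) * (dE * m)"
  define V where "V i = kron (kron (kron (1\<^sub>m dA) (ket m i)) (kron (1\<^sub>m dB) (basis_proj m i)))
                     (kron (1\<^sub>m dE) (ket m i))" for i
  have c1: "kron (1\<^sub>m dB) (basis_proj m i) \<in> carrier_mat (dB * m) (dB * m)" for i
    by (rule kron_carrier_rect[OF one_carrier_mat basis_proj_carrier])
  have c2: "kron (1\<^sub>m d) (ket m i) \<in> carrier_mat (d * m) d" for d i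
    using kron_carrier_rect[OF one_carrier_mat ket_carrier, of d m i] by simp
  note c12 = kron_carrier_rect[OF c2 c1]
  have V: "V i \<in> carrier_mat ?D (dA * (dB * m) * dE)" for i
    unfolding V_def by (rule kron_carrier_rect[OF c12 c2])
  have row: "V i $$ (((p * m + j) * (dB * m) + q) * (dE * m) + (e * m + k), K) =
      (if K = (p * (dB * m) + q) * dE + e \<and> (q mod m = i \<and> j = i \<and> k = i) then 1 else 0)"
    if bd: "p < dA" "q < dB * m" "j < m" "e < dE" "k < m" "K < dA * (dB * m) * dE" for i p q j e k K
  proof -
    obtain K1 e2 where K1: "K = K1 * dE + e2" "K1 < dA * (dB * m)" "e2 < dE" using bd(6) by (rule enc_dec)
    obtain p2 q2 where K2: "K1 = p2 * (dB * m) + q2" "p2 < dA" "q2 < dB * m" using K1(2) by (rule enc_dec)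
    have "V i $$ (((p * m + j) * (dB * m) + q) * (dE * m) + (e * m + k), (p2 * (dB * m) + q2) * dE + e2) =
        kron (1\<^sub>m dA) (ket m i) $$ (p * m + j, p2) * kron (1\<^sub>m dB) (basis_proj m i) $$ (q, q2) *
        kron (1\<^sub>m dE) (ket m i) $$ (e * m + k, e2)"
      unfolding V_def
      by (subst kron_entry_rect[OF c12 c2], (use bd K1 K2 in \<open>simp_all add: enc_less\<close>)[4],
          subst kron_entry_rect[OF c2 c1]) (use bd K1 K2 in \<open>simp_all add: enc_less\<close>)
    then show ?thesis
      unfolding K1(1) K2(1) using bd K1 K2
      by (auto simp: kron_one_proj_entry' kron_one_ket_entry enc_eq_iff)
  qed
  have less: "((p * m + j) * (dB * m) + q) * (dE * m) + (e * m + k) < ?D"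
    if "p < dA" "q < dB * m" "j < m" "e < dE" "k < m" for p q j e k
    using that by (simp only: enc_less)
  have less': "(p * (dB * m) + q) * dE + e < dA * (dB * m) * dE" if "p < dA" "q < dB * m" "e < dE" for p q e
    using that by (simp only: enc_less)
  have "public_BA dA dB m dE Y $$ (((p * m + j) * (dB * m) + q) * (dE * m) + (e * m + k),
      ((p' * m + j') * (dB * m) + q') * (dE * m) + (e' * m + k')) =
    (\<Sum>i<m. if (q mod m = i \<and> j = i \<and> k = i) \<and> (q' mod m = i \<and> j' = i \<and> k' = i)
       then Y $$ ((p * (dB * m) + q) * dE + e, (p' * (dB * m) + q') * dE + e') else 0)"
    unfolding public_BA_def Let_def V_def[symmetric]
      mat_sum_entry[OF less(1)[OF b(1,3,5,7,9)] less(1)[OF b(2,4,6,8,10)]]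
    by (intro sum.cong refl selection_sandwich[OF V Y] less less' row b)
  also have "\<dots> = (\<Sum>i<m. if k = i then if q mod m = k \<and> j = k \<and> q' mod m = k \<and> j' = k \<and> k' = k
       then Y $$ ((p * (dB * m) + q) * dE + e, (p' * (dB * m) + q') * dE + e') else 0 else 0)"
    by (intro sum.cong refl) auto
  finally show ?thesis using b by simp
qed

text \<open>A transcript \<open>c\<close> consists of the earlier transcript \<open>c div m\<close>
  and the new message \<open>c mod m\<close>. The sender's register, which is the last digit of its
  index, must carry the message and stays in place. For \<open>received\<close>, the message is a
  new last digit that has to be stripped to reach the old index.\<close>

abbreviation announced :: "nat \<Rightarrow> (nat \<Rightarrow> nat \<Rightarrow> nat \<Rightarrow> nat \<Rightarrow> nat \<Rightarrow> complex) \<Rightarrow> nat \<Rightarrow> nat \<Rightarrow> nat \<Rightarrow> nat \<Rightarrow> nat \<Rightarrow> complex" where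
  "announced m K c p p' \<equiv> \<lambda>k k'.
     if p mod m = c mod m \<and> p' mod m = c mod m then K (c div m) p p' k k' else 0"

abbreviation received :: "nat \<Rightarrow> (nat \<Rightarrow> nat \<Rightarrow> nat \<Rightarrow> nat \<Rightarrow> nat \<Rightarrow> complex) \<Rightarrow> nat \<Rightarrow> nat \<Rightarrow> nat \<Rightarrow> nat \<Rightarrow> nat \<Rightarrow> complex" where
  "received m K c p p' \<equiv> \<lambda>k k'.
     if p mod m = c mod m \<and> p' mod m = c mod m then K (c div m) (p div m) (p' div m) k k' else 0"

lemma trace_announced:
  assumes "j < m"
  shows "(\<Sum>p<d. announced m K (c * m + j) p p k k') = (\<Sum>p<d. if j = p mod m then K c p p k k' else 0)"
  using assms by (intro sum.cong refl) auto

lemma trace_received: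
  assumes "j < m"
  shows "(\<Sum>p<d * m. received m K (c * m + j) p p k k') = (\<Sum>p<d. K c p p k k')"
  unfolding sum_enc using assms by (intro sum.cong refl) simp

text \<open>Summing over the messages recovers the sender's full trace: an announcement only splits
  the trace of a transcript among its continuations.\<close>

lemma sum_announced:
  "(\<Sum>j<(m :: nat). \<Sum>p<d * m. if j = p mod m then f p else 0) = (\<Sum>p<d * m. f p :: complex)"
proof (cases "m = 0")
  case False
  then show ?thesis by (subst sum.swap) simp
qed simp

text \<open>Eve appends the message \<open>k\<close> to her earlier record \<open>c\<close>, so her
  index can be bracketed either way.\<close>

lemma transcript_enc: "(e * N + c) * m + k = e * (N * m) + (c * m + k :: nat)"
  by (simp add: algebra_simps)

lemma lopc_repr_public_A:
  assumes R: "lopc_repr a0 b0 e0 (dA * m) dB dE F N KA KB"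
  shows "lopc_repr a0 b0 e0 (dA * m) (dB * m) (dE * m) (\<lambda>X. public_AB dA m dB dE (F X)) (N * m)
    (announced m KA) (received m KB)"
  unfolding lopc_repr_def
proof (intro conjI allI impI ballI)
  show "dE * m = e0 * (N * m)" using lopc_reprD(1)[OF R] by simp
next
  fix c assume c: "c < N * m"
  show "cp_kernel (dA * m) a0 (announced m KA c)"
    by (rule cp_kernel_restrict[OF lopc_reprD(2)[OF R enc_bounds(1)[OF c]]])
  show "cp_kernel (dB * m) b0 (received m KB c)"
    by (rule cp_kernel_restrict[OF lopc_reprD(3)[OF R enc_bounds(1)[OF c]]]) (rule enc_bounds)
next
  fix a a' b b' assume ab: "a < a0" "a' < a0" "b < b0" "b' < b0"
  have "(\<Sum>c<N * m. (\<Sum>p<dA * m. announced m KA c p p a a') * (\<Sum>q<dB * m. received m KB c q q b b')) =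
     (\<Sum>c<N. \<Sum>j<m. (\<Sum>p<dA * m. if j = p mod m then KA c p p a a' else 0) * (\<Sum>q<dB. KB c q q b b'))"
    unfolding sum_enc[where b = m and a = N] by (intro sum.cong refl) (simp only: trace_announced trace_received lessThan_iff)
  also have "\<dots> = (\<Sum>c<N. (\<Sum>p<dA * m. KA c p p a a') * (\<Sum>q<dB. KB c q q b b'))"
    unfolding sum_distrib_right[symmetric] sum_announced ..
  finally show "(\<Sum>c<N * m. (\<Sum>p<dA * m. announced m KA c p p a a') * (\<Sum>q<dB * m. received m KB c q q b b')) =
      (if a = a' \<and> b = b' then 1 else 0)" using lopc_reprD(4)[OF R ab] by simp
next
  fix X :: "complex mat" assume X: "X \<in> carrier_mat (a0 * b0 * e0) (a0 * b0 * e0)"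
  show "public_AB dA m dB dE (F X) \<in> carrier_mat (dA * m * (dB * m) * (dE * m)) (dA * m * (dB * m) * (dE * m))"
    unfolding public_AB_def Let_def mat_sum_def by simp
  fix p p' Q Q' e e' C C'
  assume b: "p < dA * m" "p' < dA * m" "Q < dB * m" "Q' < dB * m" "e < e0" "e' < e0" "C < N * m" "C' < N * m"
  obtain q j where q: "Q = q * m + j" "q < dB" "j < m" using b(3) by (rule enc_dec)
  obtain q' j' where q': "Q' = q' * m + j'" "q' < dB" "j' < m" using b(4) by (rule enc_dec)
  obtain c k where c: "C = c * m + k" "c < N" "k < m" using b(7) by (rule enc_dec)
  obtain c' k' where c': "C' = c' * m + k'" "c' < N" "k' < m" using b(8) by (rule enc_dec)
  have E: "e * N + c < dE" "e' * N + c' < dE" using b c c' lopc_reprD(1)[OF R] by (simp_all add: enc_less)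
  show "public_AB dA m dB dE (F X) $$ ((p * (dB * m) + Q) * (dE * m) + (e * (N * m) + C), (p' * (dB * m) + Q') * (dE * m) + (e' * (N * m) + C')) =
     (if C = C' then \<Sum>(a, a', b, b')\<in>quad a0 b0. announced m KA C p p' a a' * received m KB C Q Q' b b' *
         X $$ ((a * b0 + b) * e0 + e, (a' * b0 + b') * e0 + e') else 0)"
    unfolding q(1) q'(1) c(1) c'(1) transcript_enc[of e N c m k, symmetric] transcript_enc[of e' N c' m k', symmetric]
      public_AB_entry[OF lopc_reprD(5)[OF R X] b(1,2) q(2) q'(2) q(3) q'(3) E c(3) c'(3)]
      lopc_reprD(6)[OF R X b(1,2) q(2) q'(2) b(5,6) c(2) c'(2)]
    using q q' c c' by (auto simp: enc_eq_iff split_def intro!: sum.cong)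
qed

lemma lopc_repr_public_B:
  assumes R: "lopc_repr a0 b0 e0 dA (dB * m) dE F N KA KB"
  shows "lopc_repr a0 b0 e0 (dA * m) (dB * m) (dE * m) (\<lambda>X. public_BA dA dB m dE (F X)) (N * m)
    (received m KA) (announced m KB)"
  unfolding lopc_repr_def
proof (intro conjI allI impI ballI)
  show "dE * m = e0 * (N * m)" using lopc_reprD(1)[OF R] by simp
next
  fix c assume c: "c < N * m"
  show "cp_kernel (dB * m) b0 (announced m KB c)"
    by (rule cp_kernel_restrict[OF lopc_reprD(3)[OF R enc_bounds(1)[OF c]]])
  show "cp_kernel (dA * m) a0 (received m KA c)"
    by (rule cp_kernel_restrict[OF lopc_reprD(2)[OF R enc_bounds(1)[OF c]]]) (rule enc_bounds)
next
  fix a a' b b' assume ab: "a < a0" "a' < a0" "b < b0" "b' < b0"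
  have "(\<Sum>c<N * m. (\<Sum>p<dA * m. received m KA c p p a a') * (\<Sum>q<dB * m. announced m KB c q q b b')) =
     (\<Sum>c<N. \<Sum>j<m. (\<Sum>p<dA. KA c p p a a') * (\<Sum>q<dB * m. if j = q mod m then KB c q q b b' else 0))"
    unfolding sum_enc[where b = m and a = N] by (intro sum.cong refl) (simp only: trace_announced trace_received lessThan_iff)
  also have "\<dots> = (\<Sum>c<N. (\<Sum>p<dA. KA c p p a a') * (\<Sum>q<dB * m. KB c q q b b'))"
    unfolding sum_distrib_left[symmetric] sum_announced ..
  finally show "(\<Sum>c<N * m. (\<Sum>p<dA * m. received m KA c p p a a') * (\<Sum>q<dB * m. announced m KB c q q b b')) =
      (if a = a' \<and> b = b' then 1 else 0)" using lopc_reprD(4)[OF R ab] by simp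
next
  fix X :: "complex mat" assume X: "X \<in> carrier_mat (a0 * b0 * e0) (a0 * b0 * e0)"
  show "public_BA dA dB m dE (F X) \<in> carrier_mat (dA * m * (dB * m) * (dE * m)) (dA * m * (dB * m) * (dE * m))"
    unfolding public_BA_def Let_def mat_sum_def by simp
  fix P P' q q' e e' C C'
  assume b: "P < dA * m" "P' < dA * m" "q < dB * m" "q' < dB * m" "e < e0" "e' < e0" "C < N * m" "C' < N * m"
  obtain p j where p: "P = p * m + j" "p < dA" "j < m" using b(1) by (rule enc_dec)
  obtain p' j' where p': "P' = p' * m + j'" "p' < dA" "j' < m" using b(2) by (rule enc_dec)
  obtain c k where c: "C = c * m + k" "c < N" "k < m" using b(7) by (rule enc_dec)
  obtain c' k' where c': "C' = c' * m + k'" "c' < N" "k' < m" using b(8) by (rule enc_dec)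
  have E: "e * N + c < dE" "e' * N + c' < dE" using b c c' lopc_reprD(1)[OF R] by (simp_all add: enc_less)
  show "public_BA dA dB m dE (F X) $$ ((P * (dB * m) + q) * (dE * m) + (e * (N * m) + C), (P' * (dB * m) + q') * (dE * m) + (e' * (N * m) + C')) =
     (if C = C' then \<Sum>(a, a', b, b')\<in>quad a0 b0. received m KA C P P' a a' * announced m KB C q q' b b' *
         X $$ ((a * b0 + b) * e0 + e, (a' * b0 + b') * e0 + e') else 0)"
    unfolding p(1) p'(1) c(1) c'(1) transcript_enc[of e N c m k, symmetric] transcript_enc[of e' N c' m k', symmetric]
      public_BA_entry[OF lopc_reprD(5)[OF R X] p(2) p'(2) b(3,4) p(3) p'(3) E c(3) c'(3)]
      lopc_reprD(6)[OF R X p(2) p'(2) b(3,4) b(5,6) c(2) c'(2)]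
    using p p' c c' by (auto simp: enc_eq_iff split_def intro!: sum.cong)
qed

lemma lopc_has_repr:
  assumes "lopc ds ds' F"
  shows "\<exists>N KA KB. lopc_repr (fst ds) (fst (snd ds)) (snd (snd ds)) (fst ds') (fst (snd ds')) (snd (snd ds')) F N KA KB"
  using assms
proof (induction rule: lopc.induct)
  case none
  show ?case using lopc_repr_none by blast
next
  case (local_A dA dB dE F m \<Lambda>)
  then show ?case using lopc_repr_local_A by fastforce
next
  case (local_B dA dB dE F m \<Lambda>)
  then show ?case using lopc_repr_local_B by fastforce
next
  case (public_A dA m dB dE F)
  then show ?case using lopc_repr_public_A by fastforce
next
  case (public_B dA dB m dE F)
  then show ?case using lopc_repr_public_B by fastforce
qed

section \<open>Square roots\<close>

lemma decomp_mult:
  assumes u: "onb n u"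
  shows "(\<Sum>j<n. (\<Sum>k<n. a k * u k i * cnj (u k j)) * (\<Sum>l<n. b l * u l j * cnj (u l m))) =
    (\<Sum>l<n. a l * b l * u l i * cnj (u l m))"
proof -
  have "(\<Sum>j<n. (\<Sum>k<n. a k * u k i * cnj (u k j)) * (\<Sum>l<n. b l * u l j * cnj (u l m))) =
      (\<Sum>j<n. (\<Sum>k<n. a k * u k i * cnj (u k j)) * (\<Sum>l<n. u l j * (b l * cnj (u l m))))"
    by (simp only: mult_ac)
  also have "\<dots> = (\<Sum>l<n. (\<Sum>j<n. (\<Sum>k<n. a k * u k i * cnj (u k j)) * u l j) * (b l * cnj (u l m)))"
    by (rule sum_assoc[symmetric])
  also have "\<dots> = (\<Sum>l<n. (a l * u l i) * (b l * cnj (u l m)))"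
    by (intro sum.cong refl arg_cong2[where f = "(*)"] decomp_apply[OF u]) simp
  finally show ?thesis by (simp only: mult_ac)
qed

definition eigen_mat :: "nat \<Rightarrow> (nat \<Rightarrow> nat \<Rightarrow> complex) \<Rightarrow> (nat \<Rightarrow> real) \<Rightarrow> complex mat" where
  "eigen_mat n u e = mat n n (\<lambda>(i, j). \<Sum>k<n. complex_of_real (e k) * u k i * cnj (u k j))"

lemma eigen_mat_decomp: "onb n u \<Longrightarrow> eigen_decomp n (eigen_mat n u e) u e"
  unfolding eigen_decomp_def eigen_mat_def by simp

lemma eigen_decomp_mult:
  assumes A: "eigen_decomp n A u a" and B: "eigen_decomp n B u b" and ij: "i < n" "j < n"
  shows "(\<Sum>l<n. A $$ (i, l) * B $$ (l, j)) = (\<Sum>k<n. complex_of_real (a k * b k) * u k i * cnj (u k j))"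
proof -
  have "(\<Sum>l<n. A $$ (i, l) * B $$ (l, j)) = (\<Sum>l<n. (\<Sum>k<n. complex_of_real (a k) * u k i * cnj (u k l)) *
      (\<Sum>k<n. complex_of_real (b k) * u k l * cnj (u k j)))"
    by (intro sum.cong refl) (use eigen_decompD(3)[OF A] eigen_decompD(3)[OF B] ij in simp)
  then show ?thesis unfolding decomp_mult[OF eigen_decompD(2)[OF A]] by simp
qed

lemma psd_sqrt:
  assumes "psd A" "A \<in> carrier_mat n n"
  obtains R where "R \<in> carrier_mat n n" "psd R"
    "\<And>i j. i < n \<Longrightarrow> j < n \<Longrightarrow> (\<Sum>l<n. R $$ (i, l) * R $$ (l, j)) = A $$ (i, j)"
proof -
  obtain u e where ue: "eigen_decomp n A u e" "\<And>k. k < n \<Longrightarrow> 0 \<le> e k"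
    using psd_eigen_decomp[OF assms] by blast
  let ?R = "eigen_mat n u (\<lambda>k. sqrt (e k))"
  have R: "eigen_decomp n ?R u (\<lambda>k. sqrt (e k))"
    by (rule eigen_mat_decomp[OF eigen_decompD(2)[OF ue(1)]])
  show ?thesis
  proof (rule that)
    show "?R \<in> carrier_mat n n" by (rule eigen_decompD(1)[OF R])
    show "psd ?R" by (rule psd_of_eigen_decomp[OF R]) (simp add: ue(2))
    fix i j assume ij: "i < n" "j < n"
    show "(\<Sum>l<n. ?R $$ (i, l) * ?R $$ (l, j)) = A $$ (i, j)"
      unfolding eigen_decomp_mult[OF R R ij] eigen_decompD(3)[OF ue(1) ij]
      by (intro sum.cong refl) (simp add: ue(2))
  qed
qed

text \<open>
  This is the polar decomposition of \<open>\<chi>\<close>. When \<open>\<chi>\<close> is the state that remains after Alice and Bob have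
  obtained the same key value, \<open>Z\<close> is the untwisting operation.
\<close>

lemma polar_contraction:
  fixes \<chi> :: "'k \<Rightarrow> nat \<Rightarrow> complex"
  assumes K: "finite K"
  shows "\<exists>S Z. S \<in> carrier_mat n n \<and> psd S \<and>
    (\<forall>e<n. \<forall>f<n. (\<Sum>k\<in>K. \<chi> k e * Z k f) = S $$ (e, f)) \<and>
    (\<forall>e<n. \<forall>f<n. (\<Sum>l<n. S $$ (e, l) * S $$ (l, f)) = (\<Sum>k\<in>K. \<chi> k e * cnj (\<chi> k f))) \<and>
    (\<forall>y. sqnorm {..<n} (\<lambda>f. \<Sum>k\<in>K. Z k f * y k) \<le> sqnorm K y)"
proof -
  define A where "A = mat n n (\<lambda>(e, f). \<Sum>k\<in>K. \<chi> k e * cnj (\<chi> k f))"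
  have A: "A \<in> carrier_mat n n" by (simp add: A_def)
  have Ae: "A $$ (e, f) = (\<Sum>k\<in>K. \<chi> k e * cnj (\<chi> k f))" if "e < n" "f < n" for e f
    using that by (simp add: A_def)
  have psdA: "psd A" by (rule psd_of_gram[OF A Ae])
  obtain u d where ud: "eigen_decomp n A u d" and d: "\<And>k. k < n \<Longrightarrow> 0 \<le> d k"
    using psd_eigen_decomp[OF psdA A] by blast
  have u: "onb n u" by (rule eigen_decompD(2)[OF ud])
  \<comment> \<open>The inverse square root on the support. The value 0 elsewhere gives d g(d) =
    sqrt d and d g(d)^2 <= 1 for all eigenvalues d >= 0.\<close>
  define g where "g x = (if x > 0 then 1 / sqrt x else 0)" for x :: real
  let ?S = "eigen_mat n u (\<lambda>k. sqrt (d k))" and ?G = "eigen_mat n u (\<lambda>k. g (d k))"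
  have S: "eigen_decomp n ?S u (\<lambda>k. sqrt (d k))" and G: "eigen_decomp n ?G u (\<lambda>k. g (d k))"
    by (rule eigen_mat_decomp[OF u])+
  \<comment> \<open>Z is \<chi>^dagger times the inverse square root of A = \<chi> \<chi>^dagger,
    hence \<chi> Z is the square root of A.\<close>
  define Z where "Z k f = (\<Sum>e<n. cnj (\<chi> k e) * ?G $$ (e, f))" for k f
  have 1: "(\<Sum>k\<in>K. \<chi> k e * Z k f) = ?S $$ (e, f)" if ef: "e < n" "f < n" for e f
  proof -
    have "(\<Sum>k\<in>K. \<chi> k e * Z k f) = (\<Sum>l<n. A $$ (e, l) * ?G $$ (l, f))"
    proof -
      have "(\<Sum>k\<in>K. \<chi> k e * Z k f) = (\<Sum>k\<in>K. \<Sum>l<n. (\<chi> k e * cnj (\<chi> k l)) * ?G $$ (l, f))"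
        unfolding Z_def sum_distrib_left by (simp only: mult.assoc)
      also have "\<dots> = (\<Sum>l<n. (\<Sum>k\<in>K. \<chi> k e * cnj (\<chi> k l)) * ?G $$ (l, f))"
        unfolding sum_distrib_right by (rule sum.swap)
      finally show ?thesis using ef by (simp add: Ae)
    qed
    also have "\<dots> = (\<Sum>k<n. complex_of_real (d k * g (d k)) * u k e * cnj (u k f))"
      by (rule eigen_decomp_mult[OF ud G ef])
    also have "\<dots> = (\<Sum>k<n. complex_of_real (sqrt (d k)) * u k e * cnj (u k f))"
    proof (intro sum.cong refl)
      fix k assume "k \<in> {..<n}"
      then have "d k * g (d k) = sqrt (d k)"
        using d[of k] by (auto simp: g_def real_div_sqrt order_le_less)
      then show "complex_of_real (d k * g (d k)) * u k e * cnj (u k f) =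
        complex_of_real (sqrt (d k)) * u k e * cnj (u k f)" by simp
    qed
    also have "\<dots> = ?S $$ (e, f)" by (rule eigen_decompD(3)[OF S ef, symmetric])
    finally show ?thesis .
  qed
  have 2: "(\<Sum>l<n. ?S $$ (e, l) * ?S $$ (l, f)) = (\<Sum>k\<in>K. \<chi> k e * cnj (\<chi> k f))" if ef: "e < n" "f < n" for e f
    unfolding Ae[OF ef, symmetric] eigen_decomp_mult[OF S S ef] eigen_decompD(3)[OF ud ef]
    by (intro sum.cong refl) (simp add: d)
  \<comment> \<open>Contractivity is shown for the adjoint of Z: in the eigenbasis, its squared norm
    carries the weights d g(d)^2, each of them 0 or 1. Then \<open>adjoint_contraction\<close>
    returns to Z.\<close>
  have contr: "sqnorm K (\<lambda>k. \<Sum>f<n. cnj (Z k f) * v f) \<le> sqnorm {..<n} v" for v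
  proof -
    define y where "y e = (\<Sum>f<n. cnj (?G $$ (e, f)) * v f)" for e
    have y: "(\<Sum>f<n. cnj (Z k f) * v f) = (\<Sum>e<n. \<chi> k e * y e)" for k
      unfolding Z_def y_def by (simp add: sum_assoc)
    have uy: "(\<Sum>e<n. u k e * y e) = complex_of_real (g (d k)) * (\<Sum>f<n. u k f * v f)" if k: "k < n" for k
    proof -
      have "(\<Sum>e<n. u k e * y e) = (\<Sum>f<n. (\<Sum>e<n. u k e * cnj (?G $$ (e, f))) * v f)"
        unfolding y_def by (rule sum_assoc[symmetric])
      also have "\<dots> = (\<Sum>f<n. (complex_of_real (g (d k)) * u k f) * v f)"
      proof (intro sum.cong refl arg_cong2[where f = "(*)"])
        fix f assume "f \<in> {..<n}"
        then have f: "f < n" by simp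
        have "(\<Sum>e<n. u k e * cnj (?G $$ (e, f))) = (\<Sum>e<n. ?G $$ (f, e) * u k e)"
          by (intro sum.cong refl) (use eigen_decomp_hermitian[OF G f] in \<open>simp add: mult.commute\<close>)
        then show "(\<Sum>e<n. u k e * cnj (?G $$ (e, f))) = complex_of_real (g (d k)) * u k f"
          using eigen_decomp_eigen[OF G f k] by simp
      qed
      finally show ?thesis by (simp add: sum_distrib_left mult.assoc)
    qed
    have "complex_of_real (sqnorm K (\<lambda>k. \<Sum>e<n. \<chi> k e * y e)) =
        complex_of_real (\<Sum>k\<in>K. (cmod (\<Sum>e<n. cnj (\<chi> k e) * cnj (y e)))\<^sup>2)"
    proof -
      have "cmod (\<Sum>e<n. cnj (\<chi> k e) * cnj (y e)) = cmod (\<Sum>e<n. \<chi> k e * y e)" for k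
        by (subst complex_mod_cnj[symmetric]) simp
      then show ?thesis by (simp add: sqnorm_def)
    qed
    also have "\<dots> = (\<Sum>i<n. \<Sum>j<n. cnj (cnj (y i)) * (\<Sum>k\<in>K. \<chi> k i * cnj (\<chi> k j)) * cnj (y j))"
      by (rule gram_quadratic_form[symmetric])
    also have "\<dots> = (\<Sum>i<n. \<Sum>j<n. cnj (cnj (y i)) * (\<Sum>k<n. complex_of_real (d k) * u k i * cnj (u k j)) * cnj (y j))"
      by (intro sum.cong refl) (simp add: Ae[symmetric] eigen_decompD(3)[OF ud])
    also have "\<dots> = (\<Sum>k<n. complex_of_real (d k) * complex_of_real ((cmod (\<Sum>j<n. cnj (u k j) * cnj (y j)))\<^sup>2))"
      by (rule weighted_gram_form)
    also have "\<dots> = complex_of_real (\<Sum>k<n. d k * (g (d k))\<^sup>2 * (cmod (\<Sum>f<n. u k f * v f))\<^sup>2)"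
    proof -
      have "cmod (\<Sum>j<n. cnj (u k j) * cnj (y j)) = \<bar>g (d k)\<bar> * cmod (\<Sum>f<n. u k f * v f)" if "k < n" for k
        by (subst complex_mod_cnj[symmetric]) (simp add: uy[OF that] norm_mult)
      then show ?thesis by (simp add: power_mult_distrib mult.assoc)
    qed
    finally have "sqnorm K (\<lambda>k. \<Sum>e<n. \<chi> k e * y e) = (\<Sum>k<n. d k * (g (d k))\<^sup>2 * (cmod (\<Sum>f<n. u k f * v f))\<^sup>2)"
      by (simp only: of_real_eq_iff)
    also have "\<dots> \<le> (\<Sum>k<n. 1 * (cmod (\<Sum>f<n. u k f * v f))\<^sup>2)"
      by (intro sum_mono mult_right_mono) (auto simp: g_def power_divide)
    also have "\<dots> = (\<Sum>k<n. (cmod (\<Sum>f<n. cnj (u k f) * cnj (v f)))\<^sup>2)"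
      by (intro sum.cong refl, subst complex_mod_cnj[symmetric]) simp
    also have "\<dots> = sqnorm {..<n} v"
      unfolding parseval[OF u] by (rule sqnorm_cnj)
    finally show ?thesis unfolding y .
  qed
  have 3: "sqnorm {..<n} (\<lambda>f. \<Sum>k\<in>K. Z k f * y k) \<le> sqnorm K y" for y
    using adjoint_contraction[OF finite_lessThan K contr, of y] by simp
  show ?thesis
    using eigen_decompD(1)[OF S] psd_of_eigen_decomp[OF S] 1 2 3 d by (intro exI[of _ ?S] exI[of _ Z]) auto
qed

text \<open>The Powers-Stormer inequality, with the trace norm replaced by the sum over an eigenbasis of
  \<open>S - R\<close>.\<close>

lemma powers_stormer:
  assumes S: "S \<in> carrier_mat n n" "psd S" and R: "R \<in> carrier_mat n n" "psd R"
  shows "\<exists>d. onb n d \<and> (\<Sum>i<n. \<Sum>j<n. (cmod (S $$ (i, j) - R $$ (i, j)))\<^sup>2) \<le>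
    (\<Sum>k<n. cmod (\<Sum>i<n. \<Sum>j<n. cnj (d k i) *
       ((\<Sum>l<n. S $$ (i, l) * S $$ (l, j)) - (\<Sum>l<n. R $$ (i, l) * R $$ (l, j))) * d k j))"
proof -
  have herm: "M $$ (i, j) = cnj (M $$ (j, i))" if "M \<in> carrier_mat n n" "psd M" "i < n" "j < n" for M :: "complex mat" and i j
    using that hermitian_mat_entry[of M n i j] by (auto simp: psd_def)
  define D where "D = mat n n (\<lambda>(i, j). S $$ (i, j) - R $$ (i, j))"
  have D: "D \<in> carrier_mat n n" by (simp add: D_def)
  have De: "D $$ (i, j) = S $$ (i, j) - R $$ (i, j)" if "i < n" "j < n" for i j
    using that by (simp add: D_def)
  have "D $$ (i, j) = cnj (D $$ (j, i))" if "i < n" "j < n" for i j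
    using herm[OF S that] herm[OF R that] by (simp add: De that)
  then obtain d e where de: "eigen_decomp n D d e" using hermitian_eigen_decomp[OF D] by blast
  have d: "onb n d" by (rule eigen_decompD(2)[OF de])
  define form where "form M k = (\<Sum>i<n. \<Sum>j<n. cnj (d k i) * M $$ (i, j) * d k j)" for M k
  have form_pos: "form M k = complex_of_real (Re (form M k)) \<and> 0 \<le> Re (form M k)"
    if M: "M \<in> carrier_mat n n" "psd M" for M k
  proof -
    obtain g where g: "\<And>i j. i < n \<Longrightarrow> j < n \<Longrightarrow> M $$ (i, j) = (\<Sum>k<n. g k i * cnj (g k j))"
      using psd_gram[OF M(2,1)] by blast
    have "form M k = (\<Sum>i<n. \<Sum>j<n. cnj (d k i) * (\<Sum>l<n. g l i * cnj (g l j)) * d k j)"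
      unfolding form_def by (intro sum.cong refl) (simp add: g)
    then show ?thesis unfolding gram_quadratic_form by (simp add: sum_nonneg)
  qed
  \<comment> \<open>The identity S^2 - R^2 = S D + D R with D = S - R gives the value e k (<S> +
    <R>) at the eigenvector d k, while e k = <S> - <R>. Both expectations are non-negative, so |e k|
    <= <S> + <R>.\<close>
  have main: "(e k)\<^sup>2 \<le> cmod (\<Sum>i<n. \<Sum>j<n. cnj (d k i) *
       ((\<Sum>l<n. S $$ (i, l) * S $$ (l, j)) - (\<Sum>l<n. R $$ (i, l) * R $$ (l, j))) * d k j)" if k: "k < n" for k
  proof -
    have De': "(\<Sum>j<n. D $$ (i, j) * d k j) = complex_of_real (e k) * d k i" if "i < n" for i
      by (rule eigen_decomp_eigen[OF de that k])
    have eD: "(\<Sum>i<n. cnj (d k i) * D $$ (i, j)) = complex_of_real (e k) * cnj (d k j)" if j: "j < n" for j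
    proof -
      have "(\<Sum>i<n. cnj (d k i) * D $$ (i, j)) = cnj (\<Sum>i<n. D $$ (j, i) * d k i)"
        unfolding cnj_sum by (intro sum.cong refl) (use eigen_decomp_hermitian[OF de j] in \<open>simp add: mult.commute\<close>)
      then show ?thesis by (simp add: De'[OF j])
    qed
    have "(\<Sum>i<n. \<Sum>j<n. cnj (d k i) *
       ((\<Sum>l<n. S $$ (i, l) * S $$ (l, j)) - (\<Sum>l<n. R $$ (i, l) * R $$ (l, j))) * d k j) =
       (\<Sum>i<n. \<Sum>j<n. \<Sum>l<n. cnj (d k i) * S $$ (i, l) * (D $$ (l, j) * d k j)) +
       (\<Sum>i<n. \<Sum>j<n. \<Sum>l<n. cnj (d k i) * D $$ (i, l) * (R $$ (l, j) * d k j))"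
      unfolding sum.distrib[symmetric] sum_subtractf[symmetric] sum_distrib_left sum_distrib_right
      by (intro sum.cong refl) (simp add: De algebra_simps)
    also have "(\<Sum>i<n. \<Sum>j<n. \<Sum>l<n. cnj (d k i) * S $$ (i, l) * (D $$ (l, j) * d k j)) =
        complex_of_real (e k) * form S k"
    proof -
      have "(\<Sum>j<n. \<Sum>l<n. cnj (d k i) * S $$ (i, l) * (D $$ (l, j) * d k j)) =
         (\<Sum>l<n. cnj (d k i) * S $$ (i, l) * (complex_of_real (e k) * d k l))" for i
        by (subst sum.swap) (simp add: De' flip: sum_distrib_left)
      then show ?thesis unfolding form_def by (simp add: sum_distrib_left mult_ac)
    qed
    also have "(\<Sum>i<n. \<Sum>j<n. \<Sum>l<n. cnj (d k i) * D $$ (i, l) * (R $$ (l, j) * d k j)) =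
        complex_of_real (e k) * form R k"
    proof -
      have "(\<Sum>i<n. \<Sum>j<n. \<Sum>l<n. cnj (d k i) * D $$ (i, l) * (R $$ (l, j) * d k j)) =
         (\<Sum>j<n. \<Sum>l<n. \<Sum>i<n. cnj (d k i) * D $$ (i, l) * (R $$ (l, j) * d k j))"
        by (rule sum_rotate[symmetric])
      also have "\<dots> = (\<Sum>j<n. \<Sum>l<n. complex_of_real (e k) * cnj (d k l) * (R $$ (l, j) * d k j))"
        by (intro sum.cong refl) (simp add: eD flip: sum_distrib_right)
      also have "\<dots> = complex_of_real (e k) * form R k"
        unfolding form_def by (subst sum.swap) (simp add: sum_distrib_left mult_ac)
      finally show ?thesis .
    qed
    finally have eq: "(\<Sum>i<n. \<Sum>j<n. cnj (d k i) *
       ((\<Sum>l<n. S $$ (i, l) * S $$ (l, j)) - (\<Sum>l<n. R $$ (i, l) * R $$ (l, j))) * d k j) =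
       complex_of_real (e k) * (form S k + form R k)" by (simp add: algebra_simps)
    have "form S k - form R k = (\<Sum>i<n. cnj (d k i) * (\<Sum>j<n. D $$ (i, j) * d k j))"
      unfolding form_def sum_subtractf[symmetric] sum_distrib_left
      by (intro sum.cong refl) (simp add: De algebra_simps)
    also have "\<dots> = complex_of_real (e k) * (\<Sum>i<n. cnj (d k i) * d k i)"
      unfolding sum_distrib_left[of "complex_of_real (e k)"]
      by (intro sum.cong refl) (simp add: De')
    also have "\<dots> = complex_of_real (e k)" using onbD[OF d k k] by simp
    finally have "e k = Re (form S k) - Re (form R k)" by (metis Re_complex_of_real minus_complex.sel(1))
    moreover have "cmod (complex_of_real (e k) * (form S k + form R k)) = \<bar>e k\<bar> * (Re (form S k) + Re (form R k))"
    proof -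
      have "form S k + form R k = complex_of_real (Re (form S k) + Re (form R k))"
        using form_pos[OF S, of k] form_pos[OF R, of k] by (simp add: complex_eq_iff)
      then show ?thesis
        using form_pos[OF S, of k] form_pos[OF R, of k] by (simp add: norm_mult del: of_real_add)
    qed
    moreover have "\<bar>e k\<bar> * \<bar>e k\<bar> \<le> \<bar>e k\<bar> * (Re (form S k) + Re (form R k))"
      using calculation(1) form_pos[OF S, of k] form_pos[OF R, of k] by (intro mult_left_mono) auto
    ultimately show ?thesis unfolding eq by (simp add: power2_eq_square)
  qed
  \<comment> \<open>The squared Hilbert-Schmidt norm of D is the trace of D^2, the sum of its
    squared eigenvalues.\<close>
  have "complex_of_real (\<Sum>i<n. \<Sum>j<n. (cmod (S $$ (i, j) - R $$ (i, j)))\<^sup>2) = (\<Sum>i<n. \<Sum>j<n. D $$ (i, j) * D $$ (j, i))"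
  proof -
    have "complex_of_real ((cmod (S $$ (i, j) - R $$ (i, j)))\<^sup>2) = D $$ (i, j) * D $$ (j, i)" if "i < n" "j < n" for i j
      using eigen_decomp_hermitian[OF de that(2,1)] that by (simp add: complex_norm_square De del: of_real_power)
    then show ?thesis by simp
  qed
  also have "\<dots> = (\<Sum>i<n. \<Sum>k<n. complex_of_real (e k * e k) * d k i * cnj (d k i))"
    by (rule sum.cong[OF refl]) (simp only: eigen_decomp_mult[OF de de] lessThan_iff)
  also have "\<dots> = (\<Sum>k<n. complex_of_real (e k * e k) * (\<Sum>i<n. cnj (d k i) * d k i))"
    by (subst sum.swap) (simp add: sum_distrib_left mult_ac)
  also have "\<dots> = complex_of_real (\<Sum>k<n. (e k)\<^sup>2)"
    using onbD[OF d] by (simp add: power2_eq_square)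
  finally have "(\<Sum>i<n. \<Sum>j<n. (cmod (S $$ (i, j) - R $$ (i, j)))\<^sup>2) = (\<Sum>k<n. (e k)\<^sup>2)"
    by (simp only: of_real_eq_iff)
  also have "\<dots> \<le> (\<Sum>k<n. cmod (\<Sum>i<n. \<Sum>j<n. cnj (d k i) *
       ((\<Sum>l<n. S $$ (i, l) * S $$ (l, j)) - (\<Sum>l<n. R $$ (i, l) * R $$ (l, j))) * d k j))"
    by (intro sum_mono) (use main in auto)
  finally show ?thesis using d by blast
qed

section \<open>The privacy test\<close>

lemma sum_diag_le:
  fixes f :: "nat \<Rightarrow> nat \<Rightarrow> real"
  assumes "M \<le> a" "M \<le> b" "\<And>i j. 0 \<le> f i j"
  shows "(\<Sum>i<M. f i i) \<le> (\<Sum>i<a. \<Sum>j<b. f i j)"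
proof -
  have "(\<Sum>i<M. f i i) \<le> (\<Sum>i<M. \<Sum>j<b. f i j)"
    by (intro sum_mono member_le_sum) (use assms in auto)
  also have "\<dots> \<le> (\<Sum>i<a. \<Sum>j<b. f i j)"
    by (rule sum_mono2) (use assms in \<open>auto intro: sum_nonneg\<close>)
  finally show ?thesis .
qed

lemma sum_sqrt_mult_le:
  assumes "\<And>i. i \<in> I \<Longrightarrow> 0 \<le> f i" "\<And>i. i \<in> I \<Longrightarrow> 0 \<le> g i"
  shows "(\<Sum>i\<in>I. sqrt (f i * g i))\<^sup>2 \<le> (\<Sum>i\<in>I. f i) * (\<Sum>i\<in>I. g i)"
proof -
  have L2: "(L2_set (\<lambda>i. sqrt (h i)) I)\<^sup>2 = (\<Sum>i\<in>I. h i)" if "\<And>i. i \<in> I \<Longrightarrow> 0 \<le> h i" for h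
    using that by (simp add: L2_set_def sum_nonneg)
  have "(\<Sum>i\<in>I. sqrt (f i * g i)) = (\<Sum>i\<in>I. \<bar>sqrt (f i)\<bar> * \<bar>sqrt (g i)\<bar>)"
    by (intro sum.cong refl) (simp add: real_sqrt_mult assms)
  also have "\<dots> \<le> L2_set (\<lambda>i. sqrt (f i)) I * L2_set (\<lambda>i. sqrt (g i)) I"
    by (rule L2_set_mult_ineq)
  finally have "(\<Sum>i\<in>I. sqrt (f i * g i))\<^sup>2 \<le> (L2_set (\<lambda>i. sqrt (f i)) I * L2_set (\<lambda>i. sqrt (g i)) I)\<^sup>2"
    by (rule power_mono) (simp add: sum_nonneg assms)
  then show ?thesis unfolding power_mult_distrib using L2[of f] L2[of g] assms by simp
qed

text \<open>The vector \<open>|i\<rangle> \<otimes> |i\<rangle> \<otimes> d \<otimes> |c\<rangle>\<close> of \<open>a1 \<otimes> b1 \<otimes> e0 \<otimes> N\<close>.\<close>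

definition block_vec :: "nat \<Rightarrow> nat \<Rightarrow> nat \<Rightarrow> nat \<Rightarrow> nat \<Rightarrow> (nat \<Rightarrow> complex) \<Rightarrow> nat \<Rightarrow> complex" where
  "block_vec b1 e0 N i c d I =
     (if I div (e0 * N) = i * b1 + i \<and> I mod (e0 * N) mod N = c then d (I mod (e0 * N) div N) else 0)"

lemma block_vec_enc:
  assumes "e < e0" "c' < N"
  shows "block_vec b1 e0 N i c d (P * (e0 * N) + (e * N + c')) = (if P = i * b1 + i \<and> c' = c then d e else 0)"
  using assms enc_less[OF assms] by (simp add: block_vec_def)

lemma sum_block_vec:
  assumes i: "i < a1" "i < b1" and c: "c < N"
  shows "(\<Sum>I<a1 * b1 * (e0 * N). block_vec b1 e0 N i c d I * h I) =
    (\<Sum>e<e0. d e * h ((i * b1 + i) * (e0 * N) + (e * N + c)))"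
proof -
  have "(\<Sum>I<a1 * b1 * (e0 * N). block_vec b1 e0 N i c d I * h I) =
     (\<Sum>P<a1 * b1. \<Sum>e<e0. \<Sum>c'<N. (if P = i * b1 + i \<and> c' = c then d e else 0) * h (P * (e0 * N) + (e * N + c')))"
    unfolding sum_enc[where b = "e0 * N"] sum_enc[where b = N]
    by (intro sum.cong refl) (simp add: block_vec_enc)
  also have "\<dots> = (\<Sum>P<a1 * b1. if P = i * b1 + i then \<Sum>e<e0. d e * h (P * (e0 * N) + (e * N + c)) else 0)"
  proof (rule sum.cong[OF refl])
    fix P
    show "(\<Sum>e<e0. \<Sum>c'<N. (if P = i * b1 + i \<and> c' = c then d e else 0) * h (P * (e0 * N) + (e * N + c'))) =
      (if P = i * b1 + i then \<Sum>e<e0. d e * h (P * (e0 * N) + (e * N + c)) else 0)"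
    proof (cases "P = i * b1 + i")
      case True
      have "(\<Sum>c'<N. (if c' = c then d e else 0) * h (P * (e0 * N) + (e * N + c'))) =
          (\<Sum>c'<N. if c' = c then d e * h (P * (e0 * N) + (e * N + c')) else 0)" for e
        by (intro sum.cong refl) simp
      then show ?thesis using True c by simp
    qed simp
  qed
  also have "\<dots> = (\<Sum>e<e0. d e * h ((i * b1 + i) * (e0 * N) + (e * N + c)))"
    using enc_less[OF i] by simp
  finally show ?thesis .
qed

lemma cnj_block_vec: "cnj (block_vec b1 e0 N i c d I) = block_vec b1 e0 N i c (\<lambda>e. cnj (d e)) I"
  by (simp add: block_vec_def)

lemma block_vec_form:
  assumes i: "i < a1" "i < b1" and c: "c < N"
  shows "(\<Sum>I<a1 * b1 * (e0 * N). \<Sum>J<a1 * b1 * (e0 * N).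
      cnj (block_vec b1 e0 N i c d I) * h I J * block_vec b1 e0 N i c d J) =
    (\<Sum>e<e0. \<Sum>f<e0. cnj (d e) * h ((i * b1 + i) * (e0 * N) + (e * N + c)) ((i * b1 + i) * (e0 * N) + (f * N + c)) * d f)"
proof -
  let ?n = "a1 * b1 * (e0 * N)" and ?g = "block_vec b1 e0 N i c"
  have "(\<Sum>I<?n. \<Sum>J<?n. cnj (?g d I) * h I J * ?g d J) =
      (\<Sum>I<?n. ?g (\<lambda>e. cnj (d e)) I * (\<Sum>J<?n. ?g d J * h I J))"
    unfolding cnj_block_vec sum_distrib_left by (simp only: mult_ac)
  also have "\<dots> = (\<Sum>e<e0. cnj (d e) * (\<Sum>f<e0. d f *
      h ((i * b1 + i) * (e0 * N) + (e * N + c)) ((i * b1 + i) * (e0 * N) + (f * N + c))))"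
    unfolding sum_block_vec[OF i c] ..
  finally show ?thesis unfolding sum_distrib_left by (simp only: mult_ac)
qed

text \<open>\<open>A c x p u\<close> is the entry \<open>(p, u)\<close> of Alice's Kraus operator number \<open>x\<close> for the transcript \<open>c\<close>, and
  \<open>B\<close> describes Bob's operations. Only the operations for all transcripts together preserve the trace.\<close>

locale kraus_pair =
  fixes N a1 b1 nU nV :: nat
    and IA :: "nat \<Rightarrow> 'x set" and IB :: "nat \<Rightarrow> 'y set"
    and A :: "nat \<Rightarrow> 'x \<Rightarrow> nat \<Rightarrow> nat \<Rightarrow> complex" and B :: "nat \<Rightarrow> 'y \<Rightarrow> nat \<Rightarrow> nat \<Rightarrow> complex"
  assumes fin: "\<And>c. finite (IA c)" "\<And>c. finite (IB c)"
    and complete: "\<And>u u' v v'. u < nU \<Longrightarrow> u' < nU \<Longrightarrow> v < nV \<Longrightarrow> v' < nV \<Longrightarrow>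
      (\<Sum>c<N. (\<Sum>p<a1. \<Sum>x\<in>IA c. A c x p u * cnj (A c x p u')) *
              (\<Sum>q<b1. \<Sum>y\<in>IB c. B c y q v * cnj (B c y q v'))) = (if u = u' \<and> v = v' then 1 else 0)"
begin

abbreviation UV where "UV \<equiv> {..<nU} \<times> {..<nV}"

abbreviation KK where "KK c \<equiv> IA c \<times> IB c"

text \<open>The unnormalised state left by transcript \<open>c\<close> and outputs \<open>p\<close>,
  \<open>q\<close>, as a vector indexed by pairs of Kraus operators, that is, by the purifying
  environments of the two parties.\<close>

definition branch :: "nat \<Rightarrow> nat \<Rightarrow> nat \<Rightarrow> (nat \<times> nat \<Rightarrow> complex) \<Rightarrow> 'x \<times> 'y \<Rightarrow> complex" where
  "branch c p q f k = (\<Sum>s\<in>UV. A c (fst k) p (fst s) * B c (snd k) q (snd s) * f s)"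

text \<open>Transcript, outputs and Kraus indices together index the components of a Stinespring
  isometry. Its columns are orthonormal by \<open>complete\<close>, whose summand for each
  transcript is a product of a sum for Alice and a sum for Bob.\<close>

lemma branch_isometry:
  "(\<Sum>c<N. \<Sum>p<a1. \<Sum>q<b1. sqnorm (KK c) (branch c p q f)) = sqnorm UV f"
proof -
  define \<Omega> where "\<Omega> = (SIGMA c:{..<N}. {..<a1} \<times> {..<b1} \<times> KK c)"
  define g where "g s w = (case w of (c, p, q, k) \<Rightarrow> A c (fst k) p (fst s) * B c (snd k) q (snd s))" for s w
  have sum\<Omega>: "(\<Sum>w\<in>\<Omega>. F w) = (\<Sum>c<N. \<Sum>p<a1. \<Sum>q<b1. \<Sum>k\<in>KK c. F (c, p, q, k))"
    for F :: "_ \<Rightarrow> 'c :: comm_monoid_add"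
    unfolding \<Omega>_def
    by (subst sum.Sigma[symmetric, of _ _ "\<lambda>c w. F (c, w)", simplified])
      (simp_all add: fin sum.cartesian_product case_prod_unfold)
  have "(\<Sum>w\<in>\<Omega>. cnj (g t w) * g s w) = (if t = s then 1 else 0)" if s: "s \<in> UV" and t: "t \<in> UV" for s t
  proof -
    have "(\<Sum>w\<in>\<Omega>. cnj (g t w) * g s w) = (\<Sum>c<N. \<Sum>p<a1. \<Sum>q<b1. \<Sum>x\<in>IA c. \<Sum>y\<in>IB c.
        (A c x p (fst s) * cnj (A c x p (fst t))) * (B c y q (snd s) * cnj (B c y q (snd t))))"
      unfolding sum\<Omega> by (simp add: g_def sum.cartesian_product case_prod_unfold mult_ac)
    also have "\<dots> = (\<Sum>c<N. (\<Sum>p<a1. \<Sum>x\<in>IA c. A c x p (fst s) * cnj (A c x p (fst t))) *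
        (\<Sum>q<b1. \<Sum>y\<in>IB c. B c y q (snd s) * cnj (B c y q (snd t))))"
      by (simp only: sum_mult_sum4)
    also have "\<dots> = (if t = s then 1 else 0)"
      using s t complete by (auto simp: prod_eq_iff)
    finally show ?thesis .
  qed
  then have "sqnorm \<Omega> (\<lambda>w. \<Sum>s\<in>UV. g s w * f s) = sqnorm UV f"
    by (intro isometry_sqnorm) auto
  then show ?thesis unfolding sqnorm_def[of \<Omega>] sum\<Omega> by (simp add: g_def branch_def sqnorm_def)
qed

lemma branch_diag_le:
  assumes "M \<le> a1" "M \<le> b1"
  shows "(\<Sum>c<N. \<Sum>i<M. sqnorm (KK c) (branch c i i f)) \<le> sqnorm UV f"
  unfolding branch_isometry[symmetric] by (intro sum_mono sum_diag_le assms) simp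

text \<open>The operator W. Its output index \<open>z\<close> consists of the transcript and a basis
  index of Eve's initial system, the target of the untwisting. M branches of norm about 1 / sqrt M,
  turned into one direction, add up to sqrt M, hence the weight.\<close>

definition test_op :: "nat \<Rightarrow> (nat \<Rightarrow> nat \<Rightarrow> 'x \<times> 'y \<Rightarrow> nat \<Rightarrow> complex) \<Rightarrow> nat \<times> nat \<Rightarrow> nat \<times> nat \<Rightarrow> complex" where
  "test_op M Z z s = complex_of_real (1 / sqrt M) * (\<Sum>i<M. \<Sum>k\<in>KK (fst z).
     Z (fst z) i k (snd z) * (A (fst z) (fst k) i (fst s) * B (fst z) (snd k) i (snd s)))"

lemma test_op_apply:
  "(\<Sum>s\<in>UV. test_op M Z z s * f s) =
    complex_of_real (1 / sqrt M) * (\<Sum>i<M. \<Sum>k\<in>KK (fst z). Z (fst z) i k (snd z) * branch (fst z) i i f k)"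
proof -
  have "(\<Sum>s\<in>UV. test_op M Z z s * f s) = (\<Sum>s\<in>UV. \<Sum>i<M. \<Sum>k\<in>KK (fst z). complex_of_real (1 / sqrt M) *
     (Z (fst z) i k (snd z) * (A (fst z) (fst k) i (fst s) * B (fst z) (snd k) i (snd s) * f s)))"
    unfolding test_op_def sum_distrib_left sum_distrib_right by (simp only: mult_ac)
  also have "\<dots> = (\<Sum>i<M. \<Sum>k\<in>KK (fst z). \<Sum>s\<in>UV. complex_of_real (1 / sqrt M) *
     (Z (fst z) i k (snd z) * (A (fst z) (fst k) i (fst s) * B (fst z) (snd k) i (snd s) * f s)))"
    by (rule sum_rotate[symmetric])
  finally show ?thesis unfolding branch_def sum_distrib_left .
qed

text \<open>Different transcripts have orthogonal outputs, so their contributions add exactly. Only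
  inside a transcript is the triangle inequality applied to the key values, followed by
  contractivity of \<open>Z\<close>.\<close>

lemma test_op_sqnorm_le:
  assumes Z: "\<And>c i y. c < N \<Longrightarrow> i < M \<Longrightarrow> sqnorm {..<e0} (\<lambda>f. \<Sum>k\<in>KK c. Z c i k f * y k) \<le> sqnorm (KK c) y"
  shows "sqnorm ({..<N} \<times> {..<e0}) (\<lambda>z. \<Sum>s\<in>UV. test_op M Z z s * f s) \<le>
    (\<Sum>c<N. (\<Sum>i<M. sqrt (sqnorm (KK c) (branch c i i f)))\<^sup>2) / real M"
proof -
  have "sqnorm ({..<N} \<times> {..<e0}) (\<lambda>z. \<Sum>s\<in>UV. test_op M Z z s * f s) =
     (\<Sum>c<N. (1 / real M) * sqnorm {..<e0} (\<lambda>g. \<Sum>i<M. \<Sum>k\<in>KK c. Z c i k g * branch c i i f k))"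
    unfolding test_op_apply sqnorm_Times sqnorm_scale by (simp add: norm_divide power_divide sum_divide_distrib)
  also have "\<dots> \<le> (\<Sum>c<N. (1 / real M) * (\<Sum>i<M. sqrt (sqnorm (KK c) (branch c i i f)))\<^sup>2)"
  proof (intro sum_mono mult_left_mono)
    fix c assume "c \<in> {..<N}"
    then have c: "c < N" by simp
    have "sqnorm {..<e0} (\<lambda>g. \<Sum>i<M. \<Sum>k\<in>KK c. Z c i k g * branch c i i f k) \<le>
       (\<Sum>i<M. sqrt (sqnorm {..<e0} (\<lambda>g. \<Sum>k\<in>KK c. Z c i k g * branch c i i f k)))\<^sup>2"
      by (rule sqnorm_sum_le) simp
    also have "\<dots> \<le> (\<Sum>i<M. sqrt (sqnorm (KK c) (branch c i i f)))\<^sup>2"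
      by (intro power_mono sum_mono real_sqrt_le_mono Z c sum_nonneg) auto
    finally show "sqnorm {..<e0} (\<lambda>g. \<Sum>i<M. \<Sum>k\<in>KK c. Z c i k g * branch c i i f k) \<le>
      (\<Sum>i<M. sqrt (sqnorm (KK c) (branch c i i f)))\<^sup>2" .
  qed simp
  finally show ?thesis by (simp add: sum_divide_distrib)
qed

text \<open>Cauchy-Schwarz over the M key values costs a factor M, which the squared weight 1 / M of
  the test cancels. The diagonal branches that remain are part of an isometry.\<close>

lemma test_op_contraction:
  assumes Z: "\<And>c i y. c < N \<Longrightarrow> i < M \<Longrightarrow> sqnorm {..<e0} (\<lambda>f. \<Sum>k\<in>KK c. Z c i k f * y k) \<le> sqnorm (KK c) y"
    and M: "0 < M" "M \<le> a1" "M \<le> b1"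
  shows "sqnorm ({..<N} \<times> {..<e0}) (\<lambda>z. \<Sum>s\<in>UV. test_op M Z z s * f s) \<le> sqnorm UV f"
proof -
  have "(\<Sum>c<N. (\<Sum>i<M. sqrt (sqnorm (KK c) (branch c i i f)))\<^sup>2) \<le>
      (\<Sum>c<N. real M * (\<Sum>i<M. sqnorm (KK c) (branch c i i f)))"
    by (intro sum_mono order_trans[OF sum_power2_le]) simp
  also have "\<dots> \<le> real M * sqnorm UV f"
    unfolding sum_distrib_left[symmetric] using branch_diag_le[OF M(2,3)] by (intro mult_left_mono) auto
  finally have "(\<Sum>c<N. (\<Sum>i<M. sqrt (sqnorm (KK c) (branch c i i f)))\<^sup>2) / real M \<le> sqnorm UV f"
    using M(1) by (simp add: divide_le_eq mult.commute)
  with test_op_sqnorm_le[where f = f and M = M and Z = Z, OF Z] show ?thesis by (rule order_trans)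
qed

text \<open>This is where separability enters: on product vectors the branch norms factorise, and since the
  untwisting acts separately for each transcript \<open>c\<close>, the test accepts with probability at most \<open>1 / M\<close>.\<close>

lemma test_op_product:
  assumes Z: "\<And>c i y. c < N \<Longrightarrow> i < M \<Longrightarrow> sqnorm {..<e0} (\<lambda>f. \<Sum>k\<in>KK c. Z c i k f * y k) \<le> sqnorm (KK c) y"
    and M: "0 < M" "M \<le> a1" "M \<le> b1"
  shows "sqnorm ({..<N} \<times> {..<e0}) (\<lambda>z. \<Sum>s\<in>UV. test_op M Z z s * (g (fst s) * h (snd s))) \<le>
    sqnorm {..<nU} g * sqnorm {..<nV} h / real M"
proof -
  let ?f = "\<lambda>s. g (fst s) * h (snd s)"
  define \<alpha> where "\<alpha> c p = sqnorm (IA c) (\<lambda>x. \<Sum>u<nU. A c x p u * g u)" for c p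
  define \<beta> where "\<beta> c q = sqnorm (IB c) (\<lambda>y. \<Sum>v<nV. B c y q v * h v)" for c q
  have \<alpha>\<beta>: "sqnorm (KK c) (branch c p q ?f) = \<alpha> c p * \<beta> c q" for c p q
  proof -
    have "branch c p q ?f k = (case k of (x, y) \<Rightarrow> (\<Sum>u<nU. A c x p u * g u) * (\<Sum>v<nV. B c y q v * h v))" for k
      unfolding branch_def by (simp add: sum_product sum.cartesian_product case_prod_unfold mult_ac)
    then have "branch c p q ?f = (\<lambda>(x, y). (\<Sum>u<nU. A c x p u * g u) * (\<Sum>v<nV. B c y q v * h v))" by blast
    then show ?thesis unfolding \<alpha>_def \<beta>_def by (simp only: sqnorm_prod)
  qed
  have nonneg: "0 \<le> \<alpha> c p" "0 \<le> \<beta> c p" for c p by (simp_all add: \<alpha>_def \<beta>_def)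
  \<comment> \<open>For product vectors, Cauchy-Schwarz applied to the factors \<alpha> and \<beta>
    bounds the squared diagonal sum by the weight of all pairs (p, q) without a factor M, so the 1 /
    M of the test survives.\<close>
  have "(\<Sum>c<N. (\<Sum>i<M. sqrt (sqnorm (KK c) (branch c i i ?f)))\<^sup>2) \<le>
      (\<Sum>c<N. \<Sum>p<a1. \<Sum>q<b1. sqnorm (KK c) (branch c p q ?f))"
  proof (intro sum_mono)
    fix c
    have "(\<Sum>i<M. sqrt (sqnorm (KK c) (branch c i i ?f)))\<^sup>2 \<le> (\<Sum>i<M. \<alpha> c i) * (\<Sum>i<M. \<beta> c i)"
      unfolding \<alpha>\<beta> by (intro sum_sqrt_mult_le nonneg)
    also have "\<dots> \<le> (\<Sum>p<a1. \<alpha> c p) * (\<Sum>q<b1. \<beta> c q)"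
      using M nonneg by (intro mult_mono sum_mono2 sum_nonneg) auto
    finally show "(\<Sum>i<M. sqrt (sqnorm (KK c) (branch c i i ?f)))\<^sup>2 \<le>
        (\<Sum>p<a1. \<Sum>q<b1. sqnorm (KK c) (branch c p q ?f))"
      unfolding \<alpha>\<beta> by (simp add: sum_product)
  qed
  also have "\<dots> = sqnorm UV ?f" by (rule branch_isometry)
  also have "\<dots> = sqnorm {..<nU} g * sqnorm {..<nV} h"
    using sqnorm_prod[of "{..<nU}" "{..<nV}" g h] by (simp add: case_prod_unfold)
  finally have "(\<Sum>c<N. (\<Sum>i<M. sqrt (sqnorm (KK c) (branch c i i ?f)))\<^sup>2) / real M \<le>
      sqnorm {..<nU} g * sqnorm {..<nV} h / real M"
    by (rule divide_right_mono) simp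
  with test_op_sqnorm_le[where f = ?f and M = M and Z = Z, OF Z] show ?thesis by (rule order_trans)
qed

text \<open>If the output were exactly the key state, every \<open>S c i\<close> would be the root
  \<open>R c\<close>, and the M aligned branches would add up to a vector of norm 1. In general
  Powers-Stormer bounds the deviations by diagonal blocks of \<Omega> - \<kappa>, and
  \<open>trace_dist_ge\<close> adds them up.\<close>

lemma test_op_success:
  fixes \<psi> :: "nat \<Rightarrow> nat \<times> nat \<Rightarrow> complex" and e0 :: nat
  defines "n \<equiv> a1 * b1 * (e0 * N)"
  assumes M: "0 < M" "M \<le> a1" "M \<le> b1"
    and \<Omega>: "\<Omega> \<in> carrier_mat n n"
      "\<And>p p' q q' e e' c c'. p < a1 \<Longrightarrow> p' < a1 \<Longrightarrow> q < b1 \<Longrightarrow> q' < b1 \<Longrightarrow> e < e0 \<Longrightarrow> e' < e0 \<Longrightarrow> c < N \<Longrightarrow> c' < N \<Longrightarrow>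
        \<Omega> $$ ((p * b1 + q) * (e0 * N) + (e * N + c), (p' * b1 + q') * (e0 * N) + (e' * N + c')) =
        (if c = c' then \<Sum>k\<in>KK c. branch c p q (\<psi> e) k * cnj (branch c p' q' (\<psi> e') k) else 0)"
    and \<tau>: "density_op (e0 * N) \<tau>"
    and \<kappa>: "\<kappa> \<in> carrier_mat n n" "\<And>i j. i < n \<Longrightarrow> j < n \<Longrightarrow> \<kappa> $$ (i, j) = cnj (\<kappa> $$ (j, i))"
      "\<And>i e e' c. i < M \<Longrightarrow> e < e0 \<Longrightarrow> e' < e0 \<Longrightarrow> c < N \<Longrightarrow>
        \<kappa> $$ ((i * b1 + i) * (e0 * N) + (e * N + c), (i * b1 + i) * (e0 * N) + (e' * N + c)) =
        \<tau> $$ (e * N + c, e' * N + c) / of_nat M"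
  obtains Z where
    "\<And>c i y. c < N \<Longrightarrow> i < M \<Longrightarrow> sqnorm {..<e0} (\<lambda>f. \<Sum>k\<in>KK c. Z c i k f * y k) \<le> sqnorm (KK c) y"
    "1 - 2 * sqrt (2 * trace_dist \<Omega> \<kappa>) \<le>
       (\<Sum>e<e0. sqnorm ({..<N} \<times> {..<e0}) (\<lambda>z. \<Sum>s\<in>UV. test_op M Z z s * \<psi> e s))"
proof -
  \<comment> \<open>\<open>R\<close> is the root of the block of \<tau> for transcript
    \<open>c\<close>, divided by M: the ideal value of \<open>S c i\<close>, the same for all key
    values i.\<close>
  have "\<exists>R. R \<in> carrier_mat e0 e0 \<and> psd R \<and>
      (\<forall>e<e0. \<forall>f<e0. (\<Sum>l<e0. R $$ (e, l) * R $$ (l, f)) = \<tau> $$ (e * N + c, f * N + c) / of_nat M)" if c: "c < N" for c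
  proof -
    obtain g where g: "\<And>i j. i < e0 * N \<Longrightarrow> j < e0 * N \<Longrightarrow> \<tau> $$ (i, j) = (\<Sum>k<e0 * N. g k i * cnj (g k j))"
      using psd_gram[of \<tau> "e0 * N"] \<tau> by (auto simp: density_op_def)
    let ?T = "mat e0 e0 (\<lambda>(e, f). \<tau> $$ (e * N + c, f * N + c) / of_nat M)"
    have "psd ?T"
    proof (rule psd_of_gram[where K = "{..<e0 * N}" and g = "\<lambda>k e. g k (e * N + c) / complex_of_real (sqrt M)"])
      fix i j assume ij: "i < e0" "j < e0"
      have "complex_of_real (sqrt M) * complex_of_real (sqrt M) = of_nat M"
        by (simp flip: of_real_mult)
      then show "?T $$ (i, j) = (\<Sum>k<e0 * N. g k (i * N + c) / complex_of_real (sqrt M) *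
          cnj (g k (j * N + c) / complex_of_real (sqrt M)))"
        using ij c by (simp add: g enc_less sum_divide_distrib)
    qed simp
    then obtain R where "R \<in> carrier_mat e0 e0" "psd R"
      "\<And>e f. e < e0 \<Longrightarrow> f < e0 \<Longrightarrow> (\<Sum>l<e0. R $$ (e, l) * R $$ (l, f)) = ?T $$ (e, f)"
      by (rule psd_sqrt[OF _ mat_carrier]) (rule that)
    then show ?thesis by auto
  qed
  then have "\<forall>c. \<exists>R. c < N \<longrightarrow> R \<in> carrier_mat e0 e0 \<and> psd R \<and>
      (\<forall>e<e0. \<forall>f<e0. (\<Sum>l<e0. R $$ (e, l) * R $$ (l, f)) = \<tau> $$ (e * N + c, f * N + c) / of_nat M)" by blast
  then obtain R where R: "\<And>c. c < N \<Longrightarrow> R c \<in> carrier_mat e0 e0" "\<And>c. c < N \<Longrightarrow> psd (R c)"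
    "\<And>c e f. c < N \<Longrightarrow> e < e0 \<Longrightarrow> f < e0 \<Longrightarrow>
       (\<Sum>l<e0. R c $$ (e, l) * R c $$ (l, f)) = \<tau> $$ (e * N + c, f * N + c) / of_nat M"
    unfolding choice_iff by blast
  have "\<forall>c i. \<exists>S Z. S \<in> carrier_mat e0 e0 \<and> psd S \<and>
    (\<forall>e<e0. \<forall>f<e0. (\<Sum>k\<in>KK c. branch c i i (\<psi> e) k * Z k f) = S $$ (e, f)) \<and>
    (\<forall>e<e0. \<forall>f<e0. (\<Sum>l<e0. S $$ (e, l) * S $$ (l, f)) = (\<Sum>k\<in>KK c. branch c i i (\<psi> e) k * cnj (branch c i i (\<psi> f) k))) \<and>
    (\<forall>y. sqnorm {..<e0} (\<lambda>f. \<Sum>k\<in>KK c. Z k f * y k) \<le> sqnorm (KK c) y)"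
    by (intro allI polar_contraction[where \<chi> = "\<lambda>k e. branch _ _ _ (\<psi> e) k"] finite_cartesian_product fin)
  then obtain S Z where "\<forall>c i. S c i \<in> carrier_mat e0 e0 \<and> psd (S c i) \<and>
    (\<forall>e<e0. \<forall>f<e0. (\<Sum>k\<in>KK c. branch c i i (\<psi> e) k * Z c i k f) = S c i $$ (e, f)) \<and>
    (\<forall>e<e0. \<forall>f<e0. (\<Sum>l<e0. S c i $$ (e, l) * S c i $$ (l, f)) = (\<Sum>k\<in>KK c. branch c i i (\<psi> e) k * cnj (branch c i i (\<psi> f) k))) \<and>
    (\<forall>y. sqnorm {..<e0} (\<lambda>f. \<Sum>k\<in>KK c. Z c i k f * y k) \<le> sqnorm (KK c) y)"
    unfolding choice_iff by (elim exE) (rule that)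
  then have S: "\<And>c i. S c i \<in> carrier_mat e0 e0" "\<And>c i. psd (S c i)"
    "\<And>c i e f. e < e0 \<Longrightarrow> f < e0 \<Longrightarrow> (\<Sum>k\<in>KK c. branch c i i (\<psi> e) k * Z c i k f) = S c i $$ (e, f)"
    "\<And>c i e f. e < e0 \<Longrightarrow> f < e0 \<Longrightarrow> (\<Sum>l<e0. S c i $$ (e, l) * S c i $$ (l, f)) =
       (\<Sum>k\<in>KK c. branch c i i (\<psi> e) k * cnj (branch c i i (\<psi> f) k))"
    and Z: "\<And>c i y. sqnorm {..<e0} (\<lambda>f. \<Sum>k\<in>KK c. Z c i k f * y k) \<le> sqnorm (KK c) y"
    by blast+
  define HS where "HS c i = (\<Sum>e<e0. \<Sum>f<e0. (cmod (S c i $$ (e, f) - R c $$ (e, f)))\<^sup>2)" for c i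
  have "\<forall>c i. \<exists>d. c < N \<longrightarrow> onb e0 d \<and> HS c i \<le> (\<Sum>k<e0. cmod (\<Sum>e<e0. \<Sum>f<e0. cnj (d k e) *
       ((\<Sum>l<e0. S c i $$ (e, l) * S c i $$ (l, f)) - (\<Sum>l<e0. R c $$ (e, l) * R c $$ (l, f))) * d k f))"
    unfolding HS_def using powers_stormer[OF S(1,2) R(1,2)] by blast
  then obtain d where d: "\<And>c i. c < N \<Longrightarrow> onb e0 (d c i)"
    "\<And>c i. c < N \<Longrightarrow> HS c i \<le> (\<Sum>k<e0. cmod (\<Sum>e<e0. \<Sum>f<e0. cnj (d c i k e) *
       ((\<Sum>l<e0. S c i $$ (e, l) * S c i $$ (l, f)) - (\<Sum>l<e0. R c $$ (e, l) * R c $$ (l, f))) * d c i k f))"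
    unfolding choice_iff by blast
  have HS: "(\<Sum>c<N. \<Sum>i<M. HS c i) \<le> 2 * trace_dist \<Omega> \<kappa>"
  proof -
    \<comment> \<open>The eigenvectors provided by Powers-Stormer for each pair (c, i), placed in
      the block of key value i and transcript c. Distinct blocks are orthogonal, so the whole family
      is orthonormal.\<close>
    let ?g = "\<lambda>(c, i, k). block_vec b1 e0 N i c (d c i k)" and ?Z = "{..<N} \<times> {..<M} \<times> {..<e0}"
    have \<Delta>: "\<Omega> - \<kappa> \<in> carrier_mat n n" using \<Omega> \<kappa> by auto
    have herm: "(\<Omega> - \<kappa>) $$ (I, J) = cnj ((\<Omega> - \<kappa>) $$ (J, I))" if IJ: "I < n" "J < n" for I J
    proof -
      obtain P E where I1: "I = P * (e0 * N) + E" "P < a1 * b1" "E < e0 * N" using IJ(1) unfolding n_def by (rule enc_dec)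
      obtain p q where I2: "P = p * b1 + q" "p < a1" "q < b1" using I1(2) by (rule enc_dec)
      obtain e c where I3: "E = e * N + c" "e < e0" "c < N" using I1(3) by (rule enc_dec)
      obtain P' E' where J1: "J = P' * (e0 * N) + E'" "P' < a1 * b1" "E' < e0 * N" using IJ(2) unfolding n_def by (rule enc_dec)
      obtain p' q' where J2: "P' = p' * b1 + q'" "p' < a1" "q' < b1" using J1(2) by (rule enc_dec)
      obtain e' c' where J3: "E' = e' * N + c'" "e' < e0" "c' < N" using J1(3) by (rule enc_dec)
      have "\<Omega> $$ (I, J) = cnj (\<Omega> $$ (J, I))"
        unfolding I1(1) I2(1) I3(1) J1(1) J2(1) J3(1)
          \<Omega>(2)[OF I2(2) J2(2) I2(3) J2(3) I3(2) J3(2) I3(3) J3(3)]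
          \<Omega>(2)[OF J2(2) I2(2) J2(3) I2(3) J3(2) I3(2) J3(3) I3(3)]
        by (simp add: mult.commute)
      then show ?thesis using \<kappa>(1) \<kappa>(2)[OF IJ] IJ by simp
    qed
    have on: "(\<Sum>I<n. cnj (?g y I) * ?g z I) = (if y = z then 1 else 0)" if y: "y \<in> ?Z" and z: "z \<in> ?Z" for y z
    proof -
      obtain c i k where y': "y = (c, i, k)" "c < N" "i < M" "k < e0" using y by auto
      obtain c' i' k' where z': "z = (c', i', k')" "c' < N" "i' < M" "k' < e0" using z by auto
      have lt: "i < a1" "i < b1" "i' < b1" using y' z' M by auto
      have "(\<Sum>I<n. cnj (?g y I) * ?g z I) = (\<Sum>e<e0. cnj (d c i k e) *
          (if i * b1 + i = i' * b1 + i' \<and> c = c' then d c' i' k' e else 0))"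
        unfolding n_def y'(1) z'(1) split cnj_block_vec sum_block_vec[OF lt(1,2) y'(2)]
        by (intro sum.cong refl) (simp add: block_vec_enc y' z')
      also have "\<dots> = (if y = z then 1 else 0)"
        using onbD[OF d(1)[OF y'(2)] y'(4) z'(4)] y'(1) z'(1)
        by (cases "i = i' \<and> c = c'") (auto simp: enc_eq_iff[OF lt(2,3)])
      finally show ?thesis .
    qed
    have "(\<Sum>c<N. \<Sum>i<M. HS c i) \<le> (\<Sum>z\<in>?Z. cmod (\<Sum>I<n. \<Sum>J<n. cnj (?g z I) * (\<Omega> - \<kappa>) $$ (I, J) * ?g z J))"
      unfolding sum.cartesian_product'
    proof (intro sum_mono)
      fix c i assume "c \<in> {..<N}" "i \<in> {..<M}"
      then have ci: "c < N" "i < M" "i < a1" "i < b1" using M by auto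
      have "(\<Sum>I<n. \<Sum>J<n. cnj (?g (c, i, k) I) * (\<Omega> - \<kappa>) $$ (I, J) * ?g (c, i, k) J) =
        (\<Sum>e<e0. \<Sum>f<e0. cnj (d c i k e) *
         ((\<Sum>l<e0. S c i $$ (e, l) * S c i $$ (l, f)) - (\<Sum>l<e0. R c $$ (e, l) * R c $$ (l, f))) * d c i k f)" for k
        unfolding n_def split block_vec_form[OF ci(3,4,1)]
      proof (intro sum.cong refl arg_cong2[where f = "(*)"])
        fix e f assume "e \<in> {..<e0}" "f \<in> {..<e0}"
        then have ef: "e < e0" "f < e0" by auto
        let ?I = "\<lambda>e. (i * b1 + i) * (e0 * N) + (e * N + c)"
        have "?I e < n" "?I f < n" unfolding n_def using ef ci by (simp_all only: enc_less)
        then have "(\<Omega> - \<kappa>) $$ (?I e, ?I f) = \<Omega> $$ (?I e, ?I f) - \<kappa> $$ (?I e, ?I f)"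
          using \<kappa>(1) by simp
        then show "(\<Omega> - \<kappa>) $$ (?I e, ?I f) =
            (\<Sum>l<e0. S c i $$ (e, l) * S c i $$ (l, f)) - (\<Sum>l<e0. R c $$ (e, l) * R c $$ (l, f))"
          unfolding \<Omega>(2)[OF ci(3,3,4,4) ef ci(1,1)] \<kappa>(3)[OF ci(2) ef ci(1)] S(4)[OF ef] R(3)[OF ci(1) ef] by simp
      qed
      then show "HS c i \<le> (\<Sum>k<e0. cmod (\<Sum>I<n. \<Sum>J<n. cnj (?g (c, i, k) I) * (\<Omega> - \<kappa>) $$ (I, J) * ?g (c, i, k) J))"
        using d(2)[OF ci(1), of i] by simp
    qed
    also have "\<dots> \<le> 2 * trace_dist \<Omega> \<kappa>"
      by (rule trace_dist_ge[OF \<Delta> herm _ on]) auto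
    finally show ?thesis .
  qed
  let ?Z = "{..<e0} \<times> {..<N} \<times> {..<e0}"
  let ?m = "complex_of_real (1 / sqrt M)"
  define Y where "Y = (\<lambda>(e, z). \<Sum>s\<in>UV. test_op M Z z s * \<psi> e s)"
  \<comment> \<open>\<open>Y\<close> is the image of the purification under the test, with Eve's
    index e left alone. \<open>T\<close> is what it would be if every \<open>S c i\<close> were
    equal to \<open>R c\<close>; its norm is 1 because \<tau> has trace 1.\<close>
  define T where "T = (\<lambda>(e, c, f). complex_of_real (sqrt M) * R c $$ (e, f))"
  have Ye: "Y (e, c, f) = ?m * (\<Sum>i<M. S c i $$ (e, f))" if "e < e0" "f < e0" for e c f
    unfolding Y_def split test_op_apply using S(3)[OF that] by (simp add: mult.commute)
  have T1: "sqnorm ?Z T = 1"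
  proof -
    have "complex_of_real (\<Sum>f<e0. (cmod (T (e, c, f)))\<^sup>2) = \<tau> $$ (e * N + c, e * N + c)" if ec: "e < e0" "c < N" for e c
    proof -
      have "complex_of_real ((cmod (T (e, c, f)))\<^sup>2) = of_nat M * (R c $$ (e, f) * R c $$ (f, e))" if f: "f < e0" for f
      proof -
        have "R c $$ (f, e) = cnj (R c $$ (e, f))"
          using hermitian_mat_entry[OF _ R(1)[OF ec(2)] f ec(1)] R(2)[OF ec(2)] by (simp add: psd_def)
        moreover have "complex_of_real (sqrt M) * complex_of_real (sqrt M) = of_nat M" by (simp flip: of_real_mult)
        moreover have "complex_of_real ((cmod (T (e, c, f)))\<^sup>2) =
            complex_of_real (sqrt M) * complex_of_real (sqrt M) * (R c $$ (e, f) * cnj (R c $$ (e, f)))"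
          unfolding T_def split complex_norm_square by (simp only: complex_cnj_mult complex_cnj_complex_of_real mult_ac)
        ultimately show ?thesis by (simp only:)
      qed
      then have "complex_of_real (\<Sum>f<e0. (cmod (T (e, c, f)))\<^sup>2) = of_nat M * (\<Sum>f<e0. R c $$ (e, f) * R c $$ (f, e))"
        by (simp add: sum_distrib_left)
      then show ?thesis using R(3)[OF ec(2,1,1)] M(1) by simp
    qed
    then have "complex_of_real (sqnorm ?Z T) = (\<Sum>e<e0. \<Sum>c<N. \<tau> $$ (e * N + c, e * N + c))"
      unfolding sqnorm_Times by (simp add: sqnorm_def)
    also have "\<dots> = mtrace \<tau>"
      using \<tau> by (auto simp: mtrace_def density_op_def sum_enc)
    finally show ?thesis using \<tau> by (simp add: density_op_def)
  qed
  have TY: "sqnorm ?Z (\<lambda>z. T z - Y z) \<le> 2 * trace_dist \<Omega> \<kappa>"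
  proof -
    have "(cmod (T (e, c, f) - Y (e, c, f)))\<^sup>2 \<le> (\<Sum>i<M. (cmod (S c i $$ (e, f) - R c $$ (e, f)))\<^sup>2)"
      if ef: "e < e0" "f < e0" for e c f
    proof -
      have "sqrt M = 1 / sqrt M * real M" using M(1) by (simp add: real_div_sqrt)
      then have "complex_of_real (sqrt M) = complex_of_real (1 / sqrt M * real M)" by (rule arg_cong)
      also have "\<dots> = ?m * of_nat M" by (simp only: of_real_mult of_real_of_nat_eq)
      finally have m: "complex_of_real (sqrt M) = ?m * of_nat M" .
      have "T (e, c, f) - Y (e, c, f) = - ?m * (\<Sum>i<M. S c i $$ (e, f) - R c $$ (e, f))"
        unfolding Ye[OF ef] T_def split m sum_subtractf by (simp add: algebra_simps)
      then have "(cmod (T (e, c, f) - Y (e, c, f)))\<^sup>2 = (1 / real M) * (cmod (\<Sum>i<M. S c i $$ (e, f) - R c $$ (e, f)))\<^sup>2"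
        by (simp add: norm_mult norm_divide power_mult_distrib power_divide)
      also have "\<dots> \<le> (1 / real M) * (\<Sum>i<M. cmod (S c i $$ (e, f) - R c $$ (e, f)))\<^sup>2"
        by (intro mult_left_mono power_mono norm_sum) auto
      also have "\<dots> \<le> (1 / real M) * (real M * (\<Sum>i<M. (cmod (S c i $$ (e, f) - R c $$ (e, f)))\<^sup>2))"
        using sum_power2_le[of "\<lambda>i. cmod (S c i $$ (e, f) - R c $$ (e, f))" "{..<M}"]
        by (intro mult_left_mono) auto
      finally show ?thesis using M(1) by simp
    qed
    then have "sqnorm ?Z (\<lambda>z. T z - Y z) \<le> (\<Sum>e<e0. \<Sum>c<N. \<Sum>f<e0. \<Sum>i<M. (cmod (S c i $$ (e, f) - R c $$ (e, f)))\<^sup>2)"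
      unfolding sqnorm_Times unfolding sqnorm_def by (intro sum_mono) auto
    also have "\<dots> = (\<Sum>c<N. \<Sum>e<e0. \<Sum>i<M. \<Sum>f<e0. (cmod (S c i $$ (e, f) - R c $$ (e, f)))\<^sup>2)"
      by (subst sum.swap) (intro sum.cong refl sum.swap)
    also have "\<dots> = (\<Sum>c<N. \<Sum>i<M. HS c i)"
      unfolding HS_def by (intro sum.cong refl sum.swap)
    finally show ?thesis using HS by simp
  qed
  have "sqrt (sqnorm ?Z T) \<le> sqrt (sqnorm ?Z (\<lambda>z. T z - Y z)) + sqrt (sqnorm ?Z Y)"
    using sqrt_sqnorm_add[of ?Z "\<lambda>z. T z - Y z" Y] by simp
  then have "1 - sqrt (2 * trace_dist \<Omega> \<kappa>) \<le> sqrt (sqnorm ?Z Y)"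
    unfolding T1 real_sqrt_one using real_sqrt_le_mono[OF TY] by linarith
  \<comment> \<open>Passing to squares via x^2 >= 2 x - 1 needs no information on the sign of the
    lower bound for x.\<close>
  moreover have "2 * sqrt (sqnorm ?Z Y) - 1 \<le> (sqrt (sqnorm ?Z Y))\<^sup>2"
    using zero_le_power2[of "sqrt (sqnorm ?Z Y) - 1"] by (simp add: power2_eq_square algebra_simps)
  ultimately have "1 - 2 * sqrt (2 * trace_dist \<Omega> \<kappa>) \<le> sqnorm ?Z Y" by simp
  also have "\<dots> = (\<Sum>e<e0. sqnorm ({..<N} \<times> {..<e0}) (\<lambda>z. \<Sum>s\<in>UV. test_op M Z z s * \<psi> e s))"
    by (subst sqnorm_Times) (simp add: Y_def)
  finally show ?thesis using that Z by blast
qed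

end

section \<open>From protocols to tests\<close>

lemma key_state_carrier:
  "\<tau> \<in> carrier_mat e e \<Longrightarrow> key_state a b l \<tau> \<in> carrier_mat (a * b * e) (a * b * e)"
  unfolding key_state_def by (rule kron_carrier) (simp_all add: mat_sum_def)

lemma key_state_entry:
  assumes \<tau>: "\<tau> \<in> carrier_mat e e"
    and b: "p < a" "p' < a" "q < b" "q' < b" "E < e" "E' < e"
  shows "key_state a b l \<tau> $$ ((p * b + q) * e + E, (p' * b + q') * e + E') =
    (if p = q \<and> p' = q \<and> q' = q \<and> q < 2 ^ l then \<tau> $$ (E, E') / 2 ^ l else 0)"
proof -
  let ?D = "(1 / 2 ^ l) \<cdot>\<^sub>m mat_sum (a * b) (a * b) (\<lambda>i. kron (basis_proj a i) (basis_proj b i)) (2 ^ l)"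
  have D: "?D \<in> carrier_mat (a * b) (a * b)" by (simp add: mat_sum_def)
  have "?D $$ (p * b + q, p' * b + q') =
      (1 / 2 ^ l) * (\<Sum>i<2 ^ l. kron (basis_proj a i) (basis_proj b i) $$ (p * b + q, p' * b + q'))"
    using D enc_less[OF b(1,3)] enc_less[OF b(2,4)] by (simp add: mat_sum_def)
  also have "\<dots> = (1 / 2 ^ l) * (\<Sum>i<2 ^ l. if i = q then if p = q \<and> p' = q \<and> q' = q then 1 else 0 else 0)"
    by (intro sum.cong refl arg_cong2[where f = "(*)"])
      (auto simp: kron_entry[OF basis_proj_carrier basis_proj_carrier] basis_proj_entry b)
  finally have "?D $$ (p * b + q, p' * b + q') =
      (if p = q \<and> p' = q \<and> q' = q \<and> q < 2 ^ l then 1 / 2 ^ l else 0)" by simp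
  then show ?thesis
    unfolding key_state_def kron_entry[OF D \<tau> enc_less[OF b(1,3)] enc_less[OF b(2,4)] b(5,6)] by simp
qed

lemma key_state_hermitian:
  assumes \<tau>: "density_op e \<tau>" and i: "i < a * b * e" and j: "j < a * b * e"
  shows "key_state a b l \<tau> $$ (i, j) = cnj (key_state a b l \<tau> $$ (j, i))"
proof -
  have \<tau>c: "\<tau> \<in> carrier_mat e e" using \<tau> by (simp add: density_op_def)
  obtain P E where 1: "i = P * e + E" "P < a * b" "E < e" using i by (rule enc_dec)
  obtain p q where 2: "P = p * b + q" "p < a" "q < b" using 1(2) by (rule enc_dec)
  obtain P' E' where 3: "j = P' * e + E'" "P' < a * b" "E' < e" using j by (rule enc_dec)
  obtain p' q' where 4: "P' = p' * b + q'" "p' < a" "q' < b" using 3(2) by (rule enc_dec)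
  have "\<tau> $$ (E, E') = cnj (\<tau> $$ (E', E))"
    using \<tau> hermitian_mat_entry[OF _ \<tau>c 1(3) 3(3)] by (simp add: density_op_def psd_def)
  then show ?thesis
    unfolding 1(1) 2(1) 3(1) 4(1) key_state_entry[OF \<tau>c 2(2) 4(2) 2(3) 4(3) 1(3) 3(3)]
      key_state_entry[OF \<tau>c 4(2) 2(2) 4(3) 2(3) 3(3) 1(3)] by auto
qed

text \<open>
  \<open>\<psi> u v e\<close> are the amplitudes of a purification in which Alice's index \<open>u = \<iota> (a, s)\<close> comprises
  the system \<open>a\<close> on which she acts in the protocol and the shield \<open>s\<close>, and likewise for Bob.
\<close>

lemma lopc_privacy_test:
  fixes \<psi> :: "nat \<Rightarrow> nat \<Rightarrow> nat \<Rightarrow> complex" and sA sB nU nV :: nat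
  assumes F: "lopc (a0, b0, e0) (a1, b1, e1) F"
    and bij: "bij_betw \<iota> ({..<a0} \<times> {..<sA}) {..<nU}" "bij_betw \<kappa> ({..<b0} \<times> {..<sB}) {..<nV}"
    and \<rho>: "\<rho> \<in> carrier_mat (a0 * b0 * e0) (a0 * b0 * e0)"
      "\<And>a a' b b' e e'. a < a0 \<Longrightarrow> a' < a0 \<Longrightarrow> b < b0 \<Longrightarrow> b' < b0 \<Longrightarrow> e < e0 \<Longrightarrow> e' < e0 \<Longrightarrow>
        \<rho> $$ ((a * b0 + b) * e0 + e, (a' * b0 + b') * e0 + e') =
        (\<Sum>s<sA. \<Sum>t<sB. \<psi> (\<iota> (a, s)) (\<kappa> (b, t)) e * cnj (\<psi> (\<iota> (a', s)) (\<kappa> (b', t)) e'))"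
    and M: "2 ^ l \<le> a1" "2 ^ l \<le> b1" and \<tau>: "density_op e1 \<tau>"
  obtains Z :: "(nat \<times> nat) set" and w :: "nat \<times> nat \<Rightarrow> nat \<times> nat \<Rightarrow> complex" where "finite Z"
    "\<And>f. sqnorm Z (\<lambda>z. \<Sum>s\<in>{..<nU} \<times> {..<nV}. w z s * f s) \<le> sqnorm ({..<nU} \<times> {..<nV}) f"
    "\<And>g h. sqnorm Z (\<lambda>z. \<Sum>s\<in>{..<nU} \<times> {..<nV}. w z s * (g (fst s) * h (snd s))) \<le>
       sqnorm {..<nU} g * sqnorm {..<nV} h / 2 ^ l"
    "1 - 2 * sqrt (2 * trace_dist (F \<rho>) (key_state a1 b1 l \<tau>)) \<le>
       (\<Sum>e<e0. sqnorm Z (\<lambda>z. \<Sum>s\<in>{..<nU} \<times> {..<nV}. w z s * \<psi> (fst s) (snd s) e))"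
proof -
  obtain N KA KB where R: "lopc_repr a0 b0 e0 a1 b1 e1 F N KA KB"
    using lopc_has_repr[OF F] by auto
  have e1: "e1 = e0 * N" by (rule lopc_reprD(1)[OF R])
  have "\<forall>c. \<exists>(r :: nat) g. c < N \<longrightarrow> (\<forall>i<a1. \<forall>i'<a1. \<forall>k<a0. \<forall>k'<a0.
      KA c i i' k k' = (\<Sum>x<r. g x i k * cnj (g x i' k')))"
    using lopc_reprD(2)[OF R] unfolding cp_kernel_def by meson
  then obtain rA :: "nat \<Rightarrow> nat" and gA where gA: "\<And>c i i' k k'. c < N \<Longrightarrow> i < a1 \<Longrightarrow> i' < a1 \<Longrightarrow> k < a0 \<Longrightarrow> k' < a0 \<Longrightarrow>
      KA c i i' k k' = (\<Sum>x<rA c. gA c x i k * cnj (gA c x i' k'))"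
    unfolding choice_iff by blast
  have "\<forall>c. \<exists>(r :: nat) g. c < N \<longrightarrow> (\<forall>i<b1. \<forall>i'<b1. \<forall>k<b0. \<forall>k'<b0.
      KB c i i' k k' = (\<Sum>x<r. g x i k * cnj (g x i' k')))"
    using lopc_reprD(3)[OF R] unfolding cp_kernel_def by meson
  then obtain rB :: "nat \<Rightarrow> nat" and gB where gB: "\<And>c i i' k k'. c < N \<Longrightarrow> i < b1 \<Longrightarrow> i' < b1 \<Longrightarrow> k < b0 \<Longrightarrow> k' < b0 \<Longrightarrow>
      KB c i i' k k' = (\<Sum>x<rB c. gB c x i k * cnj (gB c x i' k'))"
    unfolding choice_iff by blast
  define \<pi>A where "\<pi>A = inv_into ({..<a0} \<times> {..<sA}) \<iota>"
  define \<pi>B where "\<pi>B = inv_into ({..<b0} \<times> {..<sB}) \<kappa>"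
  have \<pi>A: "\<pi>A (\<iota> z) = z" if "z \<in> {..<a0} \<times> {..<sA}" for z
    using bij(1) that unfolding \<pi>A_def by (simp add: bij_betw_def inv_into_f_f)
  have \<pi>B: "\<pi>B (\<kappa> z) = z" if "z \<in> {..<b0} \<times> {..<sB}" for z
    using bij(2) that unfolding \<pi>B_def by (simp add: bij_betw_def inv_into_f_f)
  have sur: "\<exists>a s. u = \<iota> (a, s) \<and> a < a0 \<and> s < sA" if "u < nU" for u
    using bij(1) that unfolding bij_betw_def by (metis (no_types, lifting) SigmaE imageE lessThan_iff)
  have surB: "\<exists>a s. u = \<kappa> (a, s) \<and> a < b0 \<and> s < sB" if "u < nV" for u
    using bij(2) that unfolding bij_betw_def by (metis (no_types, lifting) SigmaE imageE lessThan_iff)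
  define IA where "IA c = {..<rA c} \<times> {..<sA}" for c
  define IB where "IB c = {..<rB c} \<times> {..<sB}" for c
  \<comment> \<open>The shield is sent to the environment: a Kraus index is a pair of an original
    index and a basis vector of the shield, and the operator is g tensored with that basis bra. Thus
    \<open>branch\<close> still contains the shields, on which the untwisting may act.\<close>
  define A where "A c x p u = (if snd (\<pi>A u) = snd x then gA c (fst x) p (fst (\<pi>A u)) else 0)" for c x p u
  define B where "B c y q v = (if snd (\<pi>B v) = snd y then gB c (fst y) q (fst (\<pi>B v)) else 0)" for c y q v
  have trA: "(\<Sum>p<a1. \<Sum>x\<in>IA c. A c x p (\<iota> (a, s)) * cnj (A c x p (\<iota> (a', s')))) = (if s = s' then \<Sum>p<a1. KA c p p a a' else 0)"
    if c: "c < N" and as: "a < a0" "s < sA" "a' < a0" "s' < sA" for c a s a' s'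
  proof -
    have "(\<Sum>x\<in>IA c. A c x p (\<iota> (a, s)) * cnj (A c x p (\<iota> (a', s')))) = (if s = s' then KA c p p a a' else 0)"
      if p: "p < a1" for p
    proof -
      have "(\<Sum>x\<in>IA c. A c x p (\<iota> (a, s)) * cnj (A c x p (\<iota> (a', s')))) =
         (\<Sum>x<rA c. \<Sum>r<sA. if r = s then if s = s' then gA c x p a * cnj (gA c x p a') else 0 else 0)"
        unfolding IA_def sum.cartesian_product'
        by (intro sum.cong refl) (auto simp: A_def \<pi>A as)
      then show ?thesis using as by (cases "s = s'") (simp_all add: gA[OF c p p as(1,3)])
    qed
    then show ?thesis by simp
  qed
  have trB: "(\<Sum>p<b1. \<Sum>x\<in>IB c. B c x p (\<kappa> (a, s)) * cnj (B c x p (\<kappa> (a', s')))) = (if s = s' then \<Sum>p<b1. KB c p p a a' else 0)"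
    if c: "c < N" and as: "a < b0" "s < sB" "a' < b0" "s' < sB" for c a s a' s'
  proof -
    have "(\<Sum>x\<in>IB c. B c x p (\<kappa> (a, s)) * cnj (B c x p (\<kappa> (a', s')))) = (if s = s' then KB c p p a a' else 0)"
      if p: "p < b1" for p
    proof -
      have "(\<Sum>x\<in>IB c. B c x p (\<kappa> (a, s)) * cnj (B c x p (\<kappa> (a', s')))) =
         (\<Sum>x<rB c. \<Sum>r<sB. if r = s then if s = s' then gB c x p a * cnj (gB c x p a') else 0 else 0)"
        unfolding IB_def sum.cartesian_product'
        by (intro sum.cong refl) (auto simp: B_def \<pi>B as)
      then show ?thesis using as by (cases "s = s'") (simp_all add: gB[OF c p p as(1,3)])
    qed
    then show ?thesis by simp
  qed
  interpret kraus_pair N a1 b1 nU nV IA IB A B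
  proof
    fix c show "finite (IA c)" "finite (IB c)" by (simp_all add: IA_def IB_def)
  next
    fix u u' v v' assume uv: "u < nU" "u' < nU" "v < nV" "v' < nV"
    obtain a s where u: "u = \<iota> (a, s)" "a < a0" "s < sA" using sur[OF uv(1)] by blast
    obtain a' s' where u': "u' = \<iota> (a', s')" "a' < a0" "s' < sA" using sur[OF uv(2)] by blast
    obtain b t where v: "v = \<kappa> (b, t)" "b < b0" "t < sB" using surB[OF uv(3)] by blast
    obtain b' t' where v': "v' = \<kappa> (b', t')" "b' < b0" "t' < sB" using surB[OF uv(4)] by blast
    have eq: "u = u' \<longleftrightarrow> a = a' \<and> s = s'" "v = v' \<longleftrightarrow> b = b' \<and> t = t'"
      unfolding u(1) u'(1) v(1) v'(1)
      using inj_on_eq_iff[OF bij_betw_imp_inj_on[OF bij(1)], of "(a, s)" "(a', s')"] u(2,3) u'(2,3)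
        inj_on_eq_iff[OF bij_betw_imp_inj_on[OF bij(2)], of "(b, t)" "(b', t')"] v(2,3) v'(2,3)
      by simp_all
    have "(\<Sum>c<N. (\<Sum>p<a1. \<Sum>x\<in>IA c. A c x p u * cnj (A c x p u')) * (\<Sum>q<b1. \<Sum>y\<in>IB c. B c y q v * cnj (B c y q v'))) =
       (\<Sum>c<N. if s = s' \<and> t = t' then (\<Sum>p<a1. KA c p p a a') * (\<Sum>q<b1. KB c q q b b') else 0)"
      unfolding u(1) u'(1) v(1) v'(1)
      by (intro sum.cong refl) (simp add: trA trB u(2,3) u'(2,3) v(2,3) v'(2,3))
    also have "\<dots> = (if u = u' \<and> v = v' then 1 else 0)"
      using lopc_reprD(4)[OF R u(2) u'(2) v(2) v'(2)] unfolding eq by (cases "s = s' \<and> t = t'") auto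
    finally show "(\<Sum>c<N. (\<Sum>p<a1. \<Sum>x\<in>IA c. A c x p u * cnj (A c x p u')) *
        (\<Sum>q<b1. \<Sum>y\<in>IB c. B c y q v * cnj (B c y q v'))) = (if u = u' \<and> v = v' then 1 else 0)" .
  qed
  have branch: "branch c p q f ((x, s), (y, t)) =
      (\<Sum>(a, b)\<in>{..<a0} \<times> {..<b0}. gA c x p a * gB c y q b * f (\<iota> (a, s), \<kappa> (b, t)))"
    if st: "s < sA" "t < sB" for c p q f x s y t
  proof -
    have "branch c p q f ((x, s), (y, t)) = (\<Sum>u<nU. \<Sum>v<nV. A c (x, s) p u * B c (y, t) q v * f (u, v))"
      unfolding branch_def by (simp add: sum.cartesian_product case_prod_unfold)
    also have "\<dots> = (\<Sum>z\<in>{..<a0} \<times> {..<sA}. \<Sum>z'\<in>{..<b0} \<times> {..<sB}.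
        A c (x, s) p (\<iota> z) * B c (y, t) q (\<kappa> z') * f (\<iota> z, \<kappa> z'))"
      by (simp only: sum.reindex_bij_betw[OF bij(1), symmetric] sum.reindex_bij_betw[OF bij(2), symmetric])
    also have "\<dots> = (\<Sum>a<a0. \<Sum>s'<sA. \<Sum>b<b0. \<Sum>t'<sB. if s' = s then if t' = t then
        gA c x p a * gB c y q b * f (\<iota> (a, s), \<kappa> (b, t)) else 0 else 0)"
      unfolding sum.cartesian_product'
      by (intro sum.cong refl) (auto simp: A_def B_def \<pi>A \<pi>B)
    also have "\<dots> = (\<Sum>a<a0. \<Sum>b<b0. gA c x p a * gB c y q b * f (\<iota> (a, s), \<kappa> (b, t)))"
    proof (rule sum.cong[OF refl])
      fix a
      have "(\<Sum>s'<sA. \<Sum>b<b0. \<Sum>t'<sB. if s' = s then if t' = t then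
          gA c x p a * gB c y q b * f (\<iota> (a, s), \<kappa> (b, t)) else 0 else 0) =
        (\<Sum>s'<sA. if s' = s then \<Sum>b<b0. gA c x p a * gB c y q b * f (\<iota> (a, s), \<kappa> (b, t)) else 0)"
        using st by (intro sum.cong refl) auto
      then show "(\<Sum>s'<sA. \<Sum>b<b0. \<Sum>t'<sB. if s' = s then if t' = t then
          gA c x p a * gB c y q b * f (\<iota> (a, s), \<kappa> (b, t)) else 0 else 0) =
        (\<Sum>b<b0. gA c x p a * gB c y q b * f (\<iota> (a, s), \<kappa> (b, t)))" using st by simp
    qed
    finally show ?thesis by (simp add: sum.cartesian_product)
  qed
  define \<phi> where "\<phi> e s = \<psi> (fst s) (snd s) e" for e and s :: "nat \<times> nat"
  \<comment> \<open>Tracing the Kraus indices out of the branches, and with them the shields, must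
    give back the output of \<open>F\<close>; what has to be done is to reorder the sums.\<close>
  have \<Omega>: "F \<rho> $$ ((p * b1 + q) * (e0 * N) + (e * N + c), (p' * b1 + q') * (e0 * N) + (e' * N + c')) =
        (if c = c' then \<Sum>k\<in>KK c. branch c p q (\<phi> e) k * cnj (branch c p' q' (\<phi> e') k) else 0)"
    if b: "p < a1" "p' < a1" "q < b1" "q' < b1" "e < e0" "e' < e0" "c < N" "c' < N" for p p' q q' e e' c c'
  proof -
    let ?t = "\<lambda>a a' b b' x y s t. gA c x p a * cnj (gA c x p' a') * (gB c y q b * cnj (gB c y q' b')) *
        (\<psi> (\<iota> (a, s)) (\<kappa> (b, t)) e * cnj (\<psi> (\<iota> (a', s)) (\<kappa> (b', t)) e'))"
    have "(\<Sum>(a, a', b, b')\<in>quad a0 b0. KA c p p' a a' * KB c q q' b b' *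
          \<rho> $$ ((a * b0 + b) * e0 + e, (a' * b0 + b') * e0 + e')) =
        (\<Sum>(a, a', b, b')\<in>quad a0 b0. \<Sum>(x, s, y, t)\<in>{..<rA c} \<times> {..<sA} \<times> {..<rB c} \<times> {..<sB}. ?t a a' b b' x y s t)"
    proof (rule sum.cong[OF refl], clarify)
      fix a a' k k' assume lt: "a < a0" "a' < a0" "k < b0" "k' < b0"
      show "KA c p p' a a' * KB c q q' k k' * \<rho> $$ ((a * b0 + k) * e0 + e, (a' * b0 + k') * e0 + e') =
        (\<Sum>(x, s, y, t)\<in>{..<rA c} \<times> {..<sA} \<times> {..<rB c} \<times> {..<sB}. ?t a a' k k' x y s t)"
        unfolding gA[OF b(7,1,2) lt(1,2)] gB[OF b(7,3,4) lt(3,4)] \<rho>(2)[OF lt b(5,6)]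
        by (simp only: sum_product, simp only: sum_distrib_right sum_distrib_left sum.cartesian_product)
    qed
    also have "\<dots> = (\<Sum>((a, a', b, b'), (x, s, y, t))\<in>quad a0 b0 \<times> ({..<rA c} \<times> {..<sA} \<times> {..<rB c} \<times> {..<sB}).
        ?t a a' b b' x y s t)"
      by (simp add: sum.cartesian_product case_prod_unfold)
    also have "\<dots> = (\<Sum>(((x, s), (y, t)), ((a, b), (a', b')))\<in>KK c \<times> (({..<a0} \<times> {..<b0}) \<times> ({..<a0} \<times> {..<b0})).
        ?t a a' b b' x y s t)"
      unfolding IA_def IB_def
      by (rule sum.reindex_bij_witness[where
            i = "\<lambda>(((x, s), (y, t)), ((a, b), (a', b'))). ((a, a', b, b'), (x, s, y, t))" and
            j = "\<lambda>((a, a', b, b'), (x, s, y, t)). (((x, s), (y, t)), ((a, b), (a', b')))"]) auto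
    also have "\<dots> = (\<Sum>((x, s), (y, t))\<in>KK c. \<Sum>((a, b), (a', b'))\<in>({..<a0} \<times> {..<b0}) \<times> ({..<a0} \<times> {..<b0}).
        ?t a a' b b' x y s t)"
      by (simp add: sum.cartesian_product case_prod_unfold)
    also have "\<dots> = (\<Sum>k\<in>KK c. branch c p q (\<phi> e) k * cnj (branch c p' q' (\<phi> e') k))"
    proof (rule sum.cong[OF refl], clarify)
      fix x s y t assume "(x, s) \<in> IA c" "(y, t) \<in> IB c"
      then have st: "s < sA" "t < sB" by (auto simp: IA_def IB_def)
      show "(\<Sum>((a, b), (a', b'))\<in>({..<a0} \<times> {..<b0}) \<times> ({..<a0} \<times> {..<b0}). ?t a a' b b' x y s t) =
        branch c p q (\<phi> e) ((x, s), (y, t)) * cnj (branch c p' q' (\<phi> e') ((x, s), (y, t)))"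
        unfolding branch[OF st] cnj_sum sum_product
        by (simp add: sum.cartesian_product case_prod_unfold \<phi>_def mult_ac)
    qed
    finally show ?thesis
      using lopc_reprD(6)[OF R \<rho>(1) b] unfolding e1 by (simp only:)
  qed
  have Fc: "F \<rho> \<in> carrier_mat (a1 * b1 * (e0 * N)) (a1 * b1 * (e0 * N))"
    using lopc_reprD(5)[OF R \<rho>(1)] unfolding e1 .
  have \<tau>': "density_op (e0 * N) \<tau>" using \<tau> unfolding e1 .
  then have \<tau>c: "\<tau> \<in> carrier_mat (e0 * N) (e0 * N)" by (simp add: density_op_def)
  have block: "key_state a1 b1 l \<tau> $$ ((i * b1 + i) * (e0 * N) + (e * N + c), (i * b1 + i) * (e0 * N) + (e' * N + c)) =
        \<tau> $$ (e * N + c, e' * N + c) / of_nat (2 ^ l)" if "i < 2 ^ l" "e < e0" "e' < e0" "c < N" for i e e' c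
    using key_state_entry[OF \<tau>c, of i a1 i i b1 i "e * N + c" "e' * N + c" l] that M by (simp add: enc_less)
  obtain Z where Z: "\<And>c i y. c < N \<Longrightarrow> i < 2 ^ l \<Longrightarrow> sqnorm {..<e0} (\<lambda>f. \<Sum>k\<in>KK c. Z c i k f * y k) \<le> sqnorm (KK c) y"
    and succ: "1 - 2 * sqrt (2 * trace_dist (F \<rho>) (key_state a1 b1 l \<tau>)) \<le>
       (\<Sum>e<e0. sqnorm ({..<N} \<times> {..<e0}) (\<lambda>z. \<Sum>s\<in>UV. test_op (2 ^ l) Z z s * \<phi> e s))"
    by (rule test_op_success[OF _ M Fc \<Omega> \<tau>' key_state_carrier[OF \<tau>c] key_state_hermitian[OF \<tau>'] block])
      (rule that | assumption | simp)+
  show ?thesis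
  proof (rule that)
    show "finite ({..<N} \<times> {..<e0})" by simp
    show "sqnorm ({..<N} \<times> {..<e0}) (\<lambda>z. \<Sum>s\<in>UV. test_op (2 ^ l) Z z s * f s) \<le> sqnorm UV f" for f
      by (rule test_op_contraction[OF Z _ M]) simp_all
    show "sqnorm ({..<N} \<times> {..<e0}) (\<lambda>z. \<Sum>s\<in>UV. test_op (2 ^ l) Z z s * (g (fst s) * h (snd s))) \<le>
       sqnorm {..<nU} g * sqnorm {..<nV} h / 2 ^ l" for g h
      using test_op_product[OF Z _ M, where g = g and h = h] by simp
    show "1 - 2 * sqrt (2 * trace_dist (F \<rho>) (key_state a1 b1 l \<tau>)) \<le>
       (\<Sum>e<e0. sqnorm ({..<N} \<times> {..<e0}) (\<lambda>z. \<Sum>s\<in>UV. test_op (2 ^ l) Z z s * \<psi> (fst s) (snd s) e))"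
      using succ unfolding \<phi>_def .
  qed
qed

text \<open>Both states are fed to the test vector by vector: \<rho> by Eve's index in its
  purification, \<sigma> by product vectors. The squared norms of the latter sum to the trace 1, so
  the acceptance probability of \<sigma> is at most \<open>q\<close>.\<close>

lemma rel_ent_entanglement_ge:
  fixes w :: "'z \<Rightarrow> nat \<times> nat \<Rightarrow> complex" and \<psi> :: "nat \<Rightarrow> nat \<Rightarrow> nat \<Rightarrow> complex"
  assumes \<rho>: "density_op (nU * nV) \<rho>"
      "\<And>u u' v v'. u < nU \<Longrightarrow> u' < nU \<Longrightarrow> v < nV \<Longrightarrow> v' < nV \<Longrightarrow>
         \<rho> $$ (u * nV + v, u' * nV + v') = (\<Sum>e<e0. \<psi> u v e * cnj (\<psi> u' v' e))"
    and Z: "finite Z"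
      "\<And>f. sqnorm Z (\<lambda>z. \<Sum>s\<in>{..<nU} \<times> {..<nV}. w z s * f s) \<le> sqnorm ({..<nU} \<times> {..<nV}) f"
      "\<And>g h. sqnorm Z (\<lambda>z. \<Sum>s\<in>{..<nU} \<times> {..<nV}. w z s * (g (fst s) * h (snd s))) \<le>
         sqnorm {..<nU} g * sqnorm {..<nV} h * q"
      "1 - \<epsilon> \<le> (\<Sum>e<e0. sqnorm Z (\<lambda>z. \<Sum>s\<in>{..<nU} \<times> {..<nV}. w z s * \<psi> (fst s) (snd s) e))"
    and c: "1 \<le> c"
  shows "ereal ((1 - 2 * (\<epsilon> + c * q)) * log 2 c - 2) \<le> rel_ent_entanglement nU nV \<rho>"
  unfolding rel_ent_entanglement_def
proof (rule INF_greatest)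
  fix \<sigma> assume "\<sigma> \<in> {\<sigma>. separable_state nU nV \<sigma>}"
  then have \<sigma>: "separable_state nU nV \<sigma>" by simp
  let ?n = "nU * nV" and ?UV = "{..<nU} \<times> {..<nV}"
  define w' where "w' z i = w z (i div nV, i mod nV)" for z i
  have sum_w': "(\<Sum>i<?n. w' z i * x i) = (\<Sum>s\<in>?UV. w z s * x (fst s * nV + snd s))" for z x
    unfolding sum_enc w'_def by (simp add: sum.cartesian_product case_prod_unfold)
  have sq: "sqnorm {..<?n} x = sqnorm ?UV (\<lambda>s. x (fst s * nV + snd s))" for x
    unfolding sqnorm_def sum_enc by (simp add: sum.cartesian_product case_prod_unfold)
  have quad: "Re (\<Sum>z\<in>Z. \<Sum>i<?n. \<Sum>j<?n. w' z i * X $$ (i, j) * cnj (w' z j)) =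
      (\<Sum>k\<in>K. sqnorm Z (\<lambda>z. \<Sum>s\<in>?UV. w z s * f k (fst s) (snd s)))"
    if X: "\<And>u u' v v'. u < nU \<Longrightarrow> u' < nU \<Longrightarrow> v < nV \<Longrightarrow> v' < nV \<Longrightarrow>
         X $$ (u * nV + v, u' * nV + v') = (\<Sum>k\<in>K. f k u v * cnj (f k u' v'))" for X f and K :: "'k set"
  proof -
    have X': "X $$ (i, j) = (\<Sum>k\<in>K. f k (i div nV) (i mod nV) * cnj (f k (j div nV) (j mod nV)))"
      if "i < ?n" "j < ?n" for i j
      using X[OF enc_bounds(1)[OF that(1)] enc_bounds(1)[OF that(2)] enc_bounds(2)[OF that(1)] enc_bounds(2)[OF that(2)]]
      by simp
    have "(\<Sum>i<?n. \<Sum>j<?n. w' z i * X $$ (i, j) * cnj (w' z j)) =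
       complex_of_real (\<Sum>k\<in>K. (cmod (\<Sum>s\<in>?UV. w z s * f k (fst s) (snd s)))\<^sup>2)" for z
    proof -
      have "(\<Sum>i<?n. \<Sum>j<?n. w' z i * X $$ (i, j) * cnj (w' z j)) =
        (\<Sum>i<?n. \<Sum>j<?n. cnj (cnj (w' z i)) *
           (\<Sum>k\<in>K. f k (i div nV) (i mod nV) * cnj (f k (j div nV) (j mod nV))) * cnj (w' z j))"
        by (intro sum.cong refl) (simp add: X')
      also have "\<dots> = complex_of_real (\<Sum>k\<in>K. (cmod (\<Sum>j<?n. cnj (f k (j div nV) (j mod nV)) * cnj (w' z j)))\<^sup>2)"
        by (rule gram_quadratic_form)
      also have "(\<lambda>k. cmod (\<Sum>j<?n. cnj (f k (j div nV) (j mod nV)) * cnj (w' z j))) =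
          (\<lambda>k. cmod (\<Sum>j<?n. w' z j * f k (j div nV) (j mod nV)))"
        by (rule ext, subst complex_mod_cnj[symmetric]) (simp add: mult.commute)
      also have "(\<lambda>k. cmod (\<Sum>j<?n. w' z j * f k (j div nV) (j mod nV))) =
          (\<lambda>k. cmod (\<Sum>s\<in>?UV. w z s * f k (fst s) (snd s)))"
        unfolding sum_w' by (intro ext arg_cong[where f = cmod] sum.cong refl) auto
      finally show ?thesis .
    qed
    then have "Re (\<Sum>z\<in>Z. \<Sum>i<?n. \<Sum>j<?n. w' z i * X $$ (i, j) * cnj (w' z j)) =
       (\<Sum>z\<in>Z. \<Sum>k\<in>K. (cmod (\<Sum>s\<in>?UV. w z s * f k (fst s) (snd s)))\<^sup>2)" by simp
    then show ?thesis unfolding sqnorm_def by (simp only: sum.swap[of _ Z K])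
  qed
  obtain R :: "(nat \<times> nat \<times> nat) set" and g h where R: "finite R"
    "\<And>a a' b b'. a < nU \<Longrightarrow> a' < nU \<Longrightarrow> b < nV \<Longrightarrow> b' < nV \<Longrightarrow>
      \<sigma> $$ (a * nV + b, a' * nV + b') = (\<Sum>r\<in>R. (g r a * h r b) * cnj (g r a' * h r b'))"
    using separable_gram[OF \<sigma>] by blast
  have \<sigma>d: "density_op ?n \<sigma>" by (rule separable_density[OF \<sigma>])
  have tr: "(\<Sum>r\<in>R. sqnorm {..<nU} (g r) * sqnorm {..<nV} (h r)) = 1"
  proof -
    have "mtrace \<sigma> = (\<Sum>u<nU. \<Sum>v<nV. \<Sum>r\<in>R. (g r u * h r v) * cnj (g r u * h r v))"
      using \<sigma>d by (auto simp: mtrace_def density_op_def sum_enc R(2))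
    also have "\<dots> = (\<Sum>r\<in>R. \<Sum>u<nU. \<Sum>v<nV. (g r u * cnj (g r u)) * (h r v * cnj (h r v)))"
      by (subst sum_rotate) (simp add: mult_ac)
    also have "\<dots> = complex_of_real (\<Sum>r\<in>R. sqnorm {..<nU} (g r) * sqnorm {..<nV} (h r))"
      by (simp add: of_real_sqnorm sum_product)
    finally show ?thesis using \<sigma>d by (metis density_op_def of_real_eq_1_iff)
  qed
  show "ereal ((1 - 2 * (\<epsilon> + c * q)) * log 2 c - 2) \<le> rel_entropy \<rho> \<sigma>"
  proof (rule rel_entropy_ge_test[OF \<rho>(1) \<sigma>d Z(1) _ _ _ c, where w = w'])
    show "sqnorm Z (\<lambda>z. \<Sum>i<?n. w' z i * x i) \<le> sqnorm {..<?n} x" for x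
      unfolding sum_w' sq by (rule Z(2))
    show "1 - \<epsilon> \<le> Re (\<Sum>z\<in>Z. \<Sum>i<?n. \<Sum>j<?n. w' z i * \<rho> $$ (i, j) * cnj (w' z j))"
      using Z(4) quad[OF \<rho>(2)] by simp
    have "Re (\<Sum>z\<in>Z. \<Sum>i<?n. \<Sum>j<?n. w' z i * \<sigma> $$ (i, j) * cnj (w' z j)) =
        (\<Sum>r\<in>R. sqnorm Z (\<lambda>z. \<Sum>s\<in>?UV. w z s * (g r (fst s) * h r (snd s))))"
      by (rule quad[OF R(2)])
    also have "\<dots> \<le> (\<Sum>r\<in>R. sqnorm {..<nU} (g r) * sqnorm {..<nV} (h r) * q)"
      by (intro sum_mono Z(3))
    also have "\<dots> = q" using tr by (simp flip: sum_distrib_right)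
    finally show "Re (\<Sum>z\<in>Z. \<Sum>i<?n. \<Sum>j<?n. w' z i * \<sigma> $$ (i, j) * cnj (w' z j)) \<le> q" .
  qed
qed

section \<open>Tensor powers of a purification\<close>

text \<open>The amplitudes of the n-fold tensor power, with the newest factor in the least
  significant digits, as in \<open>tensor_pow2\<close> and \<open>tensor_pow3\<close>.\<close>

fun amplitude_pow :: "nat \<Rightarrow> nat \<Rightarrow> nat \<Rightarrow> (nat \<Rightarrow> nat \<Rightarrow> nat \<Rightarrow> complex) \<Rightarrow> nat \<Rightarrow> nat \<Rightarrow> nat \<Rightarrow> nat \<Rightarrow> complex" where
  "amplitude_pow dU dV dE \<psi> 0 u v e = 1"
| "amplitude_pow dU dV dE \<psi> (Suc n) u v e =
     amplitude_pow dU dV dE \<psi> n (u div dU) (v div dV) (e div dE) * \<psi> (u mod dU) (v mod dV) (e mod dE)"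

text \<open>The index of \<open>(A \<otimes> A')\<^sup>n\<close> that corresponds to the indices \<open>a\<close> of \<open>A\<^sup>n\<close> and \<open>s\<close> of \<open>A'\<^sup>n\<close>.\<close>

fun interleave :: "nat \<Rightarrow> nat \<Rightarrow> nat \<Rightarrow> nat \<times> nat \<Rightarrow> nat" where
  "interleave d d' 0 z = 0"
| "interleave d d' (Suc n) z =
     interleave d d' n (fst z div d, snd z div d') * (d * d') + (fst z mod d * d' + snd z mod d')"

text \<open>Injectivity follows by comparing digits, surjectivity then by counting.\<close>

lemma bij_interleave: "bij_betw (interleave d d' n) ({..<d ^ n} \<times> {..<d' ^ n}) {..<(d * d') ^ n}"
proof -
  have less: "interleave d d' n z < (d * d') ^ n" if "z \<in> {..<d ^ n} \<times> {..<d' ^ n}" for z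
    using that
  proof (induction n arbitrary: z)
    case (Suc n)
    obtain a s where z: "z = (a, s)" by (cases z)
    have "a < d ^ n * d" "s < d' ^ n * d'" using Suc.prems unfolding z by (simp_all add: mult.commute)
    note b = enc_bounds[OF this(1)] enc_bounds[OF this(2)]
    have "interleave d d' n (a div d, s div d') < (d * d') ^ n" using b by (intro Suc.IH) auto
    from enc_less[OF this enc_less[OF b(2,4)]] show ?case by (simp add: z mult.commute)
  qed simp
  have "inj_on (interleave d d' n) ({..<d ^ n} \<times> {..<d' ^ n})"
  proof (induction n)
    case (Suc n)
    show ?case
    proof (rule inj_onI)
      fix y z assume y: "y \<in> {..<d ^ Suc n} \<times> {..<d' ^ Suc n}" and z: "z \<in> {..<d ^ Suc n} \<times> {..<d' ^ Suc n}"
        and eq: "interleave d d' (Suc n) y = interleave d d' (Suc n) z"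
      obtain a s where y': "y = (a, s)" by (cases y)
      obtain a' s' where z': "z = (a', s')" by (cases z)
      have "a < d ^ n * d" "s < d' ^ n * d'" "a' < d ^ n * d" "s' < d' ^ n * d'"
        using y z unfolding y' z' by (simp_all add: mult.commute)
      note b = enc_bounds[OF this(1)] enc_bounds[OF this(2)] enc_bounds[OF this(3)] enc_bounds[OF this(4)]
      have "interleave d d' n (a div d, s div d') = interleave d d' n (a' div d, s' div d') \<and>
          a mod d * d' + s mod d' = a' mod d * d' + s' mod d'"
        using eq unfolding y' z' by (simp add: enc_eq_iff enc_less b)
      then have "(a div d, s div d') = (a' div d, s' div d')" "a mod d = a' mod d" "s mod d' = s' mod d'"
        using inj_onD[OF Suc.IH, of "(a div d, s div d')" "(a' div d, s' div d')"] b
        by (auto simp: enc_eq_iff)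
      then show "y = z" unfolding y' z' by (metis Pair_inject div_mult_mod_eq)
    qed
  qed (simp add: inj_on_def)
  moreover have "interleave d d' n ` ({..<d ^ n} \<times> {..<d' ^ n}) = {..<(d * d') ^ n}"
  proof (rule card_subset_eq)
    show "card (interleave d d' n ` ({..<d ^ n} \<times> {..<d' ^ n})) = card {..<(d * d') ^ n}"
      by (simp add: card_image[OF calculation] card_cartesian_product power_mult_distrib)
  qed (use less in auto)
  ultimately show ?thesis by (simp add: bij_betw_def)
qed

lemma tensor_pow2_carrier: "tensor_pow2 dA dB \<rho> n \<in> carrier_mat (dA ^ n * dB ^ n) (dA ^ n * dB ^ n)"
proof (cases n)
  case (Suc k)
  then show ?thesis using swap_mid_carrier[of "dA ^ k" "dB ^ k" dA dB] by (simp add: mult_ac)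
qed simp

lemma tensor_pow2_purification:
  assumes \<rho>: "\<rho> \<in> carrier_mat (dU * dV) (dU * dV)"
      "\<And>u u' v v'. u < dU \<Longrightarrow> u' < dU \<Longrightarrow> v < dV \<Longrightarrow> v' < dV \<Longrightarrow>
         \<rho> $$ (u * dV + v, u' * dV + v') = (\<Sum>e<dE. \<psi> u v e * cnj (\<psi> u' v' e))"
    and "u < dU ^ n" "u' < dU ^ n" "v < dV ^ n" "v' < dV ^ n"
  shows "tensor_pow2 dU dV \<rho> n $$ (u * dV ^ n + v, u' * dV ^ n + v') =
    (\<Sum>e<dE ^ n. amplitude_pow dU dV dE \<psi> n u v e * cnj (amplitude_pow dU dV dE \<psi> n u' v' e))"
  using assms(3-6)
proof (induction n arbitrary: u u' v v')
  case (Suc n)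
  let ?\<psi> = "amplitude_pow dU dV dE \<psi> n"
  have lt: "u < dU ^ n * dU" "u' < dU ^ n * dU" "v < dV ^ n * dV" "v' < dV ^ n * dV"
    using Suc.prems by (simp_all add: mult.commute)
  obtain a c where u: "u = a * dU + c" "a < dU ^ n" "c < dU"
    using lt(1) by (rule enc_dec)
  obtain a' c' where u': "u' = a' * dU + c'" "a' < dU ^ n" "c' < dU"
    using lt(2) by (rule enc_dec)
  obtain b d where v: "v = b * dV + d" "b < dV ^ n" "d < dV"
    using lt(3) by (rule enc_dec)
  obtain b' d' where v': "v' = b' * dV + d'" "b' < dV ^ n" "d' < dV"
    using lt(4) by (rule enc_dec)
  have "tensor_pow2 dU dV \<rho> (Suc n) $$ (u * dV ^ Suc n + v, u' * dV ^ Suc n + v') =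
      tensor_pow2 dU dV \<rho> n $$ (a * dV ^ n + b, a' * dV ^ n + b') * \<rho> $$ (c * dV + d, c' * dV + d')"
    unfolding u(1) u'(1) v(1) v'(1) tensor_pow2.simps power_Suc2
      swap_mid_entry[OF u(2) u'(2) v(2) v'(2) u(3) u'(3) v(3) v'(3)]
    by (rule kron_entry[OF tensor_pow2_carrier \<rho>(1)]) (use u u' v v' in \<open>simp_all add: enc_less\<close>)
  also have "\<dots> = (\<Sum>e<dE ^ n. \<Sum>f<dE. (?\<psi> a b e * cnj (?\<psi> a' b' e)) * (\<psi> c d f * cnj (\<psi> c' d' f)))"
    unfolding Suc.IH[OF u(2) u'(2) v(2) v'(2)] \<rho>(2)[OF u(3) u'(3) v(3) v'(3)] sum_product ..
  also have "\<dots> = (\<Sum>e<dE ^ Suc n. amplitude_pow dU dV dE \<psi> (Suc n) u v e *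
      cnj (amplitude_pow dU dV dE \<psi> (Suc n) u' v' e))"
    unfolding power_Suc2 sum_enc using u u' v v' by (intro sum.cong refl) (simp add: mult_ac)
  finally show ?case .
qed simp

lemma tensor_pow3_carrier:
  "tensor_pow3 dA dB dE \<rho> n \<in> carrier_mat (dA ^ n * dB ^ n * dE ^ n) (dA ^ n * dB ^ n * dE ^ n)"
proof (cases n)
  case (Suc k)
  then show ?thesis using swap_mid_carrier[of "dA ^ k * dA * dB ^ k" "dE ^ k" dB dE] by (simp add: mult_ac)
qed simp

lemma tensor_pow3_Suc_entry:
  assumes \<rho>: "\<rho> \<in> carrier_mat (dA * dB * dE) (dA * dB * dE)"
    and lt: "a < dA ^ n" "a' < dA ^ n" "b < dB ^ n" "b' < dB ^ n" "e < dE ^ n" "e' < dE ^ n"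
      "x < dA" "x' < dA" "y < dB" "y' < dB" "z < dE" "z' < dE"
  shows "tensor_pow3 dA dB dE \<rho> (Suc n) $$
      (((a * dA + x) * (dB ^ n * dB) + (b * dB + y)) * (dE ^ n * dE) + (e * dE + z),
       ((a' * dA + x') * (dB ^ n * dB) + (b' * dB + y')) * (dE ^ n * dE) + (e' * dE + z')) =
    tensor_pow3 dA dB dE \<rho> n $$ ((a * dB ^ n + b) * dE ^ n + e, (a' * dB ^ n + b') * dE ^ n + e') *
    \<rho> $$ ((x * dB + y) * dE + z, (x' * dB + y') * dE + z')"
proof -
  let ?X = "tensor_pow3 dA dB dE \<rho> n"
  \<comment> \<open>The inner regrouping orders the factors as A^n, A, B^n, E^n, B, E; the outer one
    then exchanges E^n with B. The numbered equations rebracket the indices accordingly.\<close>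
  let ?Y = "swap_mid (dA ^ n) (dB ^ n * dE ^ n) dA (dB * dE) (kron ?X \<rho>)"
  have X: "?X \<in> carrier_mat (dA ^ n * (dB ^ n * dE ^ n)) (dA ^ n * (dB ^ n * dE ^ n))"
    using tensor_pow3_carrier by (simp add: mult.assoc)
  have \<rho>': "\<rho> \<in> carrier_mat (dA * (dB * dE)) (dA * (dB * dE))" using \<rho> by (simp add: mult.assoc)
  have 1: "((a * dA + x) * (dB ^ n * dB) + (b * dB + y)) * (dE ^ n * dE) + (e * dE + z) =
      (((a * dA + x) * dB ^ n + b) * dB + y) * (dE ^ n * dE) + (e * dE + z)" for a x b y e z
    by (simp add: algebra_simps)
  have 2: "(((a * dA + x) * dB ^ n + b) * dE ^ n + e) * (dB * dE) + (y * dE + z) =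
      (a * dA + x) * ((dB ^ n * dE ^ n) * (dB * dE)) + ((b * dE ^ n + e) * (dB * dE) + (y * dE + z))" for a x b y e z
    by (simp add: algebra_simps)
  have 3: "(a * d + b) * d' + e = a * (d * d') + (b * d' + e)" for a b d d' e :: nat
    by (simp add: algebra_simps)
  have "tensor_pow3 dA dB dE \<rho> (Suc n) $$
      (((a * dA + x) * (dB ^ n * dB) + (b * dB + y)) * (dE ^ n * dE) + (e * dE + z),
       ((a' * dA + x') * (dB ^ n * dB) + (b' * dB + y')) * (dE ^ n * dE) + (e' * dE + z')) =
     ?Y $$ ((((a * dA + x) * dB ^ n + b) * dE ^ n + e) * (dB * dE) + (y * dE + z),
       (((a' * dA + x') * dB ^ n + b') * dE ^ n + e') * (dB * dE) + (y' * dE + z'))"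
    unfolding 1 tensor_pow3.simps
    by (rule swap_mid_entry) (simp_all only: enc_less lt)
  also have "\<dots> = kron ?X \<rho> $$ ((a * (dB ^ n * dE ^ n) + (b * dE ^ n + e)) * (dA * (dB * dE)) + (x * (dB * dE) + (y * dE + z)),
       (a' * (dB ^ n * dE ^ n) + (b' * dE ^ n + e')) * (dA * (dB * dE)) + (x' * (dB * dE) + (y' * dE + z')))"
    unfolding 2 by (rule swap_mid_entry) (simp_all only: enc_less lt)
  also have "\<dots> = ?X $$ (a * (dB ^ n * dE ^ n) + (b * dE ^ n + e), a' * (dB ^ n * dE ^ n) + (b' * dE ^ n + e')) *
      \<rho> $$ (x * (dB * dE) + (y * dE + z), x' * (dB * dE) + (y' * dE + z'))"
    by (rule kron_entry[OF X \<rho>']) (simp_all only: enc_less lt)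
  finally show ?thesis unfolding 3 .
qed

text \<open>The power of the tripartite state orders Alice's systems as A^n with the shields traced
  out, while the amplitudes are those of (A A')^n. \<open>interleave\<close> mediates between the
  two orders, one digit in each induction step.\<close>

lemma tensor_pow3_purification:
  assumes \<rho>: "\<rho> \<in> carrier_mat (dA * dB * dE) (dA * dB * dE)"
      "\<And>a a' b b' e e'. a < dA \<Longrightarrow> a' < dA \<Longrightarrow> b < dB \<Longrightarrow> b' < dB \<Longrightarrow> e < dE \<Longrightarrow> e' < dE \<Longrightarrow>
        \<rho> $$ ((a * dB + b) * dE + e, (a' * dB + b') * dE + e') =
        (\<Sum>s<dA'. \<Sum>t<dB'. \<psi> (a * dA' + s) (b * dB' + t) e * cnj (\<psi> (a' * dA' + s) (b' * dB' + t) e'))"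
    and "a < dA ^ n" "a' < dA ^ n" "b < dB ^ n" "b' < dB ^ n" "e < dE ^ n" "e' < dE ^ n"
  defines "\<Phi> \<equiv> amplitude_pow (dA * dA') (dB * dB') dE \<psi>"
  shows "tensor_pow3 dA dB dE \<rho> n $$ ((a * dB ^ n + b) * dE ^ n + e, (a' * dB ^ n + b') * dE ^ n + e') =
    (\<Sum>s<dA' ^ n. \<Sum>t<dB' ^ n. \<Phi> n (interleave dA dA' n (a, s)) (interleave dB dB' n (b, t)) e *
       cnj (\<Phi> n (interleave dA dA' n (a', s)) (interleave dB dB' n (b', t)) e'))"
  using assms(3-8)
proof (induction n arbitrary: a a' b b' e e')
  case 0
  then show ?case by (simp add: \<Phi>_def)
next
  case (Suc n)
  have lt: "a < dA ^ n * dA" "a' < dA ^ n * dA" "b < dB ^ n * dB" "b' < dB ^ n * dB"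
      "e < dE ^ n * dE" "e' < dE ^ n * dE"
    using Suc.prems by (simp_all add: mult.commute)
  obtain a1 x where a: "a = a1 * dA + x" "a1 < dA ^ n" "x < dA"
    using lt(1) by (rule enc_dec)
  obtain a1' x' where a': "a' = a1' * dA + x'" "a1' < dA ^ n" "x' < dA"
    using lt(2) by (rule enc_dec)
  obtain b1 y where b: "b = b1 * dB + y" "b1 < dB ^ n" "y < dB"
    using lt(3) by (rule enc_dec)
  obtain b1' y' where b': "b' = b1' * dB + y'" "b1' < dB ^ n" "y' < dB"
    using lt(4) by (rule enc_dec)
  obtain e1 z where e: "e = e1 * dE + z" "e1 < dE ^ n" "z < dE"
    using lt(5) by (rule enc_dec)
  obtain e1' z' where e': "e' = e1' * dE + z'" "e1' < dE ^ n" "z' < dE"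
    using lt(6) by (rule enc_dec)
  let ?A = "interleave dA dA' n" and ?B = "interleave dB dB' n"
  have \<Phi>: "\<Phi> (Suc n) (interleave dA dA' (Suc n) (a * dA + x, s * dA' + s1)) (interleave dB dB' (Suc n) (b * dB + y, t * dB' + t1)) (e * dE + z) =
      \<Phi> n (?A (a, s)) (?B (b, t)) e * \<psi> (x * dA' + s1) (y * dB' + t1) z"
    if "x < dA" "y < dB" "z < dE" "s1 < dA'" "t1 < dB'" for a b e x y z s s1 t t1
    using that by (simp add: \<Phi>_def enc_less)
  have "tensor_pow3 dA dB dE \<rho> (Suc n) $$ ((a * dB ^ Suc n + b) * dE ^ Suc n + e, (a' * dB ^ Suc n + b') * dE ^ Suc n + e') =
     tensor_pow3 dA dB dE \<rho> n $$ ((a1 * dB ^ n + b1) * dE ^ n + e1, (a1' * dB ^ n + b1') * dE ^ n + e1') *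
     \<rho> $$ ((x * dB + y) * dE + z, (x' * dB + y') * dE + z')"
    unfolding a(1) a'(1) b(1) b'(1) e(1) e'(1) power_Suc2
    by (rule tensor_pow3_Suc_entry[OF \<rho>(1) a(2) a'(2) b(2) b'(2) e(2) e'(2) a(3) a'(3) b(3) b'(3) e(3) e'(3)])
  also have "\<dots> = (\<Sum>s<dA' ^ n. \<Sum>s1<dA'. \<Sum>t<dB' ^ n. \<Sum>t1<dB'.
      (\<Phi> n (?A (a1, s)) (?B (b1, t)) e1 * cnj (\<Phi> n (?A (a1', s)) (?B (b1', t)) e1')) *
      (\<psi> (x * dA' + s1) (y * dB' + t1) z * cnj (\<psi> (x' * dA' + s1) (y' * dB' + t1) z')))"
    unfolding Suc.IH[OF a(2) a'(2) b(2) b'(2) e(2) e'(2)] \<rho>(2)[OF a(3) a'(3) b(3) b'(3) e(3) e'(3)]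
    by (rule sum_mult_sum4[symmetric])
  also have "\<dots> = (\<Sum>s<dA' ^ Suc n. \<Sum>t<dB' ^ Suc n.
      \<Phi> (Suc n) (interleave dA dA' (Suc n) (a, s)) (interleave dB dB' (Suc n) (b, t)) e *
      cnj (\<Phi> (Suc n) (interleave dA dA' (Suc n) (a', s)) (interleave dB dB' (Suc n) (b', t)) e'))"
    unfolding power_Suc2 sum_enc a(1) a'(1) b(1) b'(1) e(1) e'(1)
    by (intro sum.cong refl)
      (simp only: \<Phi>[OF a(3) b(3) e(3)] \<Phi>[OF a'(3) b'(3) e'(3)] lessThan_iff, simp only: complex_cnj_mult mult_ac)
  finally show ?case .
qed

lemma ptrace_entry:
  assumes "x < d1" "x' < d1" "y < d3" "y' < d3"
  shows "ptrace d1 d2 d3 X $$ (x * d3 + y, x' * d3 + y') =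
    (\<Sum>k<d2. X $$ ((x * d2 + k) * d3 + y, (x' * d2 + k) * d3 + y'))"
  using assms unfolding ptrace_def by (simp add: enc_less)

lemma ptrace_carrier: "ptrace d1 d2 d3 X \<in> carrier_mat (d1 * d3) (d1 * d3)"
  unfolding ptrace_def by simp

section \<open>The rate bound\<close>

text \<open>With \<open>c = \<delta> 2\<^sup>l\<close>, or \<open>c = 1\<close> if this is smaller than \<open>1\<close>.\<close>

lemma key_length_le:
  assumes E: "\<And>c. 1 \<le> c \<Longrightarrow> ereal ((1 - 2 * (\<epsilon> + c * (1 / 2 ^ l))) * log 2 c - 2) \<le> E"
    and \<epsilon>: "\<epsilon> \<le> \<delta>" and \<delta>: "0 < \<delta>" "\<delta> < 1 / 4"
  shows "ereal ((1 - 4 * \<delta>) * (real l + log 2 \<delta>) - 2) \<le> E"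
proof (cases "1 \<le> \<delta> * 2 ^ l")
  case True
  have lg: "log 2 (\<delta> * 2 ^ l) = real l + log 2 \<delta>"
    using \<delta> by (simp add: log_mult log_nat_power)
  then have "0 \<le> real l + log 2 \<delta>" using True \<delta> zero_le_log_cancel_iff[of 2 "\<delta> * 2 ^ l"] by simp
  \<comment> \<open>With c = \<delta> * 2 ^ l the second error c / 2 ^ l is \<delta>, and the first
    is at most \<delta>, so that 2 (\<epsilon> + \<delta>) <= 4 \<delta>.\<close>
  then have "(1 - 4 * \<delta>) * (real l + log 2 \<delta>) \<le> (1 - 2 * (\<epsilon> + \<delta>)) * (real l + log 2 \<delta>)"
    using \<epsilon> by (intro mult_right_mono) auto
  then have "ereal ((1 - 4 * \<delta>) * (real l + log 2 \<delta>) - 2) \<le> ereal ((1 - 2 * (\<epsilon> + \<delta>)) * (real l + log 2 \<delta>) - 2)"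
    by simp
  also have "\<dots> \<le> E" using E[OF True] unfolding lg by simp
  finally show ?thesis .
next
  case False
  \<comment> \<open>Here c = \<delta> * 2 ^ l would be below 1. The choice c = 1 yields the bound
    -2, and the claimed bound is no larger because its logarithmic factor is non-positive.\<close>
  then have "log 2 (\<delta> * 2 ^ l) \<le> 0" using \<delta> by simp
  moreover have "log 2 (\<delta> * 2 ^ l) = real l + log 2 \<delta>"
    using \<delta> by (simp add: log_mult log_nat_power)
  ultimately have "(1 - 4 * \<delta>) * (real l + log 2 \<delta>) \<le> 0" using \<delta> by (simp add: mult_nonneg_nonpos)
  then have "ereal ((1 - 4 * \<delta>) * (real l + log 2 \<delta>) - 2) \<le> ereal ((1 - 2 * (\<epsilon> + 1 * (1 / 2 ^ l))) * log 2 1 - 2)"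
    by simp
  also have "\<dots> \<le> E" by (rule E) simp
  finally show ?thesis .
qed

text \<open>The loss 4 \<delta> multiplies l n / n, which is not known to be bounded. Hence the
  proof compares with two real numbers x < y strictly between the two upper limits and chooses
  \<delta> by their gap; then only the size of y matters.\<close>

lemma limsup_rate_le:
  fixes E :: "nat \<Rightarrow> ereal" and l :: "nat \<Rightarrow> nat"
  assumes E: "\<And>n \<delta>. t n \<le> \<delta> \<Longrightarrow> 0 < \<delta> \<Longrightarrow> \<delta> < 1 / 4 \<Longrightarrow> ereal ((1 - 4 * \<delta>) * (real (l n) + log 2 \<delta>) - 2) \<le> E n"
    and t: "t \<longlonglongrightarrow> 0"
  shows "limsup (\<lambda>n. ereal (real (l n) / real n)) \<le> limsup (\<lambda>n. E n / ereal (real n))"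
proof (rule ccontr)
  assume "\<not> ?thesis"
  then have "limsup (\<lambda>n. E n / ereal (real n)) < limsup (\<lambda>n. ereal (real (l n) / real n))" by simp
  then obtain y where y: "limsup (\<lambda>n. E n / ereal (real n)) < ereal y" "ereal y < limsup (\<lambda>n. ereal (real (l n) / real n))"
    using ereal_dense2 by blast
  obtain x where x: "limsup (\<lambda>n. E n / ereal (real n)) < ereal x" "ereal x < ereal y"
    using ereal_dense2[OF y(1)] by blast
  have xy: "x < y" using x(2) by simp
  \<comment> \<open>Chosen such that 4 \<delta> |y| is at most half of the gap y - x. The 1 in the
    denominator covers y = 0, and 1 / 8 keeps \<delta> below 1 / 4.\<close>
  define \<delta> where "\<delta> = min (1 / 8) ((y - x) / (8 * (\<bar>y\<bar> + 1)))"
  have \<delta>: "0 < \<delta>" "\<delta> < 1 / 4" using xy by (auto simp: \<delta>_def min_def)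
  have "\<delta> * \<bar>y\<bar> \<le> (y - x) / (8 * (\<bar>y\<bar> + 1)) * (\<bar>y\<bar> + 1)"
    using xy by (intro mult_mono) (auto simp: \<delta>_def)
  also have "\<dots> = (y - x) / 8" by (simp add: field_simps)
  finally have \<delta>y: "4 * \<delta> * \<bar>y\<bar> \<le> (y - x) / 2" by simp
  define C where "C = \<bar>(1 - 4 * \<delta>) * log 2 \<delta> - 2\<bar>"
  \<comment> \<open>From n0 on, the additive constant C costs less than the other half of the gap,
    scaled by n.\<close>
  obtain n0 where n0: "2 * C / (y - x) < real n0" using reals_Archimedean2 by blast
  have "eventually (\<lambda>n. E n / ereal (real n) < ereal x) sequentially"
    by (rule Limsup_lessD[OF x(1)])
  moreover have "eventually (\<lambda>n. t n < \<delta>) sequentially"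
    using order_tendstoD(2)[OF t \<delta>(1)] .
  moreover have "eventually (\<lambda>n. max 1 n0 \<le> n) sequentially" by (rule eventually_ge_at_top)
  ultimately have "eventually (\<lambda>n. ereal (real (l n) / real n) \<le> ereal y) sequentially"
  proof eventually_elim
    case (elim n)
    then have n: "0 < n" "n0 \<le> n" by auto
    let ?r = "real (l n) / real n"
    have "ereal ((1 - 4 * \<delta>) * (real (l n) + log 2 \<delta>) - 2) / ereal (real n) \<le> E n / ereal (real n)"
      by (intro ereal_divide_right_mono E) (use elim n \<delta> in auto)
    also have "\<dots> < ereal x" using elim by simp
    finally have "((1 - 4 * \<delta>) * (real (l n) + log 2 \<delta>) - 2) / real n < x" using n by simp
    then have "(1 - 4 * \<delta>) * (real (l n) + log 2 \<delta>) - 2 < x * real n"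
      using n by (simp add: divide_less_eq)
    then have "(1 - 4 * \<delta>) * real (l n) - C < x * real n"
      unfolding C_def by (simp add: algebra_simps)
    moreover have "2 * C < y * real n - x * real n"
    proof -
      have "2 * C / (y - x) < real n" using n0 n by (meson less_le_trans of_nat_le_iff)
      then show ?thesis using xy by (simp add: field_simps)
    qed
    ultimately have main: "2 * ((1 - 4 * \<delta>) * real (l n)) < x * real n + y * real n"
      by (simp add: algebra_simps)
    show ?case
    proof (rule ccontr)
      assume "\<not> ?case"
      then have "y < ?r" by simp
      then have "y * real n < real (l n)" using n by (simp add: less_divide_eq)
      then have "(1 - 4 * \<delta>) * (y * real n) \<le> (1 - 4 * \<delta>) * real (l n)"
        using \<delta> by (intro mult_left_mono) auto
      with main have "(2 * ((1 - 4 * \<delta>) * y)) * real n < (x + y) * real n" by (simp add: algebra_simps)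
      then have "2 * ((1 - 4 * \<delta>) * y) < x + y" using n by simp
      moreover have "4 * \<delta> * y \<le> 4 * \<delta> * \<bar>y\<bar>" using \<delta> by (intro mult_left_mono) auto
      ultimately show False using \<delta>y by (simp add: algebra_simps)
    qed
  qed
  then have "limsup (\<lambda>n. ereal (real (l n) / real n)) \<le> ereal y" by (rule Limsup_bounded)
  with y(2) show False by simp
qed

theorem theorem3p11:
  fixes dA dA' dB dB' dE :: nat and \<rho>_ABE \<Psi> \<rho>_AA'BB' :: "complex mat"
  assumes "density_op (dA * dB * dE) \<rho>_ABE"
    and "pure_state (dA * dA' * dB * dB' * dE) \<Psi>"
    and "\<rho>_ABE = ptrace dA dA' (dB * dE) (ptrace (dA * dA' * dB) dB' dE \<Psi>)"
    and "\<rho>_AA'BB' = ptrace (dA * dA' * dB * dB') dE 1 \<Psi>"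
  shows "key_rate dA dB dE \<rho>_ABE \<le> reg_rel_ent_entanglement (dA * dA') (dB * dB') \<rho>_AA'BB'
       \<and> reg_rel_ent_entanglement (dA * dA') (dB * dB') \<rho>_AA'BB'
           \<le> rel_ent_entanglement (dA * dA') (dB * dB') \<rho>_AA'BB'"
proof -
  let ?U = "dA * dA'" and ?V = "dB * dB'"
  obtain g where g: "g \<in> carrier_vec (dA * dA' * dB * dB' * dE)" "g \<bullet>c g = 1" "\<Psi> = ketbra g"
    using assms(2) unfolding pure_state_def by blast
  \<comment> \<open>The amplitudes of the pure state with A A' read as one index and B B' as
    another; both reduced states are expressed through them.\<close>
  define \<psi> where "\<psi> u v e = g $ ((u * ?V + v) * dE + e)" for u v e
  have dim: "dA * dA' * dB * dB' * dE = ?U * ?V * dE" by simp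
  have \<Psi>: "\<Psi> $$ ((u * ?V + v) * dE + e, (u' * ?V + v') * dE + e') = \<psi> u v e * cnj (\<psi> u' v' e')"
    if "u < ?U" "u' < ?U" "v < ?V" "v' < ?V" "e < dE" "e' < dE" for u u' v v' e e'
    using g(1) enc3_less[OF that(1,3,5)] enc3_less[OF that(2,4,6)]
    unfolding g(3) ketbra_def \<psi>_def dim by simp
  have \<rho>2c: "\<rho>_AA'BB' \<in> carrier_mat (?U * ?V) (?U * ?V)"
    using ptrace_carrier[of "dA * dA' * dB * dB'" dE 1 \<Psi>] unfolding assms(4) by (simp add: mult.assoc)
  have \<rho>2: "\<rho>_AA'BB' $$ (u * ?V + v, u' * ?V + v') = (\<Sum>e<dE. \<psi> u v e * cnj (\<psi> u' v' e))"
    if uv: "u < ?U" "u' < ?U" "v < ?V" "v' < ?V" for u u' v v'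
  proof -
    have lt: "u * ?V + v < dA * dA' * dB * dB'" "u' * ?V + v' < dA * dA' * dB * dB'"
      using enc_less[OF uv(1,3)] enc_less[OF uv(2,4)] by (simp_all add: mult.assoc)
    have "\<rho>_AA'BB' $$ ((u * ?V + v) * 1 + 0, (u' * ?V + v') * 1 + 0) =
        (\<Sum>k<dE. \<Psi> $$ (((u * ?V + v) * dE + k) * 1 + 0, ((u' * ?V + v') * dE + k) * 1 + 0))"
      unfolding assms(4) by (rule ptrace_entry[OF lt]) simp_all
    then show ?thesis using uv by (simp add: \<Psi>)
  qed
  have \<rho>3c: "\<rho>_ABE \<in> carrier_mat (dA * dB * dE) (dA * dB * dE)"
    using assms(1) by (simp add: density_op_def)
  have \<rho>3: "\<rho>_ABE $$ ((a * dB + b) * dE + e, (a' * dB + b') * dE + e') =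
      (\<Sum>s<dA'. \<Sum>t<dB'. \<psi> (a * dA' + s) (b * dB' + t) e * cnj (\<psi> (a' * dA' + s) (b' * dB' + t) e'))"
    if lt: "a < dA" "a' < dA" "b < dB" "b' < dB" "e < dE" "e' < dE" for a a' b b' e e'
  proof -
    have i: "(a * dB + b) * dE + e = a * (dB * dE) + (b * dE + e)" for a b e by (simp add: algebra_simps)
    have j: "(x * dB + b) * dB' + t = x * ?V + (b * dB' + t)" for x b t by (simp add: algebra_simps)
    have "\<rho>_ABE $$ ((a * dB + b) * dE + e, (a' * dB + b') * dE + e') =
      (\<Sum>s<dA'. ptrace (dA * dA' * dB) dB' dE \<Psi> $$ ((a * dA' + s) * (dB * dE) + (b * dE + e), (a' * dA' + s) * (dB * dE) + (b' * dE + e')))"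
      unfolding assms(3) i by (rule ptrace_entry) (simp_all only: enc_less lt)
    also have "\<dots> = (\<Sum>s<dA'. \<Sum>t<dB'. \<Psi> $$ (((a * dA' + s) * ?V + (b * dB' + t)) * dE + e, ((a' * dA' + s) * ?V + (b' * dB' + t)) * dE + e'))"
    proof (rule sum.cong[OF refl])
      fix s assume "s \<in> {..<dA'}"
      then have s: "s < dA'" by simp
      show "ptrace (dA * dA' * dB) dB' dE \<Psi> $$ ((a * dA' + s) * (dB * dE) + (b * dE + e), (a' * dA' + s) * (dB * dE) + (b' * dE + e')) =
        (\<Sum>t<dB'. \<Psi> $$ (((a * dA' + s) * ?V + (b * dB' + t)) * dE + e, ((a' * dA' + s) * ?V + (b' * dB' + t)) * dE + e'))"
        unfolding i[symmetric] j[symmetric] by (rule ptrace_entry) (simp_all only: enc_less lt s)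
    qed
    also have "\<dots> = (\<Sum>s<dA'. \<Sum>t<dB'. \<psi> (a * dA' + s) (b * dB' + t) e * cnj (\<psi> (a' * dA' + s) (b' * dB' + t) e'))"
      by (intro sum.cong refl \<Psi>) (simp_all only: enc_less lt lessThan_iff)
    finally show ?thesis .
  qed
  have \<rho>2d: "density_op (?U * ?V) \<rho>_AA'BB'"
  proof -
    have "psd \<rho>_AA'BB'"
    proof (rule psd_of_gram[OF \<rho>2c, where K = "{..<dE}" and g = "\<lambda>e i. \<psi> (i div ?V) (i mod ?V) e"])
      fix i j assume i: "i < ?U * ?V" and j: "j < ?U * ?V"
      show "\<rho>_AA'BB' $$ (i, j) = (\<Sum>e<dE. \<psi> (i div ?V) (i mod ?V) e * cnj (\<psi> (j div ?V) (j mod ?V) e))"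
        using \<rho>2[OF enc_bounds(1)[OF i] enc_bounds(1)[OF j] enc_bounds(2)[OF i] enc_bounds(2)[OF j]]
        by (simp only: div_mult_mod_eq)
    qed
    moreover have "mtrace \<rho>_AA'BB' = g \<bullet>c g"
    proof -
      have "mtrace \<rho>_AA'BB' = (\<Sum>u<?U. \<Sum>v<?V. \<Sum>e<dE. \<psi> u v e * cnj (\<psi> u v e))"
        using \<rho>2c by (auto simp: mtrace_def sum_enc[where b = ?V] \<rho>2)
      also have "\<dots> = (\<Sum>i<?U * ?V * dE. g $ i * cnj (g $ i))"
        unfolding sum_enc[where b = dE] sum_enc[where b = ?V] by (simp add: \<psi>_def)
      finally show ?thesis using g(1) unfolding dim by (simp add: scalar_prod_def atLeast0LessThan)
    qed
    ultimately show ?thesis using \<rho>2c g(2) by (simp add: density_op_def)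
  qed
  have "key_rate dA dB dE \<rho>_ABE \<le> reg_rel_ent_entanglement ?U ?V \<rho>_AA'BB'"
    unfolding key_rate_def
  proof (rule Sup_least)
    fix r assume "r \<in> {R. \<exists>a b e P. lopc_protocol dA dB dE a b e P \<and> distills_at_rate dA dB dE \<rho>_ABE a b e P R}"
    then obtain a b e P l \<tau> where P: "\<And>n. lopc (dA ^ n, dB ^ n, dE ^ n) (a n, b n, e n) (P n)"
      and l: "\<And>n. 2 ^ l n \<le> a n" "\<And>n. 2 ^ l n \<le> b n" "\<And>n. density_op (e n) (\<tau> n)"
      and r: "limsup (\<lambda>n. ereal (real (l n) / real n)) = r"
      and td: "(\<lambda>n. trace_dist (P n (tensor_pow3 dA dB dE \<rho>_ABE n)) (key_state (a n) (b n) (l n) (\<tau> n))) \<longlonglongrightarrow> 0"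
      unfolding lopc_protocol_def distills_at_rate_def by blast
    \<comment> \<open>The bound from the privacy test on the probability that the n-copy state is
      rejected; it tends to 0 with the trace distance.\<close>
    define t where "t n = 2 * sqrt (2 * trace_dist (P n (tensor_pow3 dA dB dE \<rho>_ABE n)) (key_state (a n) (b n) (l n) (\<tau> n)))" for n
    have t: "t \<longlonglongrightarrow> 0"
      using tendsto_mult_left[OF tendsto_real_sqrt[OF tendsto_mult_left[OF td, of 2]], of 2] unfolding t_def by simp
    let ?E = "\<lambda>n. rel_ent_entanglement (?U ^ n) (?V ^ n) (tensor_pow2 ?U ?V \<rho>_AA'BB' n)"
    have bound: "ereal ((1 - 2 * (t n + c * (1 / 2 ^ l n))) * log 2 c - 2) \<le> ?E n" if c: "1 \<le> c" for n c
    proof -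
      let ?\<psi> = "amplitude_pow ?U ?V dE \<psi> n"
      obtain Z :: "(nat \<times> nat) set" and w :: "nat \<times> nat \<Rightarrow> nat \<times> nat \<Rightarrow> complex" where Z: "finite Z"
        "\<And>f. sqnorm Z (\<lambda>z. \<Sum>s\<in>{..<?U ^ n} \<times> {..<?V ^ n}. w z s * f s) \<le> sqnorm ({..<?U ^ n} \<times> {..<?V ^ n}) f"
        "\<And>g h. sqnorm Z (\<lambda>z. \<Sum>s\<in>{..<?U ^ n} \<times> {..<?V ^ n}. w z s * (g (fst s) * h (snd s))) \<le>
           sqnorm {..<?U ^ n} g * sqnorm {..<?V ^ n} h / 2 ^ l n"
        "1 - t n \<le> (\<Sum>e<dE ^ n. sqnorm Z (\<lambda>z. \<Sum>s\<in>{..<?U ^ n} \<times> {..<?V ^ n}. w z s * ?\<psi> (fst s) (snd s) e))"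
        by (rule lopc_privacy_test[where \<psi> = ?\<psi> and \<iota> = "interleave dA dA' n" and \<kappa> = "interleave dB dB' n",
              OF P bij_interleave bij_interleave tensor_pow3_carrier
              tensor_pow3_purification[where n = n and dA' = dA' and dB' = dB' and \<psi> = \<psi>, OF \<rho>3c \<rho>3] l, folded t_def])
          (rule that | assumption)+
      show ?thesis
      proof (rule rel_ent_entanglement_ge[where \<psi> = ?\<psi>, OF density_tensor_pow2[OF \<rho>2d] tensor_pow2_purification[OF \<rho>2c \<rho>2] Z(1,2) _ Z(4) c])
        show "sqnorm Z (\<lambda>z. \<Sum>s\<in>{..<?U ^ n} \<times> {..<?V ^ n}. w z s * (g (fst s) * h (snd s))) \<le>
           sqnorm {..<?U ^ n} g * sqnorm {..<?V ^ n} h * (1 / 2 ^ l n)" for g h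
          using Z(3)[of g h] by simp
      qed
    qed
    show "r \<le> reg_rel_ent_entanglement ?U ?V \<rho>_AA'BB'"
      unfolding reg_rel_ent_entanglement_def r[symmetric]
      by (rule limsup_rate_le[OF key_length_le[OF bound] t])
  qed
  moreover have "reg_rel_ent_entanglement ?U ?V \<rho>_AA'BB' \<le> rel_ent_entanglement ?U ?V \<rho>_AA'BB'"
    by (rule reg_rel_ent_entanglement_le[OF \<rho>2d])
  ultimately show ?thesis ..
qed

end
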